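(* Let $k\ge 3$ and $m\ge 2$, and let $G$ be a $k$-uniform unicyclic hypergraph of size $m$ whose transmission is maximum among all $k$-uniform unicyclic hypergraphs of size $m$. Then $G\cong \widetilde{C}^k_2\left(\left\lfloor\frac{m-2}{2}\right\rfloor,\left\lceil\frac{m-2}{2}\right\rceil\right)$.
   Context: A hypergraph $G=(V,E)$ has a finite nonempty vertex set $V$ and a family $E$ of subsets of $V$ (edges); it is $k$-uniform if every edge has exactly $k$ vertices; its size is $|E|$. A walk is an alternating sequence $(v_0,e_1,v_1,\dots,e_p,v_p)$ with $v_{i-1}\ne v_i$ and $v_{i-1},v_i\in e_i$; a path is a walk with all vertices and all edges distinct, its length being $p$; a cycle is a walk with at least two edges, all edges distinct and all vertices distinct except $v_0=v_p$. $G$ is connected if any two vertices are joined by a path, and unicyclic if connected with exactly one cycle. The distance $d_G(u,v)$ is the length of a shortest path, and the transmission is $\sigma(G)=\sum_{\{u,v\}\subseteq V(G)} d_G(u,v)$ over unordered pairs of distinct vertices. Attaching a pendant path of length $r\ge 1$ at a vertex $w$ means adding new edges $f_1,\dots,f_r$ where $f_i=\{x_{i-1}\}\cup Y_i$ with $x_0=w$, each $Y_i$ a set of $k-1$ new vertices, the sets $Y_i$ pairwise disjoint, and $x_i\in Y_i$; attaching a path of length $0$ means adding nothing. For integers $a,b\ge 0$, $\widetilde{C}^k_2(a,b)$ is the $k$-uniform hypergraph obtained from the two edges $e=\{u,v,w_1,\dots,w_{k-2}\}$ and $f=\{u,v,w'_1,\dots,w'_{k-2}\}$ (all listed vertices distinct)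 by attaching a pendant path of length $a$ at $w_1$ and a pendant path of length $b$ at $w'_1$, using disjoint sets of new vertices. *)

theory Defs
  imports Complex_Main
begin

text \<open>
  The edges form a set rather than a multiset. For \<open>k \<ge> 3\<close> this loses nothing for \<open>k\<close>-uniform
  unicyclic hypergraphs: a repeated edge would give a cycle of length 2 for each pair of its
  vertices, hence more than one cycle.
\<close>

record 'a hypergraph =
  verts :: "'a set"
  edges :: "'a set set"

definition hypergraph :: "'a hypergraph \<Rightarrow> bool" where
  "hypergraph G \<longleftrightarrow> finite (verts G) \<and> verts G \<noteq> {} \<and> edges G \<subseteq> Pow (verts G)"

definition uniform :: "nat \<Rightarrow> 'a hypergraph \<Rightarrow> bool" where
  "uniform k G \<longleftrightarrow> (\<forall>e\<in>edges G. card e = k)"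

definition hsize :: "'a hypergraph \<Rightarrow> nat" where
  "hsize G = card (edges G)"

text \<open>
  The walk \<open>(v\<^sub>0, e\<^sub>1, v\<^sub>1, \<dots>, e\<^sub>p, v\<^sub>p)\<close> is given by the two lists
  \<open>vs = [v\<^sub>0, \<dots>, v\<^sub>p]\<close> and \<open>es = [e\<^sub>1, \<dots>, e\<^sub>p]\<close>, so \<open>es ! i\<close> is \<open>e\<^sub>i\<^sub>+\<^sub>1\<close>.
\<close>

definition walk :: "'a hypergraph \<Rightarrow> 'a list \<Rightarrow> 'a set list \<Rightarrow> bool" where
  "walk G vs es \<longleftrightarrow>
     length vs = Suc (length es) \<and> set vs \<subseteq> verts G \<and> set es \<subseteq> edges G \<and>
     (\<forall>i<length es. vs ! i \<noteq> vs ! Suc i \<and> vs ! i \<in> es ! i \<and> vs ! Suc i \<in> es ! i)"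

definition path :: "'a hypergraph \<Rightarrow> 'a list \<Rightarrow> 'a set list \<Rightarrow> bool" where
  "path G vs es \<longleftrightarrow> walk G vs es \<and> distinct vs \<and> distinct es"

definition path_between :: "'a hypergraph \<Rightarrow> 'a \<Rightarrow> 'a \<Rightarrow> 'a list \<Rightarrow> 'a set list \<Rightarrow> bool" where
  "path_between G u v vs es \<longleftrightarrow> path G vs es \<and> hd vs = u \<and> last vs = v"

definition cycle :: "'a hypergraph \<Rightarrow> 'a list \<Rightarrow> 'a set list \<Rightarrow> bool" where
  "cycle G vs es \<longleftrightarrow>
     walk G vs es \<and> 2 \<le> length es \<and> distinct es \<and> distinct (butlast vs) \<and> hd vs = last vs"

text \<open>
  Cycles are counted up to the choice of the starting vertex and of the direction. Cycles with
  the same edges but different vertices are different: two edges meeting in three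
  vertices carry three cycles.
\<close>

definition same_cycle :: "'a list \<Rightarrow> 'a set list \<Rightarrow> 'a list \<Rightarrow> 'a set list \<Rightarrow> bool" where
  "same_cycle vs es vs' es' \<longleftrightarrow>
     (\<exists>n. butlast vs' = rotate n (butlast vs) \<and> es' = rotate n es) \<or>
     (\<exists>n. butlast vs' = rotate n (butlast (rev vs)) \<and> es' = rotate n (rev es))"

definition connected :: "'a hypergraph \<Rightarrow> bool" where
  "connected G \<longleftrightarrow> (\<forall>u\<in>verts G. \<forall>v\<in>verts G. \<exists>vs es. path_between G u v vs es)"

definition unicyclic :: "'a hypergraph \<Rightarrow> bool" where
  "unicyclic G \<longleftrightarrow>
     connected G \<and> (\<exists>vs es. cycle G vs es) \<and>
     (\<forall>vs es vs' es'. cycle G vs es \<longrightarrow> cycle G vs' es' \<longrightarrow> same_cycle vs es vs' es')"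

definition distance :: "'a hypergraph \<Rightarrow> 'a \<Rightarrow> 'a \<Rightarrow> nat" where
  "distance G u v = (LEAST p. \<exists>vs es. path_between G u v vs es \<and> length es = p)"

lemma path_between_rev:
  assumes "path_between G u v vs es"
  shows "path_between G v u (rev vs) (rev es)"
proof -
  have w: "walk G vs es" and d: "distinct vs" "distinct es" and h: "hd vs = u" "last vs = v"
    using assms by (auto simp: path_between_def path_def)
  have l: "length vs = Suc (length es)" using w by (simp add: walk_def)
  have "rev vs ! i \<noteq> rev vs ! Suc i \<and> rev vs ! i \<in> rev es ! i \<and> rev vs ! Suc i \<in> rev es ! i"
    if i: "i < length es" for i
  proof -
    define j where "j = length es - Suc i"
    have j: "j < length es" using i by (simp add: j_def)
    have "rev vs ! i = vs ! Suc j" "rev vs ! Suc i = vs ! j" "rev es ! i = es ! j"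
      using i l by (auto simp: rev_nth j_def Suc_diff_Suc)
    thus ?thesis using w j by (auto simp: walk_def)
  qed
  hence "walk G (rev vs) (rev es)" using w by (auto simp: walk_def)
  moreover have "vs \<noteq> []" using l by auto
  ultimately show ?thesis using d h
    by (auto simp: path_between_def path_def hd_rev last_rev)
qed

lemma distance_commute: "distance G u v = distance G v u"
proof -
  have "(\<exists>vs es. path_between G u v vs es \<and> length es = p) \<longleftrightarrow>
        (\<exists>vs es. path_between G v u vs es \<and> length es = p)" for p
    by (metis path_between_rev length_rev)
  thus ?thesis by (simp add: distance_def)
qed

text \<open>
  The sum runs over the two-element subsets \<open>S = {u, v}\<close>; by symmetry of the distance the
  definite description does not depend on the order of \<open>u\<close> and \<open>v\<close>.
\<close>

definition transmission :: "'a hypergraph \<Rightarrow> nat" where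
  "transmission G =
     (\<Sum>S\<in>{S. S \<subseteq> verts G \<and> card S = 2}. THE d. \<exists>u v. S = {u, v} \<and> d = distance G u v)"

lemma the_distance: "(THE d. \<exists>x y. {u, v} = {x, y} \<and> d = distance G x y) = distance G u v"
  by (rule the_equality) (auto simp: doubleton_eq_iff distance_commute)

definition isomorphic :: "'a hypergraph \<Rightarrow> 'b hypergraph \<Rightarrow> bool" where
  "isomorphic G H \<longleftrightarrow>
     (\<exists>f. bij_betw f (verts G) (verts H) \<and> (\<lambda>e. f ` e) ` edges G = edges H)"

text \<open>
  Attaching a pendant path of length \<open>r\<close> at \<open>w\<close>. The new vertices are
  \<open>Y\<^sub>i = {y i j | j < k - 1}\<close> for \<open>1 \<le> i \<le> r\<close>, and the vertex \<open>x\<^sub>i \<in> Y\<^sub>i\<close> is \<open>y i 0\<close>. The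
  labelling \<open>y\<close> is meant to be injective with values outside the hypergraph.
\<close>

definition pendant_block :: "nat \<Rightarrow> (nat \<Rightarrow> nat \<Rightarrow> 'a) \<Rightarrow> nat \<Rightarrow> 'a set" where
  "pendant_block k y i = y i ` {..<k - 1}"

definition pendant_edge :: "nat \<Rightarrow> 'a \<Rightarrow> (nat \<Rightarrow> nat \<Rightarrow> 'a) \<Rightarrow> nat \<Rightarrow> 'a set" where
  "pendant_edge k w y i = {if i = 1 then w else y (i - 1) 0} \<union> pendant_block k y i"

definition attach_path ::
    "nat \<Rightarrow> 'a \<Rightarrow> (nat \<Rightarrow> nat \<Rightarrow> 'a) \<Rightarrow> nat \<Rightarrow> 'a hypergraph \<Rightarrow> 'a hypergraph" where
  "attach_path k w y r G =
     \<lparr>verts = verts G \<union> (\<Union>i\<in>{1..r}. pendant_block k y i),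
      edges = edges G \<union> pendant_edge k w y ` {1..r}\<rparr>"

text \<open>
  Labels for the vertices \<open>u\<close>, \<open>v\<close>, \<open>w\<^sub>i\<close>, \<open>w'\<^sub>i\<close>, and for the vertices of the pendant
  paths at \<open>w\<^sub>1\<close> and at \<open>w'\<^sub>1\<close>.
\<close>

datatype c2_vertex =
  VU | VV | VW nat | VW' nat | VY nat nat | VY' nat nat

definition C2_base :: "nat \<Rightarrow> c2_vertex hypergraph" where
  "C2_base k =
     (let e = {VU, VV} \<union> VW ` {1..k - 2}; f = {VU, VV} \<union> VW' ` {1..k - 2}
      in \<lparr>verts = e \<union> f, edges = {e, f}\<rparr>)"

definition C2_tilde :: "nat \<Rightarrow> nat \<Rightarrow> nat \<Rightarrow> c2_vertex hypergraph" where
  "C2_tilde k a b = attach_path k (VW' 1) VY' b (attach_path k (VW 1) VY a (C2_base k))"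

end

theory Submission
  imports Defs
begin

text \<open>
  Write \<open>k = K + 1\<close>. A cycle forces at most \<open>m K\<close> vertices (a tree has one more), and this together with
  connectedness is all that the upper bound uses; it is proved by induction on the number \<open>m\<close> of edges by
  removing an edge whose removal keeps the rest connected, for instance one of maximal level, the level of
  an edge being one more than its distance from a fixed vertex.

  If some such edge \<open>e\<close> shares at least two vertices with the rest, then the rest is bounded by the loose
  path, and the private vertices of \<open>e\<close> are at most as far from the rest as in \<open>C2_tilde\<close> with one empty
  pendant path. Otherwise all such edges are leaf edges, and removing a leaf edge with private vertex
  \<open>z\<close> costs essentially the sum of the distances from \<open>z\<close>. Take private vertices \<open>z1\<close>, \<open>z2\<close> of two leaf
  edges. The levels seen from \<open>z\<close> have no gaps, so their sum is at most \<open>1 + \<dots> + m\<close>, and each missing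
  vertex costs the level of its edge. If a geodesic from \<open>z1\<close> to \<open>z2\<close> misses an edge, some edge has a repeated
  level from both ends, and one of the two distance sums is small. If it runs through all edges, the edges
  form a chain in which some consecutive pair \<open>a\<close>, \<open>a + 1\<close> meets twice, and the two distance sums fall
  short of the maximum by at least \<open>a + 2\<close> and \<open>m - a\<close>. The larger of these is smallest in the balanced
  case.
\<close>

subsection \<open>Distance in a set system\<close>

text \<open>Distances are read off the edge set alone, so that removing an edge is a set difference
  and no vertex set has to be carried along. All sums run over ordered pairs, so the bounds concern
  twice the transmission.

  The inequality \<open>card (\<Union>E) \<le> card E * K\<close> passes to the rest when a leaf
  edge is removed, because both sides drop by K. When an edge sharing more vertices is removed it
  may be lost, and then only the comparison with the loose path remains.

  One leaf edge does not suffice: if the doubled pair of the chain is near it, its distance sum is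
  too close to the maximum for the recursion of \<open>cyc_bound\<close>. At the two ends of a chain
  with m = n + 3 edges the losses add up to m + 2, so the larger is at least n div 2 + 3, which is
  the term subtracted in that recursion.\<close>

definition adj :: "'a set set \<Rightarrow> ('a \<times> 'a) set" where
  "adj E = {(x, y). \<exists>e\<in>E. x \<in> e \<and> y \<in> e}"

definition dst :: "'a set set \<Rightarrow> 'a \<Rightarrow> 'a \<Rightarrow> nat" where
  "dst E x y = (LEAST n. (x, y) \<in> adj E ^^ n)"

definition conn :: "'a set set \<Rightarrow> bool" where
  "conn E \<longleftrightarrow> (\<forall>x\<in>\<Union>E. \<forall>y\<in>\<Union>E. (x, y) \<in> (adj E)\<^sup>*)"

lemma adjI: "e \<in> E \<Longrightarrow> x \<in> e \<Longrightarrow> y \<in> e \<Longrightarrow> (x, y) \<in> adj E"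
  by (auto simp: adj_def)

lemma adj_sym: "(x, y) \<in> adj E \<Longrightarrow> (y, x) \<in> adj E"
  by (auto simp: adj_def)

lemma adj_mono: "E' \<subseteq> E \<Longrightarrow> adj E' \<subseteq> adj E"
  by (auto simp: adj_def)

lemma relpow_adj_sym: "(x, y) \<in> adj E ^^ n \<Longrightarrow> (y, x) \<in> adj E ^^ n"
proof (induction n arbitrary: y)
  case (Suc n)
  then obtain w where "(x, w) \<in> adj E ^^ n" "(w, y) \<in> adj E" by auto
  then show ?case using Suc.IH adj_sym relpow_Suc_I2 by metis
qed auto

lemma relpow_adj_mono: "E' \<subseteq> E \<Longrightarrow> (x, y) \<in> adj E' ^^ n \<Longrightarrow> (x, y) \<in> adj E ^^ n"
proof (induction n arbitrary: y)
  case (Suc n)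
  then show ?case using adj_mono[of E' E] by auto
qed auto

lemma dst_le: "(x, y) \<in> adj E ^^ n \<Longrightarrow> dst E x y \<le> n"
  unfolding dst_def by (rule Least_le)

lemma dst_self [simp]: "dst E x x = 0"
  using dst_le[of x x 0 E] by simp

lemma dst_sym: "dst E x y = dst E y x"
proof -
  have "(x, y) \<in> adj E ^^ n \<longleftrightarrow> (y, x) \<in> adj E ^^ n" for n
    using relpow_adj_sym by metis
  then show ?thesis by (simp add: dst_def)
qed

lemma dst_relpow:
  assumes "conn E" "x \<in> \<Union>E" "y \<in> \<Union>E"
  shows "(x, y) \<in> adj E ^^ dst E x y"
proof -
  have "(x, y) \<in> (adj E)\<^sup>*" using assms by (auto simp: conn_def)
  then obtain n where "(x, y) \<in> adj E ^^ n" using rtrancl_imp_relpow by blast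
  then show ?thesis unfolding dst_def by (rule LeastI)
qed

lemma dst_triangle:
  assumes "conn E" "x \<in> \<Union>E" "y \<in> \<Union>E" "z \<in> \<Union>E"
  shows "dst E x z \<le> dst E x y + dst E y z"
proof -
  have "(x, z) \<in> adj E ^^ (dst E x y + dst E y z)"
    using dst_relpow[OF assms(1-3)] dst_relpow[OF assms(1,3,4)]
    by (auto simp: relpow_add)
  then show ?thesis by (rule dst_le)
qed

lemma dst_edge: "e \<in> E \<Longrightarrow> x \<in> e \<Longrightarrow> y \<in> e \<Longrightarrow> dst E x y \<le> 1"
  using dst_le[of x y 1 E] by (simp add: adjI)

lemma dst_step:
  assumes "conn E" "x \<in> \<Union>E" "e \<in> E" "y \<in> e" "y' \<in> e"
  shows "dst E x y' \<le> Suc (dst E x y)"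
  using dst_triangle[of E x y y'] dst_edge[of e E y y'] assms by fastforce

lemma dst_eq_0:
  assumes "conn E" "x \<in> \<Union>E" "y \<in> \<Union>E"
  shows "dst E x y = 0 \<longleftrightarrow> x = y"
  using dst_relpow[OF assms] by auto

lemma dst_edge_eq:
  assumes "conn E" "e \<in> E" "x \<in> e" "y \<in> e" "x \<noteq> y"
  shows "dst E x y = 1"
  using dst_edge[of e E x y] dst_eq_0[of E x y] assms by fastforce

lemma dst_pred:
  assumes "conn E" "x \<in> \<Union>E" "y \<in> \<Union>E" "x \<noteq> y"
  obtains e w where "e \<in> E" "w \<in> e" "y \<in> e" "dst E x y = Suc (dst E x w)"
proof -
  obtain n where n: "dst E x y = Suc n"
    using assms dst_eq_0 by (metis not0_implies_Suc)
  then have "(x, y) \<in> adj E ^^ Suc n" using dst_relpow[OF assms(1-3)] by simp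
  then obtain w where w: "(x, w) \<in> adj E ^^ n" "(w, y) \<in> adj E" by auto
  then obtain e where e: "e \<in> E" "w \<in> e" "y \<in> e" by (auto simp: adj_def)
  have "dst E x w \<le> n" by (rule dst_le[OF w(1)])
  moreover have "dst E x y \<le> Suc (dst E x w)" using dst_step assms e by metis
  ultimately show ?thesis using that e n by force
qed

text \<open>Along a walk of length n a function that grows by at most 1 inside each edge grows by at
  most n. Lower bounds for distances are obtained by guessing the distance function and checking it
  one edge at a time.\<close>

lemma dst_ge_lipschitz:
  fixes \<phi> :: "'a \<Rightarrow> nat"
  assumes "conn E" "x \<in> \<Union>E" "y \<in> \<Union>E"
    and lip: "\<And>e u v. e \<in> E \<Longrightarrow> u \<in> e \<Longrightarrow> v \<in> e \<Longrightarrow> \<phi> v \<le> Suc (\<phi> u)"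
  shows "\<phi> y \<le> \<phi> x + dst E x y"
proof -
  have "(x, y) \<in> adj E ^^ n \<Longrightarrow> \<phi> y \<le> \<phi> x + n" for n
  proof (induction n arbitrary: y)
    case (Suc n)
    then obtain w where w: "(x, w) \<in> adj E ^^ n" "(w, y) \<in> adj E" by auto
    then have "\<phi> y \<le> Suc (\<phi> w)" using lip by (auto simp: adj_def)
    then show ?case using Suc.IH[OF w(1)] by simp
  qed auto
  then show ?thesis using dst_relpow[OF assms(1-3)] by blast
qed

lemma dst_antimono:
  assumes "conn E'" "E' \<subseteq> E" "x \<in> \<Union>E'" "y \<in> \<Union>E'"
  shows "dst E x y \<le> dst E' x y"
  by (rule dst_le[OF relpow_adj_mono[OF assms(2) dst_relpow[OF assms(1,3,4)]]])

lemma geodesic: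
  assumes "conn E" "x \<in> \<Union>E" "y \<in> \<Union>E"
  obtains f p where "f 0 = x" "f (dst E x y) = y"
    "\<And>i. i \<le> dst E x y \<Longrightarrow> f i \<in> \<Union>E \<and> dst E x (f i) = i \<and> dst E y (f i) = dst E x y - i"
    "\<And>i. i < dst E x y \<Longrightarrow> p i \<in> E \<and> f i \<in> p i \<and> f (Suc i) \<in> p i"
    "inj_on f {..dst E x y}" "inj_on p {..<dst E x y}"
proof -
  define D where "D = dst E x y"
  have "(x, y) \<in> adj E ^^ D" using dst_relpow[OF assms] by (simp add: D_def)
  then obtain f where f: "f 0 = x" "f D = y" "\<And>i. i < D \<Longrightarrow> (f i, f (Suc i)) \<in> adj E"
    by (auto simp: relpow_fun_conv)
  have "\<forall>i. \<exists>e. i < D \<longrightarrow> e \<in> E \<and> f i \<in> e \<and> f (Suc i) \<in> e"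
    using f(3) by (auto simp: adj_def)
  then obtain p where p: "\<And>i. i < D \<Longrightarrow> p i \<in> E \<and> f i \<in> p i \<and> f (Suc i) \<in> p i" by metis
  have V: "f i \<in> \<Union>E" if "i \<le> D" for i
  proof (cases i)
    case (Suc j)
    then show ?thesis using p[of j] that by auto
  qed (use f assms in simp)
  have up: "i \<le> j \<Longrightarrow> j \<le> D \<Longrightarrow> (f i, f j) \<in> adj E ^^ (j - i)" for i j
  proof (induction j)
    case (Suc j)
    show ?case
    proof (cases "i = Suc j")
      case False
      then have "(f i, f j) \<in> adj E ^^ (j - i)" using Suc by simp
      moreover have "(f j, f (Suc j)) \<in> adj E" using f(3) Suc by simp
      ultimately show ?thesis using False Suc.prems
        by (metis Suc_diff_le le_SucE relpow_Suc_I)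
    qed simp
  qed simp
  have d: "dst E x (f i) = i \<and> dst E y (f i) = D - i" if "i \<le> D" for i
  proof -
    have "dst E x (f i) \<le> i" using dst_le[OF up[of 0 i]] that f by simp
    moreover have "dst E (f i) y \<le> D - i" using dst_le[OF up[of i D]] that f by simp
    moreover have "D \<le> dst E x (f i) + dst E (f i) y"
      unfolding D_def using dst_triangle assms V[OF that] by metis
    ultimately show ?thesis using that dst_sym[of E y "f i"] by linarith
  qed
  have injf: "inj_on f {..D}" using d by (metis atMost_iff inj_onI)
  \<comment> \<open>An edge used at steps i < j would contain vertices at distances i and j + 1 from
    x, which differ by at least 2.\<close>
  have "p i \<noteq> p j" if "i < j" "j < D" for i j
  proof
    assume eq: "p i = p j"
    have "f i \<in> p i" "f (Suc j) \<in> p i" "p i \<in> E" using p[of i] p[of j] that eq by auto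
    then have "dst E x (f (Suc j)) \<le> Suc (dst E x (f i))"
      using dst_step assms by metis
    then show False using d[of "Suc j"] d[of i] that by simp
  qed
  then have injp: "inj_on p {..<D}"
    by (intro inj_onI) (metis lessThan_iff linorder_neqE_nat)
  show ?thesis
  proof (rule that[of f p])
    show "f 0 = x" by (fact f)
    show "f (dst E x y) = y" using f by (simp add: D_def)
  qed (use V d p injf injp in \<open>simp_all add: D_def\<close>)
qed

text \<open>The hypergraph distance is the distance of the set system of its edges: a shortest walk
  repeats neither vertices nor edges.\<close>

lemma path_between_relpow:
  assumes "path_between G u v vs es"
  shows "(u, v) \<in> adj (edges G) ^^ length es"
proof -
  have w: "walk G vs es" and h: "hd vs = u" "last vs = v"
    using assms by (auto simp: path_between_def path_def)
  then have l: "length vs = Suc (length es)" by (simp add: walk_def)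
  have "(vs ! i, vs ! Suc i) \<in> adj (edges G)" if "i < length es" for i
    using w that nth_mem[OF that] by (auto simp: walk_def intro!: adjI[of "es ! i"])
  moreover have "vs ! 0 = u" "vs ! length es = v"
    using h l by (auto simp: hd_conv_nth last_conv_nth simp flip: length_0_conv)
  ultimately show ?thesis by (auto simp: relpow_fun_conv)
qed

lemma shortest_path_exists:
  assumes "conn (edges G)" "\<Union>(edges G) = verts G" "u \<in> verts G" "v \<in> verts G"
  shows "\<exists>vs es. path_between G u v vs es \<and> length es = dst (edges G) u v"
proof -
  let ?D = "dst (edges G) u v"
  obtain f p where f: "f 0 = u" "f ?D = v"
    and d: "\<And>i. i \<le> ?D \<Longrightarrow> f i \<in> \<Union>(edges G)"
    and p: "\<And>i. i < ?D \<Longrightarrow> p i \<in> edges G \<and> f i \<in> p i \<and> f (Suc i) \<in> p i"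
    and inj: "inj_on f {..?D}" "inj_on p {..<?D}"
    using geodesic[of "edges G" u v] assms by metis
  let ?vs = "map f [0..<Suc ?D]" and ?es = "map p [0..<?D]"
  have "f i \<noteq> f (Suc i)" if "i < ?D" for i
    using inj_onD[OF inj(1), of i "Suc i"] that by auto
  then have "walk G ?vs ?es"
    using d p assms(2) by (auto simp: walk_def nth_append simp del: upt_Suc)
  moreover have "distinct ?vs" "distinct ?es"
    using inj by (auto simp: distinct_map atLeast0LessThan lessThan_Suc_atMost simp del: upt_Suc)
  moreover have "hd ?vs = u" "last ?vs = v"
    using f by (simp_all add: hd_map del: upt_Suc) (simp_all add: last_map)
  ultimately have "path_between G u v ?vs ?es" by (simp add: path_between_def path_def)
  then show ?thesis by (metis diff_zero length_map length_upt)
qed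

lemma distance_eq_dst:
  assumes "conn (edges G)" "\<Union>(edges G) = verts G" "u \<in> verts G" "v \<in> verts G"
  shows "distance G u v = dst (edges G) u v"
  unfolding distance_def
proof (rule Least_equality)
  show "\<exists>vs es. path_between G u v vs es \<and> length es = dst (edges G) u v"
    by (rule shortest_path_exists[OF assms])
next
  fix n assume "\<exists>vs es. path_between G u v vs es \<and> length es = n"
  then show "dst (edges G) u v \<le> n" using path_between_relpow dst_le by metis
qed

lemma connected_iff_conn:
  assumes "\<Union>(edges G) = verts G"
  shows "connected G \<longleftrightarrow> conn (edges G)"
proof
  assume "connected G"
  then show "conn (edges G)"
    unfolding connected_def conn_def using assms path_between_relpow
    by (metis relpow_imp_rtrancl)
next
  assume "conn (edges G)"
  then show "connected G"
    unfolding connected_def using assms shortest_path_exists by metis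
qed

section \<open>Transmission as a sum over ordered pairs\<close>

definition tr :: "'a set set \<Rightarrow> 'a \<Rightarrow> nat" where
  "tr E x = (\<Sum>y\<in>\<Union>E. dst E x y)"

text \<open>Twice the transmission.\<close>

definition wien :: "'a set set \<Rightarrow> nat" where
  "wien E = (\<Sum>x\<in>\<Union>E. tr E x)"

lemma transmission_wien:
  assumes "conn (edges G)" "\<Union>(edges G) = verts G" "finite (verts G)"
  shows "2 * transmission G = wien (edges G)"
proof -
  let ?V = "verts G" and ?d = "dst (edges G)"
  let ?T = "{S. S \<subseteq> ?V \<and> card S = 2}" and ?P = "{q \<in> ?V \<times> ?V. fst q \<noteq> snd q}"
  let ?g = "\<lambda>q. {fst q, snd q}"
  have finT: "finite ?T" using assms(3) by simp
  have finP: "finite ?P" using assms(3) by simp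
  have "wien (edges G) = (\<Sum>q\<in>?V \<times> ?V. ?d (fst q) (snd q))"
    by (simp add: wien_def tr_def assms(2) sum.cartesian_product case_prod_beta)
  also have "\<dots> = (\<Sum>q\<in>?P. ?d (fst q) (snd q))"
    by (rule sum.mono_neutral_right) (use assms(3) in auto)
  also have "\<dots> = (\<Sum>S\<in>?T. \<Sum>q\<in>{q \<in> ?P. ?g q = S}. ?d (fst q) (snd q))"
    by (rule sum.group[symmetric]) (use finT finP in auto)
  also have "\<dots> = (\<Sum>S\<in>?T. 2 * (THE d. \<exists>u v. S = {u, v} \<and> d = distance G u v))"
  proof (rule sum.cong[OF refl])
    fix S assume "S \<in> ?T"
    then obtain u v where S: "S = {u, v}" "u \<noteq> v" "u \<in> ?V" "v \<in> ?V"
      by (auto simp: card_2_iff)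
    then have "{q \<in> ?P. ?g q = S} = {(u, v), (v, u)}" by (auto simp: doubleton_eq_iff)
    then have "(\<Sum>q\<in>{q \<in> ?P. ?g q = S}. ?d (fst q) (snd q)) = ?d u v + ?d v u"
      using S by simp
    also have "\<dots> = 2 * distance G u v"
      using distance_eq_dst[OF assms(1,2) S(3,4)] dst_sym[of "edges G" u v] by simp
    finally show "(\<Sum>q\<in>{q \<in> ?P. ?g q = S}. ?d (fst q) (snd q)) =
        2 * (THE d. \<exists>u v. S = {u, v} \<and> d = distance G u v)"
      using the_distance[of u v G] S by simp
  qed
  also have "\<dots> = 2 * transmission G"
    by (simp add: transmission_def sum_distrib_left)
  finally show ?thesis by simp
qed

subsection \<open>Levels of edges\<close>

text \<open>Otherwise \<Union>F would be closed under adjacency and would contain every vertex. This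
  allows an edge set to be built up one edge at a time, each new edge attached to earlier
  ones.\<close>

lemma conn_exit:
  assumes "conn E" "{} \<notin> E" "F \<subseteq> E" "F \<noteq> {}" "F \<noteq> E"
  obtains e where "e \<in> E" "e \<notin> F" "e \<inter> \<Union>F \<noteq> {}"
proof (rule ccontr)
  assume neg: "\<not> thesis"
  obtain h x where h: "h \<in> E" "h \<notin> F" "x \<in> h" using assms by (metis ex_in_conv subset_antisym subsetI)
  obtain y where y: "y \<in> \<Union>F" using assms by (metis Union_iff equals0I subset_iff)
  have "(y, x) \<in> (adj E)\<^sup>*" using assms(1,3) h y by (auto simp: conn_def)
  then have "x \<in> \<Union>F"
  proof induction
    case base
    show ?case by (fact y)
  next
    case (step u v)
    then obtain e where e: "e \<in> E" "u \<in> e" "v \<in> e" by (auto simp: adj_def)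
    then have "e \<in> F" using neg that[of e] step.IH by (meson disjoint_iff)
    then show ?case using e by blast
  qed
  then show False using neg that h by blast
qed

text \<open>An element of maximal level is nobody's predecessor, so deleting it leaves the family
  without gaps and induction applies.\<close>

lemma gap_free_sum:
  fixes l :: "'b \<Rightarrow> nat"
  assumes "finite A" "\<And>x. x \<in> A \<Longrightarrow> 1 \<le> l x"
    and "\<And>x. x \<in> A \<Longrightarrow> 2 \<le> l x \<Longrightarrow> \<exists>y\<in>A. Suc (l y) = l x"
  shows "2 * sum l A \<le> card A * (card A + 1) \<and> (\<forall>x\<in>A. l x \<le> card A)"
  using assms
proof (induction "card A" arbitrary: A)
  case (Suc n)
  then have "A \<noteq> {}" by auto
  then have "Max (l ` A) \<in> l ` A" using Suc.prems(1) by simp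
  then obtain x where x: "x \<in> A" "l x = Max (l ` A)" by auto
  have mx: "l y \<le> l x" if "y \<in> A" for y using that x Suc.prems(1) by simp
  let ?B = "A - {x}"
  have cB: "card ?B = n" using Suc.hyps(2) x by (simp add: card_Diff_singleton)
  have "\<exists>y\<in>?B. Suc (l y) = l u" if u: "u \<in> ?B" "2 \<le> l u" for u
  proof -
    obtain y where y: "y \<in> A" "Suc (l y) = l u" using Suc.prems(3)[of u] u by auto
    then have "y \<noteq> x" using mx[of u] u by auto
    then show ?thesis using y by auto
  qed
  then have IH: "2 * sum l ?B \<le> n * (n + 1)" "\<And>y. y \<in> ?B \<Longrightarrow> l y \<le> n"
    using Suc.hyps(1)[of ?B, OF cB[symmetric]] cB Suc.prems(1,2) by simp_all
  have lx: "l x \<le> Suc n"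
  proof (cases "2 \<le> l x")
    case True
    then obtain y where y: "y \<in> A" "Suc (l y) = l x" using Suc.prems(3) x by blast
    then have "y \<in> ?B" by auto
    then show ?thesis using IH(2) y by fastforce
  qed simp
  have "sum l A = l x + sum l ?B" using x Suc.prems(1) by (simp add: sum.remove)
  then have "2 * sum l A \<le> Suc n * (Suc n + 1)" using IH(1) lx by (simp add: algebra_simps)
  then show ?case using Suc.hyps(2) mx lx by (metis order_trans)
qed auto

text \<open>Deleting g creates no gap, since h keeps its level occupied; \<open>gap_free_sum\<close>
  bounds the rest.\<close>

lemma gap_free_sum_repeated:
  fixes l :: "'b \<Rightarrow> nat"
  assumes "finite A" "\<And>x. x \<in> A \<Longrightarrow> 1 \<le> l x"
    and gap: "\<And>x. x \<in> A \<Longrightarrow> 2 \<le> l x \<Longrightarrow> \<exists>y\<in>A. Suc (l y) = l x"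
    and g: "g \<in> A" "h \<in> A" "g \<noteq> h" "l g = l h"
  shows "2 * sum l A \<le> card A * (card A - 1) + 2 * l g"
proof -
  let ?B = "A - {g}"
  have "\<exists>y\<in>?B. Suc (l y) = l u" if u: "u \<in> ?B" "2 \<le> l u" for u
  proof -
    obtain y where "y \<in> A" "Suc (l y) = l u" using gap[of u] u by auto
    then show ?thesis using g by (cases "y = g") auto
  qed
  then have "2 * sum l ?B \<le> card ?B * (card ?B + 1)"
    using gap_free_sum[of ?B l] assms(1,2) by auto
  moreover have "sum l A = l g + sum l ?B" using g assms(1) by (simp add: sum.remove)
  moreover have "card A = Suc (card ?B)" by (rule card.remove[OF assms(1) g(1)])
  ultimately show ?thesis by (simp add: mult.commute)
qed

text \<open>A vertex of e is at distance \<open>lev E z e - 1\<close> or \<open>lev E z e\<close>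
  from z. The shift by one makes the level the distance of those vertices that are newly reached
  through e, so distances can be counted edge by edge.\<close>

definition lev :: "'a set set \<Rightarrow> 'a \<Rightarrow> 'a set \<Rightarrow> nat" where
  "lev E z e = Suc (Min (dst E z ` e))"

locale ksys =
  fixes K :: nat and E :: "'a set set"
  assumes fin: "finite E" and con: "conn E" and card_edge: "e \<in> E \<Longrightarrow> card e = Suc K"
begin

lemma fin_edge: "e \<in> E \<Longrightarrow> finite e"
  using card_edge by (metis card.infinite nat.distinct(1))

lemma edge_ne: "e \<in> E \<Longrightarrow> e \<noteq> {}"
  using card_edge by (metis card.empty nat.distinct(1))

lemma empty_notin: "{} \<notin> E"
  using edge_ne by blast

lemma fin_verts: "finite (\<Union>E)"
  using fin fin_edge by blast

text \<open>The edges outside F can be added one at a time so that each meets what is already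
  covered (\<open>conn_exit\<close>) and brings at most K new vertices.\<close>

lemma card_verts_growth:
  assumes "F \<subseteq> E" "F \<noteq> {}"
  shows "card (\<Union>E) \<le> card (\<Union>F) + K * card (E - F)"
  using assms
proof (induction "card (E - F)" arbitrary: F)
  case 0
  then have "F = E" using fin by auto
  then show ?case by simp
next
  case (Suc n)
  then have "F \<noteq> E" by auto
  then obtain e where e: "e \<in> E" "e \<notin> F" "e \<inter> \<Union>F \<noteq> {}"
    by (rule conn_exit[OF con empty_notin Suc.prems])
  let ?F = "insert e F"
  have fF: "finite (\<Union>F)" using Suc.prems fin_verts by (meson Union_mono finite_subset)
  have "E - ?F = (E - F) - {e}" by blast
  then have n: "n = card (E - ?F)" using Suc.hyps(2) e fin by simp
  have IH: "card (\<Union>E) \<le> card (\<Union>?F) + K * n"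
    using Suc.hyps(1)[OF n] Suc.prems(1) e(1) n by simp
  have "\<Union>?F = \<Union>F \<union> e" by blast
  then have "card (\<Union>?F) + card (\<Union>F \<inter> e) = card (\<Union>F) + Suc K"
    using card_Un_Int[OF fF fin_edge[OF e(1)]] card_edge[OF e(1)] by simp
  moreover have "card (\<Union>F \<inter> e) \<noteq> 0" using e fin_edge by auto
  ultimately have "card (\<Union>?F) \<le> card (\<Union>F) + K" by linarith
  then show ?case using IH Suc.hyps(2)[symmetric] by simp
qed

lemma card_verts_le:
  assumes "E \<noteq> {}"
  shows "card (\<Union>E) \<le> card E * K + 1"
proof -
  obtain e where e: "e \<in> E" using assms by blast
  then have m: "card E = Suc (card (E - {e}))" by (rule card.remove[OF fin])
  have "card (\<Union>E) \<le> Suc K + K * card (E - {e})"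
    using card_verts_growth[of "{e}"] e card_edge[OF e] by simp
  then show ?thesis unfolding m by (simp add: algebra_simps)
qed

lemma dst_le_lev: "e \<in> E \<Longrightarrow> z \<in> \<Union>E \<Longrightarrow> x \<in> e \<Longrightarrow> dst E z x \<le> lev E z e"
proof -
  assume a: "e \<in> E" "z \<in> \<Union>E" "x \<in> e"
  then have "Min (dst E z ` e) \<in> dst E z ` e" using fin_edge edge_ne by simp
  then obtain w where w: "w \<in> e" "dst E z w = Min (dst E z ` e)" by auto
  show ?thesis using dst_step[OF con a(2,1) w(1) a(3)] w by (simp add: lev_def)
qed

lemma lev_le: "e \<in> E \<Longrightarrow> x \<in> e \<Longrightarrow> lev E z e \<le> Suc (dst E z x)"
  by (simp add: lev_def fin_edge)

lemma lev_pos: "1 \<le> lev E z e"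
  by (simp add: lev_def)

lemma lev_attained:
  assumes "e \<in> E"
  obtains w where "w \<in> e" "Suc (dst E z w) = lev E z e"
proof -
  have "Min (dst E z ` e) \<in> dst E z ` e" using fin_edge edge_ne assms by simp
  then show ?thesis using that by (auto simp: lev_def)
qed

text \<open>The last edge of a geodesic from z to x serves. This yields both the absence of gaps
  among the levels and the charging of vertices to edges in \<open>deficiency\<close>.\<close>

lemma ex_lev_eq_dst:
  assumes "z \<in> \<Union>E" "x \<in> \<Union>E" "x \<noteq> z"
  obtains e where "e \<in> E" "x \<in> e" "lev E z e = dst E z x"
proof -
  obtain e w where "e \<in> E" "w \<in> e" "x \<in> e" "dst E z x = Suc (dst E z w)"
    by (rule dst_pred[OF con assms(1,2) assms(3)[symmetric]])
  then show ?thesis using that[of e] lev_le[of e w z] dst_le_lev[of e z x] assms by simp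
qed

lemma lev_gap_free:
  assumes "z \<in> \<Union>E" "e \<in> E" "2 \<le> lev E z e"
  shows "\<exists>h\<in>E. Suc (lev E z h) = lev E z e"
proof -
  obtain w where w: "w \<in> e" "Suc (dst E z w) = lev E z e" using lev_attained assms by metis
  then have "w \<noteq> z" using assms(3) by auto
  then show ?thesis using ex_lev_eq_dst[of z w] assms w by (metis UnionI)
qed

lemma sum_lev_le: "z \<in> \<Union>E \<Longrightarrow> 2 * sum (lev E z) E \<le> card E * (card E + 1)"
  using gap_free_sum[of E "lev E z"] fin lev_pos lev_gap_free by auto

lemma sum_lev_repeated_le:
  "z \<in> \<Union>E \<Longrightarrow> g \<in> E \<Longrightarrow> h \<in> E \<Longrightarrow> g \<noteq> h \<Longrightarrow> lev E z g = lev E z h \<Longrightarrow>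
    2 * sum (lev E z) E \<le> card E * (card E - 1) + 2 * lev E z g"
  using gap_free_sum_repeated[of E "lev E z" g h] fin lev_pos lev_gap_free by auto

text \<open>Every vertex other than \<open>z\<close> is charged to an edge whose level is its distance from \<open>z\<close>;
  \<open>c e\<close> is the number of the \<open>K\<close> slots of \<open>e\<close> that stay empty.\<close>

lemma deficiency:
  assumes z: "z \<in> \<Union>E"
  shows "\<exists>c. tr E z + (\<Sum>e\<in>E. lev E z e * c e) = K * sum (lev E z) E \<and>
    sum c E + card (\<Union>E) = card E * K + 1 \<and>
    (\<forall>e\<in>E. (\<forall>h\<in>E. lev E z h = lev E z e \<longrightarrow> h = e) \<longrightarrow>
       c e + card {x \<in> e. dst E z x = lev E z e} = K) \<and>
    (\<forall>e\<in>E. K \<le> c e + card {x \<in> e. dst E z x = lev E z e})"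
proof -
  let ?l = "lev E z" and ?V = "\<Union>E - {z}"
  have "\<forall>x. \<exists>e. x \<in> ?V \<longrightarrow> e \<in> E \<and> x \<in> e \<and> ?l e = dst E z x"
    by (metis DiffD1 DiffD2 ex_lev_eq_dst[OF z] singletonI)
  then obtain f where f: "\<And>x. x \<in> ?V \<Longrightarrow> f x \<in> E \<and> x \<in> f x \<and> ?l (f x) = dst E z x" by metis
  define fib where "fib e = {x \<in> ?V. f x = e}" for e
  have sub: "fib e \<subseteq> {x \<in> e. dst E z x = ?l e}" for e
  proof
    fix x assume "x \<in> fib e"
    then have "x \<in> ?V" "f x = e" by (simp_all add: fib_def)
    then show "x \<in> {x \<in> e. dst E z x = ?l e}" using f[of x] by simp
  qed
  \<comment> \<open>The vertex attaining the minimum is one step nearer to z, so at most K of the K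
    + 1 vertices can be charged to e.\<close>
  have le: "card {x \<in> e. dst E z x = ?l e} \<le> K" if e: "e \<in> E" for e
  proof -
    obtain w where w: "w \<in> e" "Suc (dst E z w) = ?l e" using lev_attained[OF e] by metis
    then have "{x \<in> e. dst E z x = ?l e} \<subseteq> e - {w}" by auto
    then have "card {x \<in> e. dst E z x = ?l e} \<le> card (e - {w})"
      using e fin_edge by (intro card_mono) auto
    then show ?thesis using card_edge[OF e] w e fin_edge by simp
  qed
  have cle: "card (fib e) \<le> card {x \<in> e. dst E z x = ?l e}" if "e \<in> E" for e
    using card_mono[OF _ sub[of e]] fin_edge[OF that] by simp
  define c where "c e = K - card (fib e)" for e
  have ce: "c e + card (fib e) = K" if "e \<in> E" for e
    using le[OF that] cle[OF that] by (simp add: c_def)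
  have finV: "finite ?V" using fin_verts by simp
  have sumfib: "(\<Sum>e\<in>E. \<Sum>x\<in>fib e. g x) = (\<Sum>x\<in>?V. g x)" for g :: "'a \<Rightarrow> nat"
    unfolding fib_def by (rule sum.group[OF finV fin]) (use f in auto)
  have "tr E z = (\<Sum>x\<in>?V. dst E z x)"
    unfolding tr_def using z fin_verts by (simp add: sum.remove)
  also have "\<dots> = (\<Sum>e\<in>E. \<Sum>x\<in>fib e. dst E z x)" using sumfib by simp
  also have "\<dots> = (\<Sum>e\<in>E. \<Sum>x\<in>fib e. ?l e)"
    using sub by (intro sum.cong refl) blast
  also have "\<dots> = (\<Sum>e\<in>E. ?l e * card (fib e))" by (simp add: mult.commute)
  finally have "tr E z + (\<Sum>e\<in>E. ?l e * c e) = (\<Sum>e\<in>E. ?l e * (c e + card (fib e)))"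
    by (simp add: sum.distrib algebra_simps)
  also have "\<dots> = K * sum ?l E" using ce by (simp add: sum_distrib_left mult.commute)
  finally have 1: "tr E z + (\<Sum>e\<in>E. ?l e * c e) = K * sum ?l E" .
  have "(\<Sum>e\<in>E. card (fib e)) = card ?V" using sumfib[of "\<lambda>_. 1"] by simp
  moreover have "sum c E + (\<Sum>e\<in>E. card (fib e)) = card E * K"
    using ce by (simp flip: sum.distrib)
  moreover have "card (\<Union>E) = Suc (card ?V)" by (rule card.remove[OF fin_verts z])
  ultimately have 2: "sum c E + card (\<Union>E) = card E * K + 1" by simp
  \<comment> \<open>If no other edge has the level of e, all vertices of e at this distance must be
    charged to e.\<close>
  have 3: "c e + card {x \<in> e. dst E z x = ?l e} = K"
    if e: "e \<in> E" and u: "\<And>h. h \<in> E \<Longrightarrow> ?l h = ?l e \<Longrightarrow> h = e" for e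
  proof -
    have "x \<in> fib e" if x: "x \<in> e" "dst E z x = ?l e" for x
    proof -
      have "x \<noteq> z" using x lev_pos[of z e] by auto
      then have "x \<in> ?V" using x e by auto
      then show ?thesis using f[of x] u x by (auto simp: fib_def)
    qed
    then have "fib e = {x \<in> e. dst E z x = ?l e}" using sub by auto
    then show ?thesis using ce[OF e] by simp
  qed
  have 4: "K \<le> c e + card {x \<in> e. dst E z x = ?l e}" if "e \<in> E" for e
    using ce[OF that] cle[OF that] by simp
  show ?thesis by (intro exI[of _ c] conjI ballI impI 1 2 3 4) auto
qed

lemma tr_le_sum_lev: "z \<in> \<Union>E \<Longrightarrow> tr E z \<le> K * sum (lev E z) E"
  using deficiency[of z] by fastforce

lemma tr_le:
  assumes "z \<in> \<Union>E" shows "2 * tr E z \<le> K * (card E * (card E + 1))"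
proof -
  have "2 * tr E z \<le> K * (2 * sum (lev E z) E)" using tr_le_sum_lev[OF assms] by simp
  also have "\<dots> \<le> K * (card E * (card E + 1))" using sum_lev_le[OF assms] by (rule mult_le_mono2)
  finally show ?thesis .
qed

text \<open>There are \<open>card E * K - card (\<Union>E) + 1\<close> empty slots in all. At least
  one is in e and costs the level of e; each of the others costs at least 1.\<close>

lemma tr_le_deficient_edge:
  assumes z: "z \<in> \<Union>E" and e: "e \<in> E"
    and d: "card {x \<in> e. dst E z x = lev E z e} < K" and N: "card (\<Union>E) \<le> card E * K"
  shows "tr E z + lev E z e + (card E * K - card (\<Union>E)) \<le> K * sum (lev E z) E"
proof -
  let ?l = "lev E z"
  obtain c where c: "tr E z + (\<Sum>h\<in>E. ?l h * c h) = K * sum ?l E"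
    "sum c E + card (\<Union>E) = card E * K + 1" "K \<le> c e + card {x \<in> e. dst E z x = ?l e}"
    using deficiency[OF z] e by blast
  have ce: "1 \<le> c e" using c(3) d by simp
  have split: "(\<Sum>h\<in>E. g h) = g e + (\<Sum>h\<in>E - {e}. g h)" for g :: "'a set \<Rightarrow> nat"
    using e fin by (simp add: sum.remove)
  have "(\<Sum>h\<in>E - {e}. c h) \<le> (\<Sum>h\<in>E - {e}. ?l h * c h)"
    using lev_pos by (intro sum_mono) (metis mult_le_mono1 mult_1)
  \<comment> \<open>This is the expanded form of (?l e - 1) * (c e - 1) \<ge> 0.\<close>
  moreover have "?l e + c e \<le> ?l e * c e + 1"
  proof -
    obtain a b where "?l e = Suc a" "c e = Suc b" using ce lev_pos[of z e]
      by (metis Suc_le_D One_nat_def)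
    then show ?thesis by simp
  qed
  ultimately have "?l e + sum c E \<le> (\<Sum>h\<in>E. ?l h * c h) + 1"
    using split[of c] split[of "\<lambda>h. ?l h * c h"] by linarith
  then show ?thesis using c(1,2) N by linarith
qed

text \<open>Only l has level 1, and its K slots are filled by its other vertices. The vertex count
  leaves an empty slot somewhere, hence in an edge of level at least 2.\<close>

lemma tr_le_private:
  assumes l: "l \<in> E" "z \<in> l" "\<And>h. h \<in> E \<Longrightarrow> z \<in> h \<Longrightarrow> h = l" and N: "card (\<Union>E) \<le> card E * K"
  shows "tr E z + 2 \<le> K * sum (lev E z) E"
proof -
  let ?l = "lev E z"
  have z: "z \<in> \<Union>E" using l by blast
  have lev1: "h = l" if h: "h \<in> E" "?l h = 1" for h
  proof -
    obtain w where "w \<in> h" "Suc (dst E z w) = ?l h" using lev_attained[OF h(1)] by metis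
    then show ?thesis using l(3)[OF h(1)] dst_eq_0[OF con z, of w] h by auto
  qed
  have ll: "?l l = 1" using lev_le[OF l(1,2), of z] lev_pos[of z l] by simp
  obtain c where c: "tr E z + (\<Sum>h\<in>E. ?l h * c h) = K * sum ?l E"
    "sum c E + card (\<Union>E) = card E * K + 1"
    and u: "\<forall>e\<in>E. (\<forall>h\<in>E. ?l h = ?l e \<longrightarrow> h = e) \<longrightarrow> c e + card {x \<in> e. dst E z x = ?l e} = K"
    using deficiency[OF z] by blast
  have cl: "c l + card {x \<in> l. dst E z x = ?l l} = K"
    using bspec[OF u l(1)] lev1 unfolding ll by blast
  have sl: "{x \<in> l. dst E z x = ?l l} = l - {z}"
    using dst_edge_eq[OF con l(1,2)] ll by auto
  have "card (l - {z}) = K"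
    using card_edge[OF l(1)] card_Diff_singleton[OF l(2)] by simp
  then have cl0: "c l = 0" using cl[unfolded sl] by linarith
  have "sum c E \<noteq> 0" using c(2) N by linarith
  then have "\<exists>h\<in>E. c h \<noteq> 0" by (metis (no_types) sum.neutral)
  then obtain h where h: "h \<in> E" "c h \<noteq> 0" by blast
  then have "h \<noteq> l" using cl0 by auto
  then have "2 \<le> ?l h" using lev1[OF h(1)] lev_pos[of z h] by linarith
  then have "2 \<le> ?l h * c h" using h(2) by (cases "c h") auto
  also have "\<dots> \<le> (\<Sum>h\<in>E. ?l h * c h)" using h fin by (intro member_le_sum) auto
  finally show ?thesis using c(1) by simp
qed

text \<open>A vertex x of another edge h is still reached from z. Either h contains a vertex nearer
  to z, or the level of h exceeds the distance of x; then the edge through which x is reached has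
  smaller level than h, hence than e, and survives.\<close>

lemma max_lev_noncut:
  assumes z: "z \<in> \<Union>E" and e: "e \<in> E" and mx: "\<And>h. h \<in> E \<Longrightarrow> lev E z h \<le> lev E z e"
  shows "conn (E - {e})"
proof -
  let ?E = "E - {e}"
  have reach: "(z, x) \<in> (adj ?E)\<^sup>*" if "x \<in> \<Union>?E" for x
    using that
  proof (induction "dst E z x" arbitrary: x rule: less_induct)
    case less
    show ?case
    proof (cases "x = z")
      case False
      from less.prems obtain h where h: "h \<in> ?E" "x \<in> h" by blast
      have "\<exists>g\<in>?E. x \<in> g \<and> lev E z g \<le> dst E z x"
      proof (cases "lev E z h \<le> dst E z x")
        case False
        have "x \<in> \<Union>E" using h by auto
        then obtain g where g: "g \<in> E" "x \<in> g" "lev E z g = dst E z x"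
          by (rule ex_lev_eq_dst[OF z _ \<open>x \<noteq> z\<close>])
        then have "g \<noteq> e" using mx[of h] h False by auto
        then show ?thesis using g by auto
      qed (use h in blast)
      then obtain g where g: "g \<in> ?E" "x \<in> g" "lev E z g \<le> dst E z x" by blast
      obtain w where w: "w \<in> g" "Suc (dst E z w) = lev E z g" using lev_attained g by blast
      then have "(z, w) \<in> (adj ?E)\<^sup>*" using less.hyps[of w] g by auto
      moreover have "(w, x) \<in> adj ?E" using adjI w g by metis
      ultimately show ?thesis by (rule rtrancl_into_rtrancl)
    qed simp
  qed
  have "sym (adj ?E)" by (meson adj_sym symI)
  then have "(x, y) \<in> (adj ?E)\<^sup>*" if "x \<in> \<Union>?E" "y \<in> \<Union>?E" for x y
    using rtrancl_trans[OF symD[OF sym_rtrancl reach[OF that(1)]] reach[OF that(2)]] by blast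
  then show ?thesis by (auto simp: conn_def)
qed

lemma ex_max_lev:
  assumes "E \<noteq> {}"
  obtains e where "e \<in> E" "\<And>h. h \<in> E \<Longrightarrow> lev E z h \<le> lev E z e"
proof -
  have "Max (lev E z ` E) \<in> lev E z ` E" using fin assms by simp
  then obtain e where "e \<in> E" "lev E z e = Max (lev E z ` E)" by auto
  then show ?thesis using that fin by simp
qed

lemma ksys_remove: "conn (E - {e}) \<Longrightarrow> ksys K (E - {e})"
  using fin card_edge by unfold_locales auto

end

subsection \<open>Removing an edge\<close>

context ksys
begin

lemma ex_shared:
  assumes "e \<in> E" "E - {e} \<noteq> {}"
  shows "\<exists>s. s \<in> e \<and> s \<in> \<Union>(E - {e})"
proof -
  obtain h where "h \<in> E" "h \<notin> E - {e}" "h \<inter> \<Union>(E - {e}) \<noteq> {}"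
    by (rule conn_exit[OF con empty_notin, of "E - {e}"]) (use assms in auto)
  then show ?thesis by blast
qed

lemma wien_split:
  assumes e: "e \<in> E"
  defines "V \<equiv> \<Union>(E - {e})" and "R \<equiv> e - \<Union>(E - {e})"
  shows "wien E = (\<Sum>x\<in>V. \<Sum>y\<in>V. dst E x y) + 2 * (\<Sum>x\<in>R. \<Sum>y\<in>V. dst E x y) + card R * (card R - 1)"
proof -
  have U: "\<Union>E = V \<union> R" and dj: "V \<inter> R = {}" using e by (auto simp: V_def R_def)
  have f: "finite V" "finite R" using fin_verts U by auto
  have sp: "(\<Sum>x\<in>\<Union>E. g x) = (\<Sum>x\<in>V. g x) + (\<Sum>x\<in>R. g x)" for g :: "'a \<Rightarrow> nat"
    unfolding U using f dj by (rule sum.union_disjoint)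
  have RR: "(\<Sum>x\<in>R. \<Sum>y\<in>R. dst E x y) = card R * (card R - 1)"
  proof -
    have "(\<Sum>y\<in>R. dst E x y) = card R - 1" if x: "x \<in> R" for x
    proof -
      have "(\<Sum>y\<in>R. dst E x y) = dst E x x + (\<Sum>y\<in>R - {x}. dst E x y)"
        by (rule sum.remove[OF f(2) x])
      also have "(\<Sum>y\<in>R - {x}. dst E x y) = (\<Sum>y\<in>R - {x}. 1)"
        using x dst_edge_eq[OF con e] by (intro sum.cong) (auto simp: R_def)
      also have "\<dots> = card R - 1" using x by simp
      finally show ?thesis by simp
    qed
    then show ?thesis by simp
  qed
  have "(\<Sum>x\<in>V. \<Sum>y\<in>R. dst E x y) = (\<Sum>x\<in>R. \<Sum>y\<in>V. dst E x y)"
    by (subst sum.swap) (simp add: dst_sym)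
  then show ?thesis
    unfolding wien_def tr_def sp sum.distrib RR by simp
qed

lemma dst_private_le:
  assumes e: "e \<in> E" "conn (E - {e})" and s: "s \<in> e" "s \<in> \<Union>(E - {e})"
    and x: "x \<in> e" and y: "y \<in> \<Union>(E - {e})"
  shows "dst E x y \<le> Suc (dst (E - {e}) s y)"
proof -
  have "dst E x y \<le> dst E x s + dst E s y"
    using dst_triangle[OF con] e s x y by blast
  moreover have "dst E x s \<le> 1" using dst_edge e s x by metis
  moreover have "dst E s y \<le> dst (E - {e}) s y" using dst_antimono[OF e(2) _ s(2) y] by blast
  ultimately show ?thesis by linarith
qed

text \<open>Putting e back does not increase distances within the rest, and two private vertices of
  e are at distance 1. Only the distances between private vertices and the rest need the bound
  B.\<close>

lemma wien_remove_le_gen: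
  assumes e: "e \<in> E" "conn (E - {e})"
    and B: "\<And>x. x \<in> e - \<Union>(E - {e}) \<Longrightarrow> (\<Sum>y\<in>\<Union>(E - {e}). dst E x y) \<le> B"
  defines "r \<equiv> card (e - \<Union>(E - {e}))"
  shows "wien E \<le> wien (E - {e}) + 2 * r * B + r * (r - 1)"
proof -
  let ?V = "\<Union>(E - {e})"
  have "(\<Sum>x\<in>?V. \<Sum>y\<in>?V. dst E x y) \<le> wien (E - {e})"
    unfolding wien_def tr_def by (intro sum_mono dst_antimono[OF e(2)]) auto
  moreover have "(\<Sum>x\<in>e - ?V. \<Sum>y\<in>?V. dst E x y) \<le> (\<Sum>x\<in>e - ?V. B)"
    by (intro sum_mono B)
  then have "2 * (\<Sum>x\<in>e - ?V. \<Sum>y\<in>?V. dst E x y) \<le> 2 * r * B" by (simp add: r_def)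
  ultimately show ?thesis using wien_split[OF e(1)] by (simp add: r_def)
qed

lemma wien_remove_le:
  assumes e: "e \<in> E" "conn (E - {e})" and s: "s \<in> e" "s \<in> \<Union>(E - {e})"
  defines "r \<equiv> card (e - \<Union>(E - {e}))"
  shows "wien E \<le> wien (E - {e}) + 2 * r * (card (\<Union>(E - {e})) + tr (E - {e}) s) + r * (r - 1)"
  unfolding r_def
proof (rule wien_remove_le_gen[OF e])
  let ?V = "\<Union>(E - {e})"
  fix x assume x: "x \<in> e - ?V"
  have "(\<Sum>y\<in>?V. dst E x y) \<le> (\<Sum>y\<in>?V. Suc (dst (E - {e}) s y))"
    using dst_private_le[OF e s] x by (intro sum_mono) auto
  then show "(\<Sum>y\<in>?V. dst E x y) \<le> card ?V + tr (E - {e}) s"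
    by (simp add: tr_def sum_Suc)
qed

text \<open>The estimate through s charges s' with 1 + d(s, s'), while s' lies in e and is at
  distance at most 1 from every private vertex. The difference is saved once per private vertex, and
  doubled by ordered pairs.\<close>

lemma wien_remove_two_shared_le:
  assumes e: "e \<in> E" "conn (E - {e})" and s: "s \<in> e" "s \<in> \<Union>(E - {e})"
    and s': "s' \<in> e" "s' \<in> \<Union>(E - {e})"
  defines "r \<equiv> card (e - \<Union>(E - {e}))"
  shows "wien E + 2 * r * dst (E - {e}) s s' \<le>
    wien (E - {e}) + 2 * r * (card (\<Union>(E - {e})) + tr (E - {e}) s) + r * (r - 1)"
proof -
  let ?V = "\<Union>(E - {e})" and ?d = "dst (E - {e})"
  have fV: "finite ?V" using fin_verts by (rule rev_finite_subset) auto
  let ?B = "card ?V + tr (E - {e}) s - ?d s s'"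
  have B: "?d s s' + ?B = card ?V + tr (E - {e}) s"
    using member_le_sum[OF s'(2), of "?d s"] fV by (simp add: tr_def)
  have "(\<Sum>y\<in>?V. dst E x y) \<le> ?B" if x: "x \<in> e - ?V" for x
  proof -
    have "(\<Sum>y\<in>?V. dst E x y) = dst E x s' + (\<Sum>y\<in>?V - {s'}. dst E x y)"
      by (rule sum.remove[OF fV s'(2)])
    also have "\<dots> \<le> 1 + (\<Sum>y\<in>?V - {s'}. Suc (?d s y))"
      using dst_private_le[OF e s] x dst_edge[OF e(1), of x s'] s'
      by (intro add_mono sum_mono) auto
    finally have "(\<Sum>y\<in>?V. dst E x y) + ?d s s' \<le> Suc (?d s s') + (\<Sum>y\<in>?V - {s'}. Suc (?d s y))"
      by simp
    also have "\<dots> = (\<Sum>y\<in>?V. Suc (?d s y))"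
      by (rule sum.remove[OF fV s'(2), symmetric])
    also have "\<dots> = card ?V + tr (E - {e}) s" by (simp add: tr_def sum_Suc)
    finally show ?thesis by simp
  qed
  then have "wien E \<le> wien (E - {e}) + 2 * r * ?B + r * (r - 1)"
    unfolding r_def by (rule wien_remove_le_gen[OF e])
  moreover have "2 * r * ?d s s' + 2 * r * ?B = 2 * r * (card ?V + tr (E - {e}) s)"
    unfolding add_mult_distrib2[symmetric] B ..
  ultimately show ?thesis by linarith
qed

lemma leaf_distances:
  assumes e: "e \<in> E" "conn (E - {e})" and w: "e \<inter> \<Union>(E - {e}) = {w}" and x: "x \<in> \<Union>(E - {e})"
  shows "y \<in> \<Union>(E - {e}) \<Longrightarrow> dst E x y = dst (E - {e}) x y"
    and "z \<in> e - \<Union>(E - {e}) \<Longrightarrow> dst E z x = Suc (dst (E - {e}) w x)"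
proof -
  let ?V = "\<Union>(E - {e})" and ?d = "dst (E - {e})"
  \<comment> \<open>The expected distance from x: unchanged on the rest, and through the only
    attachment vertex w for private vertices of e. Checking it edge by edge makes it a lower
    bound.\<close>
  define \<phi> where "\<phi> y = (if y \<in> ?V then ?d x y else Suc (?d x w))" for y
  have lip: "\<phi> v \<le> Suc (\<phi> u)" if h: "h \<in> E" "u \<in> h" "v \<in> h" for h u v
  proof (cases "h = e")
    case True
    have "\<phi> t = ?d x w \<or> \<phi> t = Suc (?d x w)" if t: "t \<in> e" for t
    proof (cases "t \<in> ?V")
      case True
      then have "t = w" using w t by blast
      then show ?thesis using True by (simp add: \<phi>_def)
    qed (simp add: \<phi>_def)
    then have "\<phi> v \<le> Suc (?d x w)" "?d x w \<le> \<phi> u" using h True by fastforce+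
    then show ?thesis by linarith
  next
    case False
    then have h': "h \<in> E - {e}" using h by blast
    then have "u \<in> ?V" "v \<in> ?V" using h by blast+
    then show ?thesis using dst_step[OF e(2) x h' h(2,3)] by (simp add: \<phi>_def)
  qed
  have lower: "\<phi> y \<le> dst E x y" if "y \<in> \<Union>E" for y
  proof -
    have "\<phi> y \<le> \<phi> x + dst E x y" by (rule dst_ge_lipschitz[OF con _ that lip]) (use x in blast)
    then show ?thesis using x by (simp add: \<phi>_def)
  qed
  show "dst E x y = ?d x y" if y: "y \<in> ?V"
  proof (rule antisym)
    show "dst E x y \<le> ?d x y" using dst_antimono[OF e(2) _ x y] by blast
    have "y \<in> \<Union>E" using y by blast
    then have "\<phi> y \<le> dst E x y" by (rule lower)
    then show "?d x y \<le> dst E x y" using y by (simp add: \<phi>_def)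
  qed
  show "dst E z x = Suc (?d w x)" if z: "z \<in> e - ?V"
  proof (rule antisym)
    show "dst E z x \<le> Suc (?d w x)" using dst_private_le[OF e, of w z x] w x z by blast
    have "z \<in> \<Union>E" using z e by blast
    then have "\<phi> z \<le> dst E x z" by (rule lower)
    moreover have "\<phi> z = Suc (?d x w)" using z by (simp add: \<phi>_def)
    ultimately show "Suc (?d w x) \<le> dst E z x"
      using dst_sym[of E x z] dst_sym[of "E - {e}" x w] by linarith
  qed
qed

text \<open>All K private vertices have the same distance sum as z. In \<open>2 * K * tr E z\<close>
  the ordered pairs of private vertices are counted twice, which \<open>K * (K - 1)\<close>
  corrects.\<close>

lemma wien_leaf:
  assumes e: "e \<in> E" "conn (E - {e})" and w: "e \<inter> \<Union>(E - {e}) = {w}"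
    and z: "z \<in> e - \<Union>(E - {e})"
  shows "wien E + K * (K - 1) = wien (E - {e}) + 2 * K * tr E z"
proof -
  let ?V = "\<Union>(E - {e})" and ?R = "e - \<Union>(E - {e})" and ?d = "dst (E - {e})"
  have "?R = e - {w}" "w \<in> e" using w by auto
  then have r: "card ?R = K" using card_edge[OF e(1)] by simp
  have fV: "finite ?V" "finite ?R" using fin_verts fin_edge[OF e(1)] by (auto intro: rev_finite_subset)
  have s: "(\<Sum>y\<in>?V. dst E x y) = card ?V + tr (E - {e}) w" if x: "x \<in> ?R" for x
  proof -
    have "(\<Sum>y\<in>?V. dst E x y) = (\<Sum>y\<in>?V. Suc (?d w y))"
      using leaf_distances(2)[OF e w _ x] by (rule sum.cong[OF refl])
    then show ?thesis by (simp add: tr_def sum_Suc)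
  qed
  have "(\<Sum>x\<in>?V. \<Sum>y\<in>?V. dst E x y) = wien (E - {e})"
    unfolding wien_def tr_def using leaf_distances(1)[OF e w] by (intro sum.cong refl)
  then have 1: "wien E = wien (E - {e}) + 2 * K * (card ?V + tr (E - {e}) w) + K * (K - 1)"
    using wien_split[OF e(1)] s by (simp add: r)
  have U: "\<Union>E = ?V \<union> ?R" "?V \<inter> ?R = {}" using e by auto
  have "tr E z = (\<Sum>y\<in>?V. dst E z y) + (\<Sum>y\<in>?R. dst E z y)"
    unfolding tr_def U(1) by (rule sum.union_disjoint[OF fV U(2)])
  also have "(\<Sum>y\<in>?R. dst E z y) = dst E z z + (\<Sum>y\<in>?R - {z}. dst E z y)"
    by (rule sum.remove[OF fV(2) z])
  also have "(\<Sum>y\<in>?R - {z}. dst E z y) = (\<Sum>y\<in>?R - {z}. 1)"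
    using z dst_edge_eq[OF con e(1), of z] by (intro sum.cong refl) auto
  also have "\<dots> = K - 1" using card_Diff_singleton[OF z] r by simp
  finally have "tr E z = card ?V + tr (E - {e}) w + (K - 1)" using s[OF z] by simp
  then have "2 * K * tr E z = 2 * K * (card ?V + tr (E - {e}) w) + 2 * (K * (K - 1))"
    by (simp only: distrib_left mult.assoc)
  then show ?thesis using 1 by linarith
qed

end

text \<open>Twice the transmission of the path with \<open>m\<close> edges of \<open>K + 1\<close> vertices.\<close>

primrec tree_bound :: "nat \<Rightarrow> nat \<Rightarrow> nat" where
  "tree_bound K 0 = 0"
| "tree_bound K (Suc m) = tree_bound K m + K * K * (m * (m + 3)) + K * K + K"

lemma wien_single_edge: "ksys K {e} \<Longrightarrow> wien {e} = K * K + K"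
proof -
  assume "ksys K {e}"
  then interpret ksys K "{e}" .
  show ?thesis using wien_split[of e] card_edge by simp
qed

text \<open>Remove an edge of maximal level, leaving m edges. For m > 0 they have at most m * K + 1
  vertices, the shared vertex has distance sum at most K * m * (m + 1) / 2, and at most K vertices
  are private. These maxima inserted into \<open>wien_remove_le\<close> give the increment of
  \<open>tree_bound\<close>.\<close>

lemma wien_le_tree_bound:
  assumes "ksys K E"
  shows "wien E \<le> tree_bound K (card E)"
  using assms
proof (induction "card E" arbitrary: E)
  case 0
  then interpret ksys K E by simp
  have "E = {}" using 0(1) fin by simp
  then show ?case by (simp add: wien_def)
next
  case (Suc m)
  interpret ksys K E by fact
  have ne: "E \<noteq> {}" using Suc.hyps(2) by auto
  then obtain z where z: "z \<in> \<Union>E" using edge_ne by blast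
  obtain e where e: "e \<in> E" "\<And>h. h \<in> E \<Longrightarrow> lev E z h \<le> lev E z e" using ex_max_lev[OF ne, of z] by blast
  then have c: "conn (E - {e})" by (rule max_lev_noncut[OF z])
  interpret E': ksys K "E - {e}" by (rule ksys_remove[OF c])
  have m: "card (E - {e}) = m" using Suc.hyps(2) e by simp
  have IH: "wien (E - {e}) \<le> tree_bound K m" using Suc.hyps(1)[of "E - {e}"] m E'.ksys_axioms by simp
  show ?case
  proof (cases "m = 0")
    case True
    then have "E - {e} = {}" using m E'.fin by (metis card_0_eq)
    then have "E = {e}" using e(1) by blast
    then show ?thesis using wien_single_edge[of K e] ksys_axioms by simp
  next
    case False
    then have ne': "E - {e} \<noteq> {}" using m by (metis card.empty)
    obtain s where s: "s \<in> e" "s \<in> \<Union>(E - {e})" using ex_shared[OF e(1) ne'] by blast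
    let ?r = "card (e - \<Union>(E - {e}))" and ?B = "card (\<Union>(E - {e})) + tr (E - {e}) s"
    have "e - \<Union>(E - {e}) \<subseteq> e - {s}" using s by blast
    then have "?r \<le> card (e - {s})" using fin_edge[OF e(1)] by (intro card_mono) auto
    then have r: "?r \<le> K" using card_edge[OF e(1)] s by simp
    have B: "2 * ?B \<le> K * (m * (m + 3)) + 2"
      using E'.tr_le[OF s(2)] E'.card_verts_le[OF ne'] by (simp add: m algebra_simps)
    have "2 * ?r * ?B = ?r * (2 * ?B)" by simp
    also have "\<dots> \<le> K * (K * (m * (m + 3)) + 2)" by (rule mult_le_mono[OF r B])
    finally have "2 * ?r * ?B \<le> K * K * (m * (m + 3)) + 2 * K" by (simp add: algebra_simps)
    moreover have "?r * (?r - 1) \<le> K * (K - 1)" using r by (intro mult_le_mono) auto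
    moreover have "K * (K - 1) + K = K * K" by (cases K) auto
    ultimately have "wien E \<le> tree_bound K m + K * K * (m * (m + 3)) + K * K + K"
      using wien_remove_le[OF e(1) c s] IH by linarith
    then show ?thesis unfolding Suc.hyps(2)[symmetric] tree_bound.simps .
  qed
qed

subsection \<open>The extremal edge sequence\<close>

text \<open>The edge sequence of \<open>C2_tilde\<close>, read from the end of one pendant path to the end of the other;
  the two edges of the cycle are \<open>p a\<close> and \<open>p (Suc a)\<close>.\<close>

definition chain2 :: "nat \<Rightarrow> nat \<Rightarrow> nat \<Rightarrow> (nat \<Rightarrow> 'a set) \<Rightarrow> bool" where
  "chain2 K m a p \<longleftrightarrow> Suc a < m \<and> (\<forall>i<m. card (p i) = Suc K) \<and>
     (\<forall>i j. Suc i < j \<longrightarrow> j < m \<longrightarrow> p i \<inter> p j = {}) \<and>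
     (\<forall>i. Suc i < m \<longrightarrow> card (p i \<inter> p (Suc i)) = (if i = a then 2 else 1))"

lemma chain2_index: "chain2 K m a p \<Longrightarrow> Suc a < m"
  and chain2_card_edge: "chain2 K m a p \<Longrightarrow> i < m \<Longrightarrow> card (p i) = Suc K"
  and chain2_far: "chain2 K m a p \<Longrightarrow> Suc i < j \<Longrightarrow> j < m \<Longrightarrow> p i \<inter> p j = {}"
  and chain2_consec: "chain2 K m a p \<Longrightarrow> Suc i < m \<Longrightarrow> card (p i \<inter> p (Suc i)) = (if i = a then 2 else 1)"
  by (simp_all add: chain2_def)

lemma chain2_finite_edge: "chain2 K m a p \<Longrightarrow> i < m \<Longrightarrow> finite (p i)"
  using chain2_card_edge by (metis card.infinite nat.distinct(1))

lemma chain2_meet: "chain2 K m a p \<Longrightarrow> Suc i < m \<Longrightarrow> p i \<inter> p (Suc i) \<noteq> {}"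
  using chain2_consec[of K m a p i] by (auto split: if_splits)

lemma chain2_near:
  assumes "chain2 K m a p" "i < m" "j < m" "p i \<inter> p j \<noteq> {}"
  shows "i \<le> Suc j \<and> j \<le> Suc i"
  using chain2_far[OF assms(1), of i j] chain2_far[OF assms(1), of j i] assms by fastforce

text \<open>Equal edges would meet in K + 1 \<ge> 3 vertices, more than two edges of the sequence
  share.\<close>

lemma chain2_ne:
  assumes "chain2 K m a p" "2 \<le> K" "i < j" "j < m"
  shows "p i \<noteq> p j"
proof
  assume eq: "p i = p j"
  then have "p i \<inter> p j \<noteq> {}" using chain2_card_edge[OF assms(1), of i] assms by auto
  then have "j = Suc i" using chain2_near[OF assms(1), of i j] assms by simp
  then have "card (p i) = (if i = a then 2 else 1)" using chain2_consec[OF assms(1), of i] eq assms by simp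
  moreover have "card (p i) = Suc K" using chain2_card_edge[OF assms(1)] assms by simp
  ultimately show False using assms(2) by (simp split: if_splits)
qed

lemma chain2_inj: "chain2 K m a p \<Longrightarrow> 2 \<le> K \<Longrightarrow> inj_on p {..<m}"
  by (intro inj_onI) (metis chain2_ne lessThan_iff linorder_neqE_nat)

lemma chain2_conn:
  assumes "chain2 K m a p"
  shows "conn (p ` {..<m})"
proof -
  let ?R = "(adj (p ` {..<m}))\<^sup>*"
  have edge: "(x, y) \<in> ?R" if "x \<in> p i" "y \<in> p i" "i < m" for x y i
    using adjI[of "p i" "p ` {..<m}" x y] that by blast
  have "i < m \<Longrightarrow> x \<in> p 0 \<Longrightarrow> y \<in> p i \<Longrightarrow> (x, y) \<in> ?R" for x y i
  proof (induction i arbitrary: y)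
    case (Suc i)
    obtain s where s: "s \<in> p i" "s \<in> p (Suc i)" using chain2_meet[OF assms Suc.prems(1)] by blast
    then have "(x, s) \<in> ?R" using Suc by simp
    moreover have "(s, y) \<in> ?R" using edge s Suc.prems by blast
    ultimately show ?case by (rule rtrancl_trans)
  qed (rule edge)
  moreover have "sym ?R" by (rule sym_rtrancl) (meson adj_sym symI)
  moreover have "p 0 \<noteq> {}" using chain2_card_edge[OF assms, of 0] chain2_index[OF assms] by auto
  then obtain z where "z \<in> p 0" by blast
  ultimately have "(z, x) \<in> ?R \<and> (x, z) \<in> ?R" if "x \<in> \<Union>(p ` {..<m})" for x
    using that by (auto dest: symD)
  then show ?thesis unfolding conn_def by (meson rtrancl_trans)
qed

lemma chain2_ksys:
  assumes "chain2 K m a p"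
  shows "ksys K (p ` {..<m})"
  by unfold_locales (use chain2_conn[OF assms] chain2_card_edge[OF assms] in auto)

text \<open>Serves to exchange the two central positions of the doubled pair, and to bring the other
  end of a sequence to the place where edges are appended.\<close>

lemma chain2_rev:
  assumes "chain2 K m a p"
  shows "chain2 K m (m - 2 - a) (\<lambda>i. p (m - 1 - i))"
  unfolding chain2_def
proof (intro conjI allI impI)
  note a = chain2_index[OF assms]
  show "Suc (m - 2 - a) < m" using a by simp
  show "card (p (m - 1 - i)) = Suc K" if "i < m" for i using chain2_card_edge[OF assms] that by simp
  show "p (m - 1 - i) \<inter> p (m - 1 - j) = {}" if "Suc i < j" "j < m" for i j
    using chain2_far[OF assms, of "m - 1 - j" "m - 1 - i"] that by (simp add: Int_commute)
  show "card (p (m - 1 - i) \<inter> p (m - 1 - Suc i)) = (if i = m - 2 - a then 2 else 1)" if i: "Suc i < m" for i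
  proof -
    obtain j where j: "m = Suc (Suc i) + j" using i by (metis Suc_leI le_Suc_ex)
    then have "m - 1 - i = Suc j" "m - 1 - Suc i = j" by simp_all
    moreover have "(i = m - 2 - a) = (j = a)" using j a by auto
    moreover have "card (p j \<inter> p (Suc j)) = (if j = a then 2 else 1)"
      using chain2_consec[OF assms, of j] j by simp
    ultimately show ?thesis by (simp add: Int_commute)
  qed
qed

lemma image_rev_lessThan: "(\<lambda>i. p (m - 1 - i)) ` {..<m} = p ` {..<m :: nat}"
proof -
  have "(\<lambda>i. m - 1 - i) ` {..<m} = {..<m}"
  proof
    show "{..<m} \<subseteq> (\<lambda>i. m - 1 - i) ` {..<m}"
    proof
      fix i assume "i \<in> {..<m}"
      then have "i = m - 1 - (m - 1 - i)" "m - 1 - i \<in> {..<m}" by auto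
      then show "i \<in> (\<lambda>i. m - 1 - i) ` {..<m}" by (rule image_eqI)
    qed
  qed auto
  then show ?thesis by (metis image_image)
qed

lemma chain2_tl:
  assumes "chain2 K (Suc m) (Suc a) p"
  shows "chain2 K m a (\<lambda>i. p (Suc i))"
  using assms by (auto simp: chain2_def)

text \<open>A new edge meets the union of the earlier ones exactly in its overlap with its
  predecessor, so no other terms of inclusion-exclusion occur.\<close>

lemma card_chain_prefix:
  fixes p :: "nat \<Rightarrow> 'a set"
  assumes "\<And>i. i \<le> n \<Longrightarrow> finite (p i)" "\<And>i j. Suc i < j \<Longrightarrow> j \<le> n \<Longrightarrow> p i \<inter> p j = {}"
  shows "card (\<Union>i\<le>n. p i) + (\<Sum>i<n. card (p i \<inter> p (Suc i))) = (\<Sum>i\<le>n. card (p i))"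
  using assms
proof (induction n)
  case (Suc n)
  let ?U = "\<Union>i\<le>n. p i"
  have "x \<notin> p (Suc n)" if "i < n" "x \<in> p i" for i x using Suc.prems(2)[of i "Suc n"] that by auto
  then have "?U \<inter> p (Suc n) = p n \<inter> p (Suc n)" by (auto simp: le_less)
  moreover have "card ?U + card (p (Suc n)) = card (?U \<union> p (Suc n)) + card (?U \<inter> p (Suc n))"
    by (rule card_Un_Int) (use Suc.prems(1) in auto)
  moreover have "(\<Union>i\<le>Suc n. p i) = ?U \<union> p (Suc n)" by (auto simp: atMost_Suc)
  moreover have "card ?U + (\<Sum>i<n. card (p i \<inter> p (Suc i))) = (\<Sum>i\<le>n. card (p i))"
    by (rule Suc.IH) (use Suc.prems in auto)
  ultimately show ?case by simp
qed simp

lemma chain2_card_verts: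
  assumes "chain2 K m a p"
  shows "card (\<Union>(p ` {..<m})) = m * K"
proof -
  obtain n where m: "m = Suc n" using chain2_index[OF assms] by (metis Suc_lessE)
  then have a: "a < n" using chain2_index[OF assms] by simp
  have "card (\<Union>i\<le>n. p i) + (\<Sum>i<n. card (p i \<inter> p (Suc i))) = (\<Sum>i\<le>n. card (p i))"
    by (rule card_chain_prefix) (use chain2_finite_edge[OF assms] chain2_far[OF assms] m in auto)
  moreover have "(\<Sum>i\<le>n. card (p i)) = (\<Sum>i\<le>n. Suc K)"
    by (rule sum.cong) (use chain2_card_edge[OF assms] m in auto)
  moreover have "(\<Sum>i<n. card (p i \<inter> p (Suc i))) = (\<Sum>i<n. if i = a then 2 else 1)"
    by (rule sum.cong) (use chain2_consec[OF assms] m in auto)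
  moreover have "(\<Sum>i<n. if i = a then 2 else 1 :: nat) = (\<Sum>i<n. (if i = a then 1 else 0) + 1)"
    by (rule sum.cong) auto
  moreover have "\<dots> = n + 1" using a by (simp only: sum.distrib) simp
  moreover have "(\<Union>i\<le>n. p i) = \<Union>(p ` {..<m})" using m by (simp add: lessThan_Suc_atMost)
  ultimately show ?thesis using m by simp
qed

lemma chain2_lev:
  assumes c: "chain2 K m a p" and z: "z \<in> p 0" "z \<notin> p 1" and i: "i < m"
  shows "lev (p ` {..<m}) z (p i) = Suc i"
proof -
  let ?E = "p ` {..<m}"
  interpret ksys K ?E by (rule chain2_ksys[OF c])
  have m: "0 < m" using i by simp
  \<comment> \<open>\<open>idx x\<close> is the index of the first edge through x. Away from z the
    distance is expected to be one more; this guess is the potential \<phi>.\<close>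
  define idx where "idx x = (LEAST i. x \<in> p i)" for x
  define \<phi> where "\<phi> x = (if x = z then 0 else Suc (idx x))" for x
  have idx: "j \<le> Suc (idx x) \<and> idx x \<le> j" if "x \<in> p j" "j < m" for x j
  proof
    show 1: "idx x \<le> j" unfolding idx_def using that(1) by (rule Least_le)
    have "x \<in> p (idx x)" unfolding idx_def using that(1) by (rule LeastI)
    then have "p (idx x) \<inter> p j \<noteq> {}" using that(1) by blast
    then show "j \<le> Suc (idx x)" using chain2_near[OF c _ that(2), of "idx x"] 1 that(2) by simp
  qed
  have zonly: "j = 0" if "z \<in> p j" "j < m" for j
  proof (rule ccontr)
    assume "j \<noteq> 0"
    moreover have "p 0 \<inter> p j \<noteq> {}" using z that by blast
    ultimately have "j = 1" using chain2_near[OF c m that(2)] by simp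
    then show False using z that by simp
  qed
  have zE: "z \<in> \<Union>?E" using z m by blast
  have lip: "\<phi> v \<le> Suc (\<phi> u)" if h: "h \<in> ?E" "u \<in> h" "v \<in> h" for h u v
  proof -
    obtain j where j: "h = p j" "j < m" using h(1) by auto
    have "\<phi> u = 0 \<and> j = 0 \<or> j \<le> \<phi> u" using idx[of u j] zonly[of j] h j by (auto simp: \<phi>_def)
    moreover have "\<phi> v \<le> Suc j" using idx[of v j] h j by (auto simp: \<phi>_def)
    ultimately show ?thesis by linarith
  qed
  have dge: "\<phi> x \<le> dst ?E z x" if "x \<in> \<Union>?E" for x
    using dst_ge_lipschitz[of ?E z x \<phi>, OF con zE that lip] by (simp add: \<phi>_def)
  show ?thesis
    using i
  proof (induction i)
    case 0
    have "lev ?E z (p 0) \<le> Suc (dst ?E z z)" by (rule lev_le) (use z m in auto)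
    then show ?case using lev_pos[of z "p 0"] by simp
  next
    case (Suc i)
    have pE: "p i \<in> ?E" "p (Suc i) \<in> ?E" using Suc.prems by auto
    obtain s where s: "s \<in> p i" "s \<in> p (Suc i)" using chain2_meet[OF c Suc.prems] by blast
    have "dst ?E z s \<le> Suc i" using dst_le_lev[OF pE(1) zE s(1)] Suc by simp
    then have 1: "lev ?E z (p (Suc i)) \<le> Suc (Suc i)" using lev_le[OF pE(2) s(2), of z] by simp
    obtain x where x: "x \<in> p (Suc i)" "Suc (dst ?E z x) = lev ?E z (p (Suc i))"
      by (rule lev_attained[OF pE(2)])
    have "x \<noteq> z" using zonly[of "Suc i"] x Suc.prems by auto
    then have "Suc i \<le> \<phi> x" using idx[OF x(1) Suc.prems] by (simp add: \<phi>_def)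
    moreover have "\<phi> x \<le> dst ?E z x" by (rule dge) (use x pE in blast)
    ultimately show ?case using 1 x(2) by linarith
  qed
qed

lemma sum_Suc_lessThan: "2 * (\<Sum>i<m. Suc i) = m * (m + 1)" for m :: nat
  by (induction m) auto

text \<open>With \<open>m * K\<close> vertices exactly one slot is empty. It is in
  \<open>p (Suc a)\<close>, which has level a + 2 and at least two vertices in common with
  \<open>p a\<close>, where all distances are smaller. So the sum falls short of the maximum K * m *
  (m + 1) / 2 by a + 2 only.\<close>

lemma chain2_tr_ge:
  assumes c: "chain2 K m a p" and K: "2 \<le> K" and z: "z \<in> p 0" "z \<notin> p 1"
  shows "K * (m * (m + 1)) \<le> 2 * tr (p ` {..<m}) z + 2 * (a + 2)"
proof -
  let ?E = "p ` {..<m}"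
  interpret ksys K ?E by (rule chain2_ksys[OF c])
  note a = chain2_index[OF c]
  have zE: "z \<in> \<Union>?E" using z a by auto
  note inj = chain2_inj[OF c K]
  have sm: "(\<Sum>e\<in>?E. g e) = (\<Sum>i<m. g (p i))" for g :: "'a set \<Rightarrow> nat"
    using sum.reindex[OF inj, of g] by simp
  obtain f where f: "tr ?E z + (\<Sum>e\<in>?E. lev ?E z e * f e) = K * sum (lev ?E z) ?E"
    "sum f ?E + card (\<Union>?E) = card ?E * K + 1"
    "\<forall>e\<in>?E. K \<le> f e + card {x \<in> e. dst ?E z x = lev ?E z e}"
    using deficiency[OF zE] by blast
  have lv: "lev ?E z (p i) = Suc i" if "i < m" for i by (rule chain2_lev[OF c z that])
  have "sum (lev ?E z) ?E = (\<Sum>i<m. Suc i)" unfolding sm by (rule sum.cong) (use lv in auto)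
  then have sl: "2 * sum (lev ?E z) ?E = m * (m + 1)" using sum_Suc_lessThan by simp
  have "card ?E = m" using card_image[OF inj] by simp
  then have f1: "(\<Sum>i<m. f (p i)) = 1" using f(2) chain2_card_verts[OF c] sm[of f] by simp
  let ?q = "p (Suc a)"
  have "dst ?E z x \<noteq> Suc (Suc a)" if "x \<in> p a" for x
    using dst_le_lev[of "p a" z x] zE that a lv[of a] by simp
  then have "{x \<in> ?q. dst ?E z x = lev ?E z ?q} \<subseteq> ?q - (p a \<inter> ?q)" using lv[OF a] by auto
  then have "card {x \<in> ?q. dst ?E z x = lev ?E z ?q} \<le> card (?q - (p a \<inter> ?q))"
    by (rule card_mono[rotated]) (use chain2_finite_edge[OF c a] in simp)
  also have "\<dots> = K - 1"
    using card_Diff_subset[of "p a \<inter> ?q" ?q] chain2_finite_edge[OF c a] chain2_card_edge[OF c a]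
      chain2_consec[OF c a] by simp
  finally have "card {x \<in> ?q. dst ?E z x = lev ?E z ?q} \<le> K - 1" .
  moreover have "?q \<in> ?E" using a by simp
  then have "K \<le> f ?q + card {x \<in> ?q. dst ?E z x = lev ?E z ?q}" by (rule bspec[OF f(3)])
  ultimately have "1 \<le> f ?q" using K by linarith
  moreover have "(\<Sum>i<m. f (p i)) = f ?q + (\<Sum>i\<in>{..<m} - {Suc a}. f (p i))"
    by (rule sum.remove) (use a in auto)
  ultimately have fq: "f ?q = 1" "(\<Sum>i\<in>{..<m} - {Suc a}. f (p i)) = 0" using f1 by linarith+
  have "(\<Sum>e\<in>?E. lev ?E z e * f e) = (\<Sum>i<m. lev ?E z (p i) * f (p i))" by (rule sm)
  also have "\<dots> = lev ?E z ?q * f ?q + (\<Sum>i\<in>{..<m} - {Suc a}. lev ?E z (p i) * f (p i))"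
    by (rule sum.remove) (use a in auto)
  also have "(\<Sum>i\<in>{..<m} - {Suc a}. lev ?E z (p i) * f (p i)) = 0" using fq(2) by simp
  finally have "(\<Sum>e\<in>?E. lev ?E z e * f e) = a + 2" using fq(1) lv[OF a] by simp
  then have "2 * tr ?E z + 2 * (a + 2) = K * (2 * sum (lev ?E z) ?E)" using f(1) by simp
  then show ?thesis using sl by simp
qed


text \<open>Twice the transmission of the extremal hypergraph with \<open>n + 2\<close> edges of \<open>K + 1\<close> vertices.\<close>

primrec cyc_bound :: "nat \<Rightarrow> nat \<Rightarrow> int" where
  "cyc_bound K 0 = 6 * int K * int K - 6 * int K + 2"
| "cyc_bound K (Suc n) = cyc_bound K n + int K * int K * ((int n + 3) * (int n + 4))
     - 2 * int K * int (n div 2 + 3) - int K * (int K - 1)"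

lemma (in ksys) sum_dst_edge:
  assumes "e \<in> E" "x \<in> e"
  shows "(\<Sum>y\<in>e. dst E x y) = K"
proof -
  have "(\<Sum>y\<in>e. dst E x y) = dst E x x + (\<Sum>y\<in>e - {x}. dst E x y)"
    by (rule sum.remove[OF fin_edge[OF assms(1)] assms(2)])
  also have "(\<Sum>y\<in>e - {x}. dst E x y) = (\<Sum>y\<in>e - {x}. 1)"
    using dst_edge_eq[OF con assms] by (intro sum.cong refl) auto
  also have "\<dots> = K" using card_edge[OF assms(1)] assms(2) by simp
  finally show ?thesis by simp
qed

text \<open>The 2 * K vertices are pairwise at distance 1, except that the K - 1 private vertices of
  one edge are at distance 2 from those of the other. This gives 2 * K * (2 * K - 1) + 2 * (K - 1) *
  (K - 1), the starting value of \<open>cyc_bound\<close>.\<close>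

lemma chain2_wien_two_edges:
  assumes c: "chain2 K 2 0 p" and K: "2 \<le> K"
  shows "cyc_bound K 0 \<le> int (wien (p ` {..<2}))"
proof -
  let ?e = "p 0" and ?f = "p 1"
  have E: "p ` {..<2} = {?e, ?f}" by (auto simp: numeral_2_eq_2 lessThan_Suc)
  have ne: "?e \<noteq> ?f" using chain2_ne[OF c K, of 0 1] by simp
  have i: "card (?e \<inter> ?f) = 2" using chain2_consec[OF c, of 0] by simp
  interpret ksys K "{?e, ?f}" using chain2_ksys[OF c] E by simp
  have V: "\<Union>({?e, ?f} - {?e}) = ?f" using ne by auto
  have fi: "finite ?e" "finite ?f" using chain2_finite_edge[OF c] by simp_all
  have ce: "card ?e = Suc K" "card ?f = Suc K" using chain2_card_edge[OF c] by simp_all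
  have R: "card (?e - ?f) = K - 1"
    using card_Diff_subset_Int[of ?e ?f] fi ce i by simp
  have d: "card (?f - ?e) = K - 1"
    using card_Diff_subset_Int[of ?f ?e] fi ce i by (simp add: Int_commute)
  have "2 * K \<le> (\<Sum>y\<in>?f. dst {?e, ?f} x y)" if x: "x \<in> ?e - ?f" for x
  proof -
    have far: "2 \<le> dst {?e, ?f} x y" if y: "y \<in> ?f - ?e" for y
    proof -
      have xy: "x \<in> \<Union>{?e, ?f}" "y \<in> \<Union>{?e, ?f}" using x y by auto
      have "dst {?e, ?f} x y \<noteq> 0" using dst_eq_0[OF con xy] x y by auto
      moreover have "(x, y) \<notin> adj {?e, ?f} ^^ 1" using x y by (auto simp: adj_def)
      then have "dst {?e, ?f} x y \<noteq> 1" using dst_relpow[OF con xy] by metis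
      ultimately show ?thesis by linarith
    qed
    have near: "1 \<le> dst {?e, ?f} x y" if y: "y \<in> ?f \<inter> ?e" for y
    proof -
      have "x \<noteq> y" using x y by blast
      then show ?thesis using dst_edge_eq[OF con, of ?e x y] x y by simp
    qed
    have "(\<Sum>y\<in>?f. dst {?e, ?f} x y) = (\<Sum>y\<in>?f \<inter> ?e. dst {?e, ?f} x y) + (\<Sum>y\<in>?f - ?e. dst {?e, ?f} x y)"
      by (rule sum.Int_Diff[OF fi(2)])
    moreover have "(\<Sum>y\<in>?f \<inter> ?e. 1) \<le> (\<Sum>y\<in>?f \<inter> ?e. dst {?e, ?f} x y)"
      by (rule sum_mono) (rule near)
    moreover have "(\<Sum>y\<in>?f - ?e. 2) \<le> (\<Sum>y\<in>?f - ?e. dst {?e, ?f} x y)"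
      by (rule sum_mono) (rule far)
    ultimately show ?thesis using i d K by (simp add: Int_commute)
  qed
  then have "(\<Sum>x\<in>?e - ?f. 2 * K) \<le> (\<Sum>x\<in>?e - ?f. \<Sum>y\<in>?f. dst {?e, ?f} x y)" by (rule sum_mono)
  moreover have "(\<Sum>x\<in>?f. \<Sum>y\<in>?f. dst {?e, ?f} x y) = Suc K * K"
    using sum_dst_edge[of ?f] ce by simp
  ultimately have "Suc K * K + 2 * ((K - 1) * (2 * K)) + (K - 1) * (K - 1 - 1) \<le> wien {?e, ?f}"
    using wien_split[OF insertI1, unfolded V R] unfolding sum_constant R of_nat_id by linarith
  moreover obtain j where j: "K = Suc (Suc j)" using K by (metis add_2_eq_Suc le_Suc_ex)
  \<comment> \<open>The same value at K = j + 2; the substitution eliminates truncated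
    subtraction.\<close>
  ultimately have "14 + j * 18 + j * (j * 6) \<le> wien {?e, ?f}" by (simp add: algebra_simps)
  then have "int (14 + j * 18 + j * (j * 6)) \<le> int (wien {?e, ?f})" by (rule of_nat_mono)
  then show ?thesis unfolding E j by (simp add: algebra_simps)
qed

text \<open>Cut an end edge on a side whose pendant path is not the shorter one, so that the rest is
  balanced again. In \<open>wien_leaf\<close> and \<open>chain2_tr_ge\<close> the doubled pair is
  then at a = n div 2 + 1, and a + 2 becomes the term n div 2 + 3 of
  \<open>cyc_bound\<close>.\<close>

lemma chain2_wien_ge:
  assumes "chain2 K (n + 2) a p" "2 \<le> K" "a = n div 2 \<or> a = (n + 1) div 2"
  shows "cyc_bound K n \<le> int (wien (p ` {..<n + 2}))"
  using assms
proof (induction n arbitrary: a p)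
  case 0
  then show ?case using chain2_wien_two_edges[of K p] by (simp add: numeral_2_eq_2)
next
  case (Suc n)
  have step: "cyc_bound K (Suc n) \<le> int (wien (p ` {..<Suc n + 2}))"
    if c: "chain2 K (Suc n + 2) a p" and a: "a = (n + 2) div 2" for a and p :: "nat \<Rightarrow> 'a set"
  proof -
    let ?E = "p ` {..<Suc n + 2}" and ?E' = "(\<lambda>i. p (Suc i)) ` {..<n + 2}"
    interpret ksys K ?E by (rule chain2_ksys[OF c])
    have a': "a = Suc (n div 2)" using a by simp
    have c': "chain2 K (n + 2) (n div 2) (\<lambda>i. p (Suc i))" using chain2_tl c unfolding a' by simp
    have IH: "cyc_bound K n \<le> int (wien ?E')" using Suc.IH[OF c' Suc.prems(2)] by simp
    have ins: "?E = insert (p 0) ?E'" by (simp only: add_Suc lessThan_Suc_eq_insert_0 image_insert image_image)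
    have "p 0 \<noteq> p (Suc i)" if "i < n + 2" for i using chain2_ne[OF c Suc.prems(2), of 0 "Suc i"] that by simp
    then have rem: "?E - {p 0} = ?E'" unfolding ins by auto
    have e: "p 0 \<in> ?E" by simp
    have con': "conn (?E - {p 0})" unfolding rem by (rule chain2_conn[OF c'])
    have "card (p 0 \<inter> p 1) = 1" using chain2_consec[OF c, of 0] a' by simp
    then obtain w where w: "p 0 \<inter> p 1 = {w}" by (auto simp: card_1_singleton_iff)
    have "x \<in> p 1" if "x \<in> p 0" "x \<in> p (Suc i)" "i < n + 2" for x i
    proof (cases i)
      case (Suc j)
      then show ?thesis using chain2_far[OF c, of 0 "Suc i"] that by auto
    qed (use that in simp)
    then have "p 0 \<inter> \<Union>?E' \<subseteq> p 0 \<inter> p 1" by auto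
    moreover have "p (Suc 0) \<subseteq> \<Union>?E'" by (rule Union_upper) simp
    then have "p 1 \<subseteq> \<Union>?E'" by simp
    ultimately have "p 0 \<inter> \<Union>?E' = {w}" using w by blast
    then have w': "p 0 \<inter> \<Union>(?E - {p 0}) = {w}" by (simp only: rem)
    have "card (p 0 - {w}) = K"
      using chain2_card_edge[OF c, of 0] w by (subst card_Diff_singleton) auto
    then have "p 0 - {w} \<noteq> {}" using Suc.prems(2) by (metis card.empty not_numeral_le_zero)
    then obtain z where z: "z \<in> p 0" "z \<noteq> w" by blast
    have z1: "z \<notin> p 1" using z w by blast
    have "z \<in> p 0 - \<Union>(?E - {p 0})" using z w' by blast
    then have "wien ?E + K * (K - 1) = wien (?E - {p 0}) + 2 * K * tr ?E z"
      by (rule wien_leaf[OF e con' w'])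
    then have "int (wien ?E + K * (K - 1)) = int (wien ?E' + 2 * K * tr ?E z)" unfolding rem by simp
    then have eq: "int (wien ?E) + int K * (int K - 1) = int (wien ?E') + int K * (2 * int (tr ?E z))"
      using Suc.prems(2) by (simp add: of_nat_diff mult.assoc mult.left_commute)
    have "K * ((Suc n + 2) * (Suc n + 2 + 1)) \<le> 2 * tr ?E z + 2 * (a + 2)"
      by (rule chain2_tr_ge[OF c Suc.prems(2) z(1) z1])
    moreover have "Suc n + 2 = n + 3" "n + 3 + 1 = n + 4" "a + 2 = n div 2 + 3" using a' by simp_all
    ultimately have "K * ((n + 3) * (n + 4)) \<le> 2 * tr ?E z + 2 * (n div 2 + 3)" by (simp only:)
    then have "int (K * ((n + 3) * (n + 4))) \<le> int (2 * tr ?E z + 2 * (n div 2 + 3))" by (rule of_nat_mono)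
    then have "int K * ((int n + 3) * (int n + 4)) - 2 * int (n div 2 + 3) \<le> 2 * int (tr ?E z)"
      by (simp only: of_nat_mult of_nat_add of_nat_numeral)
    then have "int K * (int K * ((int n + 3) * (int n + 4)) - 2 * int (n div 2 + 3)) \<le> int K * (2 * int (tr ?E z))"
      by (rule mult_left_mono) simp
    then show ?thesis using IH eq unfolding cyc_bound.simps by (simp only: right_diff_distrib mult.assoc)
  qed
  show ?case
  proof (cases "a = (n + 2) div 2")
    case True
    then show ?thesis using step[OF Suc.prems(1)] by simp
  next
    case False
    then have a: "a = (n + 1) div 2" using Suc.prems(3) by simp
    then have "Suc n + 2 - 2 - a = (n + 2) div 2" by presburger
    then show ?thesis using step[OF chain2_rev[OF Suc.prems(1)]] image_rev_lessThan[of p "Suc n + 2"] by simp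
  qed
qed

text \<open>The bound for a non-cut edge with at least two shared vertices; it is attained by
  \<open>C2_tilde\<close> with one empty pendant path.\<close>

definition end_cycle_bound :: "nat \<Rightarrow> nat \<Rightarrow> int" where
  "end_cycle_bound K n = int (tree_bound K (Suc n)) +
     (int K - 1) * (int K * ((int n + 1) * (int n + 4))) + (int K - 1) * (int K - 2)"

lemma end_cycle_bound_Suc:
  "cyc_bound K (Suc n) - end_cycle_bound K (Suc n) =
   cyc_bound K n - end_cycle_bound K n + 2 * int K * int ((n + 1) div 2)"
proof -
  have "int n - int (n div 2) = int ((n + 1) div 2)" by presburger
  then have "2 * int K * int ((n + 1) div 2) = 2 * int K * int n - 2 * int K * int (n div 2)"
    by (metis right_diff_distrib)
  then show ?thesis by (simp add: end_cycle_bound_def algebra_simps)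
qed

text \<open>The gap is 0 at n = 0 and does not grow in the step to n = 1: with two or three edges
  the balanced hypergraph itself has an empty pendant path. The gap is positive from four edges
  on.\<close>

lemma end_cycle_bound_le:
  assumes "1 \<le> K"
  shows "end_cycle_bound K n \<le> cyc_bound K n \<and> (2 \<le> n \<longrightarrow> end_cycle_bound K n < cyc_bound K n)"
proof (induction n)
  case 0
  show ?case by (simp add: end_cycle_bound_def algebra_simps)
next
  case (Suc n)
  have "0 \<le> 2 * int K * int ((n + 1) div 2)" by simp
  moreover have "0 < 2 * int K * int ((n + 1) div 2)" if "1 \<le> n" using assms that by simp
  ultimately show ?case using Suc end_cycle_bound_Suc[of K n] by (cases "1 \<le> n") auto
qed

section \<open>A non-cut edge sharing at least two vertices with the rest\<close>

context ksys
begin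

lemma card_verts_remove:
  assumes "e \<in> E"
  shows "card (\<Union>E) = card (\<Union>(E - {e})) + card (e - \<Union>(E - {e}))"
proof -
  have "\<Union>E = \<Union>(E - {e}) \<union> (e - \<Union>(E - {e}))" using assms by auto
  moreover have "finite (\<Union>(E - {e}))" "finite (e - \<Union>(E - {e}))"
    using fin_verts fin_edge[OF assms] by (auto intro: rev_finite_subset)
  ultimately show ?thesis by (metis Diff_disjoint card_Un_disjoint)
qed

lemma card_shared:
  assumes "e \<in> E"
  shows "card (e - \<Union>(E - {e})) + card (e \<inter> \<Union>(E - {e})) = Suc K"
  using card_Int_Diff[OF fin_edge[OF assms], of "\<Union>(E - {e})"] card_edge[OF assms] by simp

text \<open>At most K - 1 vertices of e are private. Vertex count and distance sum of the rest are
  at most (n + 1) * K + 1 and K * (n + 1) * (n + 2) / 2, and s' saves at least 1; this is the origin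
  of \<open>end_cycle_bound\<close>. Equality in the total forces equality in each estimate.\<close>

lemma wien_two_shared:
  assumes K: "2 \<le> K" and n: "card E = n + 2"
    and e: "e \<in> E" "conn (E - {e})" and s: "s \<in> e" "s \<in> \<Union>(E - {e})"
    and s': "s' \<in> e" "s' \<in> \<Union>(E - {e})" and ne: "s \<noteq> s'"
  shows "int (wien E) \<le> end_cycle_bound K n"
    and "int (wien E) = end_cycle_bound K n \<Longrightarrow>
      e \<inter> \<Union>(E - {e}) = {s, s'} \<and> card (\<Union>(E - {e})) = (n + 1) * K + 1 \<and>
      2 * tr (E - {e}) s = K * ((n + 1) * (n + 2)) \<and> dst (E - {e}) s s' = 1"
proof -
  interpret E': ksys K "E - {e}" by (rule ksys_remove[OF e(2)])
  let ?E = "E - {e}"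
  let ?N = "card (\<Union>?E)" and ?t = "tr ?E s" and ?D = "dst ?E s s'" and ?r = "card (e - \<Union>?E)"
  have ne': "?E \<noteq> {}" using s by blast
  have m: "card ?E = n + 1" using n e fin by simp
  have sub: "{s, s'} \<subseteq> e \<inter> \<Union>?E" using s s' by blast
  have fi: "finite (e \<inter> \<Union>?E)" using fin_edge[OF e(1)] by simp
  have "card {s, s'} \<le> card (e \<inter> \<Union>?E)" by (rule card_mono[OF fi sub])
  then have r: "?r \<le> K - 1" using card_shared[OF e(1)] ne by simp
  have D: "1 \<le> ?D" using dst_eq_0[OF E'.con s(2) s'(2)] ne by linarith
  have N: "?N \<le> (n + 1) * K + 1" using E'.card_verts_le[OF ne'] m by simp
  have t: "2 * ?t \<le> K * ((n + 1) * (n + 2))" using E'.tr_le[OF s(2)] m by simp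
  have T: "wien ?E \<le> tree_bound K (Suc n)" using wien_le_tree_bound[OF E'.ksys_axioms] m by simp
  \<comment> \<open>X is the largest possible value of Y, attained exactly when 2 * tv = P, nv = Q +
    1 and dv = 1.\<close>
  define X where "X = int K * ((int n + 1) * (int n + 4))"
  define P Q where "P = int K * ((int n + 1) * (int n + 2))" and "Q = (int n + 1) * int K"
  define nv tv dv where "nv = int ?N" and "tv = int ?t" and "dv = int ?D"
  define Y where "Y = 2 * (nv + tv - dv)"
  have "int (2 * ?t) \<le> int (K * ((n + 1) * (n + 2)))" using t by (rule of_nat_mono)
  then have t': "2 * tv \<le> P" by (simp add: P_def tv_def algebra_simps)
  have "int ?N \<le> int ((n + 1) * K + 1)" using N by (rule of_nat_mono)
  then have N': "nv \<le> Q + 1" by (simp add: Q_def nv_def algebra_simps)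
  have D': "1 \<le> dv" using D by (simp add: dv_def)
  have X_eq: "X = P + 2 * Q" by (simp add: X_def P_def Q_def algebra_simps)
  have YX: "Y \<le> X" using t' N' D' unfolding X_eq Y_def by simp
  have X0: "0 < X" unfolding X_def using K by (intro mult_pos_pos) simp_all
  have "wien E + 2 * ?r * ?D \<le> wien ?E + 2 * ?r * (?N + ?t) + ?r * (?r - 1)"
    by (rule wien_remove_two_shared_le[OF e s s'])
  then have "int (wien E + 2 * ?r * ?D) \<le> int (wien ?E + 2 * ?r * (?N + ?t) + ?r * (?r - 1))"
    by (rule of_nat_mono)
  moreover have "int ?r * int (?r - 1) = int ?r * (int ?r - 1)" by (cases ?r) auto
  ultimately have "int (wien E) + 2 * int ?r * int ?D \<le>
      int (wien ?E) + 2 * int ?r * (int ?N + int ?t) + int ?r * (int ?r - 1)"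
    by (simp only: of_nat_add of_nat_mult of_nat_numeral)
  then have W: "int (wien E) \<le> int (wien ?E) + int ?r * Y + int ?r * (int ?r - 1)"
    unfolding Y_def nv_def tv_def dv_def by (simp add: algebra_simps)
  have r': "int ?r \<le> int K - 1" using r K by linarith
  have rr: "int ?r * (int ?r - 1) \<le> (int K - 1) * (int K - 2)"
  proof (cases "?r = 0")
    case False
    then show ?thesis using r' K by (intro mult_mono) auto
  next
    case True
    then show ?thesis using K by simp
  qed
  have rX: "int ?r * X \<le> (int K - 1) * X" using r' X0 by (intro mult_right_mono) auto
  have rY: "int ?r * Y \<le> int ?r * X" using YX by (intro mult_left_mono) auto
  have T': "int (wien ?E) \<le> int (tree_bound K (Suc n))" using T by (rule of_nat_mono)
  have B: "end_cycle_bound K n = int (tree_bound K (Suc n)) + (int K - 1) * X + (int K - 1) * (int K - 2)"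
    unfolding end_cycle_bound_def X_def by simp
  show "int (wien E) \<le> end_cycle_bound K n" using W rr rX rY T' unfolding B by linarith
  assume eq: "int (wien E) = end_cycle_bound K n"
  then have rX': "int ?r * X = (int K - 1) * X" "int ?r * Y = int ?r * X"
    using W rr rX rY T' unfolding B by linarith+
  then have r1: "int ?r = int K - 1" using X0 by simp
  then have "Y = X" using rX'(2) K by simp
  then have 1: "2 * tv = P" "nv = Q + 1" "dv = 1"
    using t' N' D' unfolding X_eq Y_def by presburger+
  have "int (2 * ?t) = int (K * ((n + 1) * (n + 2)))" using 1(1) by (simp add: P_def tv_def algebra_simps)
  then have 2: "2 * ?t = K * ((n + 1) * (n + 2))" by (simp only: of_nat_eq_iff)
  have "int ?N = int ((n + 1) * K + 1)" using 1(2) by (simp add: Q_def nv_def algebra_simps)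
  then have 3: "?N = (n + 1) * K + 1" by (simp only: of_nat_eq_iff)
  have "card (e \<inter> \<Union>?E) = 2" using card_shared[OF e(1)] r1 by linarith
  then have "{s, s'} = e \<inter> \<Union>?E" using card_subset_eq[OF fi sub] ne by simp
  then show "e \<inter> \<Union>?E = {s, s'} \<and> ?N = (n + 1) * K + 1 \<and> 2 * ?t = K * ((n + 1) * (n + 2)) \<and> ?D = 1"
    using 2 3 1(3) by (simp add: dv_def)
qed

lemma two_edges_chain2:
  assumes K: "2 \<le> K" and n: "card E = 2" and e: "e \<in> E" and i: "card (e \<inter> \<Union>(E - {e})) = 2"
  shows "\<exists>p. chain2 K 2 0 p \<and> E = p ` {..<2}"
proof -
  have "card (E - {e}) = 1" using n e fin by simp
  then obtain f where f: "E - {e} = {f}" by (auto simp: card_1_singleton_iff)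
  then have E: "E = {e, f}" and fE: "f \<in> E" using e by auto
  define p where "p j = (if j = (0::nat) then e else f)" for j
  have "E = p ` {..<2}" unfolding E by (auto simp: p_def numeral_2_eq_2 lessThan_Suc)
  moreover have "chain2 K 2 0 p"
    using card_edge[OF e] card_edge[OF fE] i unfolding f chain2_def p_def by auto
  ultimately show ?thesis by blast
qed

text \<open>Let f, g be the two edges of the rest. A vertex common to both would have every other
  vertex of the rest at distance 1 and distance sum only 2 * K. So s and s', adjacent through f, are
  not in g, and e meets f alone.\<close>

lemma three_edges_chain2:
  assumes K: "2 \<le> K" and n: "card E = 3" and e: "e \<in> E" "conn (E - {e})"
    and i: "e \<inter> \<Union>(E - {e}) = {s, s'}" and ne: "s \<noteq> s'"
    and N: "card (\<Union>(E - {e})) = 2 * K + 1"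
    and t: "tr (E - {e}) s = 3 * K" "tr (E - {e}) s' = 3 * K" and D: "dst (E - {e}) s s' = 1"
  shows "\<exists>p. chain2 K 3 0 p \<and> E = p ` {..<3}"
proof -
  interpret E': ksys K "E - {e}" by (rule ksys_remove[OF e(2)])
  let ?E = "E - {e}"
  have sE: "s \<in> \<Union>?E" "s' \<in> \<Union>?E" "s \<in> e" "s' \<in> e" using i by blast+
  have "(s, s') \<in> adj ?E ^^ 1" using dst_relpow[OF E'.con sE(1,2)] D by simp
  then obtain f where f: "f \<in> ?E" "s \<in> f" "s' \<in> f" by (auto simp: adj_def)
  have "card (?E - {f}) = 1" using n e f fin by simp
  then obtain g where "?E - {f} = {g}" by (auto simp: card_1_singleton_iff)
  then have g: "?E = {f, g}" "f \<noteq> g" using f by auto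
  have fg: "f \<in> E" "g \<in> E" "e \<noteq> f" "e \<noteq> g" using g by auto
  have "card (f \<union> g) + card (f \<inter> g) = 2 * Suc K"
    using card_Un_Int[OF fin_edge[OF fg(1)] fin_edge[OF fg(2)]] card_edge fg by simp
  then have fgi: "card (f \<inter> g) = 1" using N g by simp
  have out: "x \<notin> g" if x: "x \<in> f" "tr ?E x = 3 * K" for x
  proof
    assume xg: "x \<in> g"
    have xE: "x \<in> \<Union>?E" using x g by blast
    have fV: "finite (\<Union>?E)" by (rule E'.fin_verts)
    have "tr ?E x = dst ?E x x + (\<Sum>y\<in>\<Union>?E - {x}. dst ?E x y)"
      unfolding tr_def by (rule sum.remove[OF fV xE])
    also have "\<dots> = (\<Sum>y\<in>\<Union>?E - {x}. dst ?E x y)" by simp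
    also have "\<dots> \<le> (\<Sum>y\<in>\<Union>?E - {x}. 1)"
    proof (rule sum_mono)
      fix y assume "y \<in> \<Union>?E - {x}"
      then have "y \<in> f \<or> y \<in> g" using g by auto
      then show "dst ?E x y \<le> 1"
        using dst_edge[of f ?E x y] dst_edge[of g ?E x y] x xg g by blast
    qed
    also have "\<dots> = 2 * K" using N xE by simp
    finally show False using x K by simp
  qed
  have sg: "s \<notin> g" "s' \<notin> g" using out f t by blast+
  have "e \<inter> g \<subseteq> {s, s'}" using i g by blast
  then have eg: "e \<inter> g = {}" using sg by blast
  have "e \<inter> f \<subseteq> {s, s'}" "{s, s'} \<subseteq> e \<inter> f" using i g f sE by blast+
  then have "e \<inter> f = {s, s'}" by blast
  then have ef: "card (e \<inter> f) = 2" using ne by simp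
  define p where "p j = (if j = (0::nat) then e else if j = 1 then f else g)" for j
  have "E = {e, f, g}" using g e by blast
  then have "E = p ` {..<3}" by (auto simp: p_def numeral_3_eq_3 lessThan_Suc)
  moreover have "chain2 K 3 0 p"
    unfolding chain2_def
  proof (intro conjI allI impI)
    show "card (p i) = Suc K" for i using card_edge e fg by (simp add: p_def)
    show "p i \<inter> p j = {}" if "Suc i < j" "j < 3" for i j
    proof -
      have "i = 0" "j = 2" using that by auto
      then show ?thesis using eg by (simp add: p_def)
    qed
    show "card (p i \<inter> p (Suc i)) = (if i = 0 then 2 else 1)" if "Suc i < 3" for i
    proof (cases "i = 0")
      case True
      then show ?thesis using ef by (simp add: p_def)
    next
      case False
      then have "i = 1" using that by simp
      then show ?thesis using fgi by (simp add: p_def)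
    qed
  qed simp
  ultimately show ?thesis by blast
qed

end

subsection \<open>The upper bound\<close>

context ksys
begin

text \<open>The vertices f i and f (i + 1) of the edge p i bound its levels from both sides. Hence
  each level from 1 to the length of the geodesic occurs on it, seen from either end.\<close>

lemma geodesic_levels:
  assumes z: "z1 \<in> \<Union>E" "z2 \<in> \<Union>E"
  obtains f p where "f 0 = z1" "f (dst E z1 z2) = z2"
    "\<forall>i<dst E z1 z2. p i \<in> E \<and> f i \<in> p i \<and> f (Suc i) \<in> p i"
    "\<forall>i\<le>dst E z1 z2. dst E z1 (f i) = i \<and> dst E z2 (f i) = dst E z1 z2 - i"
    "\<forall>i<dst E z1 z2. lev E z1 (p i) = Suc i \<and> lev E z2 (p i) = dst E z1 z2 - i"
    "inj_on p {..<dst E z1 z2}"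
proof (rule geodesic[OF con z])
  fix f p
  assume fp: "f 0 = z1" "f (dst E z1 z2) = z2"
    and d: "\<And>i. i \<le> dst E z1 z2 \<Longrightarrow> f i \<in> \<Union>E \<and> dst E z1 (f i) = i \<and> dst E z2 (f i) = dst E z1 z2 - i"
    and p: "\<And>i. i < dst E z1 z2 \<Longrightarrow> p i \<in> E \<and> f i \<in> p i \<and> f (Suc i) \<in> p i"
    and "inj_on f {..dst E z1 z2}" and inj: "inj_on p {..<dst E z1 z2}"
  have lv: "lev E z1 (p i) = Suc i \<and> lev E z2 (p i) = dst E z1 z2 - i" if i: "i < dst E z1 z2" for i
  proof -
    have pi: "p i \<in> E" "f i \<in> p i" "f (Suc i) \<in> p i" using p[OF i] by blast+
    have di: "dst E z1 (f i) = i" "dst E z2 (f i) = dst E z1 z2 - i"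
      "dst E z1 (f (Suc i)) = Suc i" "dst E z2 (f (Suc i)) = dst E z1 z2 - Suc i"
      using d[of i] d[of "Suc i"] i by auto
    show ?thesis
      using lev_le[OF pi(1,2), of z1] lev_le[OF pi(1,3), of z2]
        dst_le_lev[OF pi(1) z(1) pi(3)] dst_le_lev[OF pi(1) z(2) pi(2)] di i by linarith
  qed
  show thesis by (rule that[OF fp _ _ _ inj]) (use d p lv in auto)
qed

text \<open>An edge \<open>g\<close> off a geodesic between two leaf edges, but meeting it: each of the two levels of \<open>g\<close> also
  occurs on the geodesic, and they add up to at most \<open>D + 3\<close>.\<close>

lemma two_leaves_off_geodesic:
  assumes N: "card (\<Union>E) \<le> card E * K"
    and l1: "l1 \<in> E" "z1 \<in> l1" "z1 \<notin> \<Union>(E - {l1})" "l1 \<inter> \<Union>(E - {l1}) = {w1}"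
    and l2: "l2 \<in> E" "z2 \<in> l2" "z2 \<notin> \<Union>(E - {l2})" "l2 \<inter> \<Union>(E - {l2}) = {w2}"
    and ne: "l1 \<noteq> l2" and D: "dst E z1 z2 < card E"
  shows "2 * (tr E z1 + tr E z2) + 8 \<le> K * (2 * (card E * (card E - 1)) + 2 * (card E + 2))"
proof -
  let ?D = "dst E z1 z2" and ?m = "card E"
  have z: "z1 \<in> \<Union>E" "z2 \<in> \<Union>E" using l1 l2 by blast+
  have u1: "h = l1" if "h \<in> E" "z1 \<in> h" for h using l1 that by blast
  have u2: "h = l2" if "h \<in> E" "z2 \<in> h" for h using l2 that by blast
  obtain f p where f: "f 0 = z1" "f ?D = z2"
    and fp: "\<forall>i<?D. p i \<in> E \<and> f i \<in> p i \<and> f (Suc i) \<in> p i"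
      "\<forall>i\<le>?D. dst E z1 (f i) = i \<and> dst E z2 (f i) = ?D - i"
      "\<forall>i<?D. lev E z1 (p i) = Suc i \<and> lev E z2 (p i) = ?D - i"
    and inj: "inj_on p {..<?D}"
    by (rule geodesic_levels[OF z])
  note p = fp(1)[rule_format] and d = fp(2)[rule_format] and lv = fp(3)[rule_format]
  have "z1 \<noteq> z2" using u1 l2 ne by blast
  then have D0: "0 < ?D" using dst_eq_0[OF con z] by simp
  have p0: "p 0 = l1" using p[OF D0] f u1 by simp
  have pD: "p (?D - 1) = l2" using p[of "?D - 1"] f u2 D0 by simp
  have D2: "2 \<le> ?D" using p0 pD ne D0 by (cases "?D = 1") auto
  let ?F = "p ` {..<?D}"
  have F: "?F \<subseteq> E" "?F \<noteq> {}" using p D0 by auto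
  have "card ?F = ?D" using card_image[OF inj] by simp
  then have "?F \<noteq> E" using D by auto
  then obtain g where g: "g \<in> E" "g \<notin> ?F" "g \<inter> \<Union>?F \<noteq> {}"
    by (rule conn_exit[OF con empty_notin F])
  then obtain i x where x: "x \<in> g" "x \<in> p i" "i < ?D" by auto
  have dx: "dst E z1 x \<le> Suc i" "dst E z2 x \<le> ?D - i"
    using dst_le_lev[OF _ z(1) x(2)] dst_le_lev[OF _ z(2) x(2)] p[OF x(3)] lv[OF x(3)] by auto
  have gl: "lev E z1 g \<le> Suc (dst E z1 x)" "lev E z2 g \<le> Suc (dst E z2 x)"
    using lev_le[OF g(1) x(1)] by blast+
  \<comment> \<open>The distance ?D could occur only in the last edge l2. There x also lies in g
    \<noteq> l2, so x is the attachment vertex w2, which is f (?D - 1). Thus the level of g does not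
    exceed ?D and is repeated on the geodesic.\<close>
  have last: "dst E z1 x \<le> ?D - 1"
  proof (cases "i = ?D - 1")
    case True
    let ?j = "?D - 2"
    have j: "?j < ?D" "Suc ?j = ?D - 1" using D2 by simp_all
    have "p ?j \<noteq> l2" using inj_onD[OF inj, of ?j "?D - 1"] pD j by auto
    then have "f (?D - 1) \<in> l2 \<inter> \<Union>(E - {l2})" using p[OF j(1)] p[of "?D - 1"] j pD D0 by auto
    then have fw: "f (?D - 1) = w2" using l2(4) by blast
    have "g \<noteq> l2" using g(2) pD D0 by auto
    then have "x \<in> l2 \<inter> \<Union>(E - {l2})" using x g True pD by auto
    then have "x = f (?D - 1)" using l2(4) fw by blast
    then show ?thesis using d[of "?D - 1"] by simp
  next
    case False
    then show ?thesis using dx(1) x(3) by linarith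
  qed
  have first: "dst E z2 x \<le> ?D - 1"
  proof (cases "i = 0")
    case True
    have j: "1 < ?D" using D2 by simp
    have "p 1 \<noteq> l1" using inj_onD[OF inj, of 1 0] p0 j by auto
    then have "f 1 \<in> l1 \<inter> \<Union>(E - {l1})" using p[OF j] p[OF D0] p0 by auto
    then have fw: "f 1 = w1" using l1(4) by blast
    have "g \<noteq> l1" using g(2) p0 D0 by auto
    then have "x \<in> l1 \<inter> \<Union>(E - {l1})" using x g True p0 by auto
    then have "x = f 1" using l1(4) fw by blast
    then show ?thesis using d[of 1] j by simp
  next
    case False
    then show ?thesis using dx(2) by linarith
  qed
  have range: "lev E z1 g \<le> ?D" "lev E z2 g \<le> ?D" using gl last first D0 by linarith+
  \<comment> \<open>The bounds i + 2 and ?D - i + 1 add up to ?D + 3, and ?D < ?m.\<close>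
  have sum: "lev E z1 g + lev E z2 g \<le> ?m + 2" using gl dx x(3) D by linarith
  have dup1: "2 * sum (lev E z1) E \<le> ?m * (?m - 1) + 2 * lev E z1 g"
  proof (rule sum_lev_repeated_le[OF z(1) g(1)])
    let ?j = "lev E z1 g - 1"
    have j: "?j < ?D" "Suc ?j = lev E z1 g" using range lev_pos[of z1 g] by linarith+
    show "p ?j \<in> E" using p[OF j(1)] by blast
    show "g \<noteq> p ?j" using g(2) j(1) by blast
    show "lev E z1 g = lev E z1 (p ?j)" using lv[OF j(1)] j(2) by simp
  qed
  have dup2: "2 * sum (lev E z2) E \<le> ?m * (?m - 1) + 2 * lev E z2 g"
  proof (rule sum_lev_repeated_le[OF z(2) g(1)])
    let ?j = "?D - lev E z2 g"
    have j: "?j < ?D" "?D - ?j = lev E z2 g" using range lev_pos[of z2 g] by linarith+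
    show "p ?j \<in> E" using p[OF j(1)] by blast
    show "g \<noteq> p ?j" using g(2) j(1) by blast
    show "lev E z2 g = lev E z2 (p ?j)" using lv[OF j(1)] j(2) by simp
  qed
  have "tr E z1 + 2 \<le> K * sum (lev E z1) E" by (rule tr_le_private[OF l1(1,2) u1 N])
  moreover have "tr E z2 + 2 \<le> K * sum (lev E z2) E" by (rule tr_le_private[OF l2(1,2) u2 N])
  ultimately have "2 * (tr E z1 + tr E z2) + 8 \<le> K * (2 * sum (lev E z1) E + 2 * sum (lev E z2) E)"
    by (simp only: distrib_left mult.left_commute[of K 2])
  also have "\<dots> \<le> K * (2 * (?m * (?m - 1)) + 2 * (?m + 2))"
  proof (rule mult_le_mono2)
    define c where "c = ?m * (?m - 1)"
    show "2 * sum (lev E z1) E + 2 * sum (lev E z2) E \<le> 2 * (?m * (?m - 1)) + 2 * (?m + 2)"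
      using dup1 dup2 sum unfolding c_def[symmetric] by simp
  qed
  finally show ?thesis .
qed

text \<open>The vertex count makes the m - 1 consecutive overlaps sum to at least m, so some overlap
  has size at least 2. From z1 the empty slot is in p (a + 1), of level a + 2; from z2 it is in p a,
  of level m - a. The number of vertices missing from \<open>card E * K\<close> is kept in both
  estimates because equality later has to force it to be 0.\<close>

lemma two_leaves_geodesic_chain:
  assumes K: "2 \<le> K" and N: "card (\<Union>E) \<le> card E * K" and m: "2 \<le> card E"
    and z: "z1 \<in> \<Union>E" "z2 \<in> \<Union>E" and D: "dst E z1 z2 = card E"
  obtains a p where "Suc a < card E" "E = p ` {..<card E}"
    "2 * tr E z1 + 2 * (a + 2) + 2 * (card E * K - card (\<Union>E)) \<le> K * (card E * (card E + 1))"
    "2 * tr E z2 + 2 * (card E - a) + 2 * (card E * K - card (\<Union>E)) \<le> K * (card E * (card E + 1))"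
    "card (\<Union>E) = card E * K \<Longrightarrow> chain2 K (card E) a p"
proof -
  let ?m = "card E"
  obtain f p where f: "f 0 = z1" "f ?m = z2"
    and fp: "\<forall>i<?m. p i \<in> E \<and> f i \<in> p i \<and> f (Suc i) \<in> p i"
      "\<forall>i\<le>?m. dst E z1 (f i) = i \<and> dst E z2 (f i) = ?m - i"
      "\<forall>i<?m. lev E z1 (p i) = Suc i \<and> lev E z2 (p i) = ?m - i"
    and inj: "inj_on p {..<?m}"
    by (rule geodesic_levels[OF z, unfolded D])
  note p = fp(1)[rule_format] and d = fp(2)[rule_format] and lv = fp(3)[rule_format]
  have "p ` {..<?m} \<subseteq> E" using p by blast
  then have E: "E = p ` {..<?m}" using card_image[OF inj] card_subset_eq[OF fin] by (metis card_lessThan)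
  have pE: "p i \<in> E" if "i < ?m" for i using p[OF that] by blast
  have far: "p i \<inter> p j = {}" if ij: "Suc i < j" "j < ?m" for i j
  proof (rule equals0I)
    fix x assume "x \<in> p i \<inter> p j"
    then have x: "x \<in> p i" "x \<in> p j" by auto
    have "dst E z1 x \<le> Suc i" using dst_le_lev[OF pE z(1) x(1)] lv[of i] ij by simp
    moreover have "Suc j \<le> Suc (dst E z1 x)" using lev_le[OF pE x(2), of z1] lv[of j] ij by simp
    ultimately show False using ij by simp
  qed
  have meet: "1 \<le> card (p i \<inter> p (Suc i))" if i: "Suc i < ?m" for i
  proof -
    have "f (Suc i) \<in> p i \<inter> p (Suc i)" using p[of i] p[OF i] i by auto
    moreover have "finite (p i \<inter> p (Suc i))" using fin_edge[OF pE[OF i]] by simp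
    ultimately show ?thesis by (metis One_nat_def Suc_leI card_gt_0_iff empty_iff)
  qed
  obtain k where k: "?m = Suc k" using m by (metis Suc_le_D numeral_2_eq_2)
  have UE: "(\<Union>i\<le>k. p i) = \<Union>E" by (subst E) (simp add: k lessThan_Suc_atMost)
  have cs: "card (\<Union>E) + (\<Sum>i<k. card (p i \<inter> p (Suc i))) = ?m * Suc K"
  proof -
    have "card (\<Union>i\<le>k. p i) + (\<Sum>i<k. card (p i \<inter> p (Suc i))) = (\<Sum>i\<le>k. card (p i))"
      by (rule card_chain_prefix) (use fin_edge pE far k in auto)
    also have "\<dots> = (\<Sum>i\<le>k. Suc K)" by (rule sum.cong) (use card_edge pE k in auto)
    finally show ?thesis unfolding UE by (simp add: k)
  qed
  have "\<exists>a<k. 2 \<le> card (p a \<inter> p (Suc a))"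
  proof (rule ccontr)
    assume "\<not> ?thesis"
    then have small: "\<forall>i<k. card (p i \<inter> p (Suc i)) < 2" by (simp add: not_le)
    have "card (p i \<inter> p (Suc i)) \<le> 1" if "i < k" for i using small[rule_format, OF that] by linarith
    then have "(\<Sum>i<k. card (p i \<inter> p (Suc i))) \<le> (\<Sum>i<k. 1)" by (intro sum_mono) simp
    then show False using cs N k by simp
  qed
  then obtain a where a: "a < k" "2 \<le> card (p a \<inter> p (Suc a))" by blast
  then have am: "Suc a < ?m" "a < ?m" using k by simp_all
  note fa = fin_edge[OF pE[OF am(2)]] and fa' = fin_edge[OF pE[OF am(1)]]
  have less: "card (p (Suc a) - p a) < K" "card (p a - p (Suc a)) < K"
    using card_Diff_subset_Int[of "p (Suc a)" "p a"] card_Diff_subset_Int[of "p a" "p (Suc a)"]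
      fa fa' card_edge[OF pE[OF am(1)]] card_edge[OF pE[OF am(2)]] a(2) K
    by (simp_all add: Int_commute)
  have "dst E z1 x \<noteq> lev E z1 (p (Suc a))" if "x \<in> p a" for x
    using dst_le_lev[OF pE[OF am(2)] z(1) that] lv[OF am(1)] lv[OF am(2)] by simp
  then have "{x \<in> p (Suc a). dst E z1 x = lev E z1 (p (Suc a))} \<subseteq> p (Suc a) - p a" by blast
  then have "card {x \<in> p (Suc a). dst E z1 x = lev E z1 (p (Suc a))} \<le> card (p (Suc a) - p a)"
    by (rule card_mono[rotated]) (use fa' in simp)
  then have c1: "card {x \<in> p (Suc a). dst E z1 x = lev E z1 (p (Suc a))} < K" using less(1) by linarith
  have "dst E z2 x \<noteq> lev E z2 (p a)" if "x \<in> p (Suc a)" for x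
    using dst_le_lev[OF pE[OF am(1)] z(2) that] lv[OF am(1)] lv[OF am(2)] am by simp
  then have "{x \<in> p a. dst E z2 x = lev E z2 (p a)} \<subseteq> p a - p (Suc a)" by blast
  then have "card {x \<in> p a. dst E z2 x = lev E z2 (p a)} \<le> card (p a - p (Suc a))"
    by (rule card_mono[rotated]) (use fa in simp)
  then have c2: "card {x \<in> p a. dst E z2 x = lev E z2 (p a)} < K" using less(2) by linarith
  define c where "c = K * (?m * (?m + 1))"
  have S: "2 * (K * sum (lev E z') E) \<le> c" if "z' \<in> \<Union>E" for z'
    unfolding c_def
    using mult_le_mono2[OF sum_lev_le[OF that], of K] by (simp only: mult.left_commute)
  have t1: "2 * tr E z1 + 2 * (a + 2) + 2 * (?m * K - card (\<Union>E)) \<le> K * (?m * (?m + 1))"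
    using tr_le_deficient_edge[OF z(1) pE[OF am(1)] c1 N] lv[OF am(1)] S[OF z(1)]
    unfolding c_def[symmetric] by simp
  have t2: "2 * tr E z2 + 2 * (?m - a) + 2 * (?m * K - card (\<Union>E)) \<le> K * (?m * (?m + 1))"
    using tr_le_deficient_edge[OF z(2) pE[OF am(2)] c2 N] lv[OF am(2)] S[OF z(2)]
    unfolding c_def[symmetric] by simp
  have ch: "chain2 K ?m a p" if NK: "card (\<Union>E) = ?m * K"
    unfolding chain2_def
  proof (intro conjI allI impI)
    show "Suc a < ?m" by (fact am)
    show "card (p i) = Suc K" if "i < ?m" for i using card_edge[OF pE[OF that]] .
    show "p i \<inter> p j = {}" if "Suc i < j" "j < ?m" for i j using far that .
    fix i assume i: "Suc i < ?m"
    let ?s = "\<lambda>i. card (p i \<inter> p (Suc i))"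
    \<comment> \<open>Now the k overlaps sum to k + 1. Each is at least 1 and the one at a is at
      least 2, which leaves no room elsewhere.\<close>
    have tot: "(\<Sum>i<k. ?s i) = Suc k" using cs NK k by simp
    have sp: "(\<Sum>i<k. ?s i) = ?s a + (\<Sum>i\<in>{..<k} - {a}. ?s i)" by (rule sum.remove) (use a in auto)
    have "(\<Sum>i\<in>{..<k} - {a}. 1) \<le> (\<Sum>i\<in>{..<k} - {a}. ?s i)"
      by (rule sum_mono) (use meet k in auto)
    then have ge: "k - 1 \<le> (\<Sum>i\<in>{..<k} - {a}. ?s i)" using a by simp
    show "?s i = (if i = a then 2 else 1)"
    proof (cases "i = a")
      case True
      then show ?thesis using tot sp ge a by simp
    next
      case False
      have ik: "i \<in> {..<k} - {a}" using i k False by simp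
      have sp2: "(\<Sum>i\<in>{..<k} - {a}. ?s i) = ?s i + (\<Sum>i\<in>{..<k} - {a} - {i}. ?s i)"
        by (rule sum.remove[OF _ ik]) simp
      have "(\<Sum>i\<in>{..<k} - {a} - {i}. 1) \<le> (\<Sum>i\<in>{..<k} - {a} - {i}. ?s i)"
        by (rule sum_mono) (use meet k in auto)
      moreover have "card ({..<k} - {a} - {i}) = k - 2" using ik a by simp
      ultimately have ge2: "k - 2 \<le> (\<Sum>i\<in>{..<k} - {a} - {i}. ?s i)" by simp
      have "2 \<le> k" using ik a by auto
      then show ?thesis using tot sp sp2 ge2 a(2) meet[OF i] False by simp
    qed
  qed
  show ?thesis by (rule that[OF am(1) E t1 t2 ch])
qed


lemma dst_le_card:
  assumes "z1 \<in> \<Union>E" "z2 \<in> \<Union>E"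
  shows "dst E z1 z2 \<le> card E"
proof (rule geodesic_levels[OF assms])
  fix f p
  assume p: "\<forall>i<dst E z1 z2. p i \<in> E \<and> f i \<in> p i \<and> f (Suc i) \<in> p i"
    and inj: "inj_on p {..<dst E z1 z2}"
  have "p ` {..<dst E z1 z2} \<subseteq> E" using p by blast
  then show ?thesis using card_inj_on_le[OF inj _ fin] by simp
qed

text \<open>The number d is the amount by which \<open>2 * tr E z\<close> stays below the value
  built into \<open>cyc_bound\<close>. It survives as slack K * d, so d > 0 excludes
  equality.\<close>

lemma wien_remove_leaf_le:
  assumes K: "2 \<le> K" and n: "card E = n + 3"
    and l: "l \<in> E" "conn (E - {l})" "l \<inter> \<Union>(E - {l}) = {w}" "z \<in> l" "z \<notin> \<Union>(E - {l})"
    and IH: "int (wien (E - {l})) \<le> cyc_bound K n"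
    and t: "2 * tr E z + 2 * (n div 2 + 3) + d \<le> K * ((n + 3) * (n + 4))"
  shows "int (wien E) + int (K * d) \<le> cyc_bound K (Suc n)"
proof -
  have "wien E + K * (K - 1) = wien (E - {l}) + 2 * K * tr E z"
    by (rule wien_leaf[OF l(1-3)]) (use l in blast)
  then have "int (wien E + K * (K - 1)) = int (wien (E - {l}) + 2 * K * tr E z)" by simp
  then have eq: "int (wien E) + int K * (int K - 1) = int (wien (E - {l})) + int K * (2 * int (tr E z))"
    using K by (simp add: of_nat_diff mult.assoc mult.left_commute)
  have "int (2 * tr E z + 2 * (n div 2 + 3) + d) \<le> int (K * ((n + 3) * (n + 4)))" using t by (rule of_nat_mono)
  then have "2 * int (tr E z) + 2 * int (n div 2 + 3) + int d \<le> int K * ((int n + 3) * (int n + 4))"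
    by (simp only: of_nat_mult of_nat_add of_nat_numeral)
  then have "int K * (2 * int (tr E z) + 2 * int (n div 2 + 3) + int d) \<le> int K * (int K * ((int n + 3) * (int n + 4)))"
    by (rule mult_left_mono) simp
  then show ?thesis
    using IH eq unfolding cyc_bound.simps by (simp only: distrib_left mult.assoc mult.left_commute[of 2] of_nat_mult)
qed

end

text \<open>The smaller of two numbers is at most their average. The term 8 collects the savings of
  \<open>tr_le_private\<close> at both ends; it decides the case K = 2, m = 4.\<close>

lemma two_leaves_arith:
  fixes K m x y :: nat
  assumes "2 \<le> K" "4 \<le> m" "2 * (x + y) + 8 \<le> K * (2 * (m * (m - 1)) + 2 * (m + 2))"
  shows "2 * x + 2 * ((m + 1) div 2 + 1) + 1 \<le> K * (m * (m + 1)) \<or>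
         2 * y + 2 * ((m + 1) div 2 + 1) + 1 \<le> K * (m * (m + 1))"
proof -
  obtain k where k: "m = k + 4" using assms(2) by (metis add.commute le_Suc_ex)
  have "2 * (m * (m - 1)) + 2 * (m + 2) + (2 * k + 4) = 2 * (m * (m + 1))" unfolding k by (simp add: algebra_simps)
  then have "K * (2 * (m * (m - 1)) + 2 * (m + 2)) + K * (2 * k + 4) = 2 * (K * (m * (m + 1)))"
    by (simp only: distrib_left[symmetric] mult.left_commute[of 2 K])
  moreover have "2 * (2 * k + 4) \<le> K * (2 * k + 4)" using assms(1) by (rule mult_le_mono1)
  ultimately have "2 * (x + y) + 8 + 2 * (2 * k + 4) \<le> 2 * (K * (m * (m + 1)))" using assms(3) by linarith
  moreover define c where "c = K * (m * (m + 1))"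
  ultimately have "2 * x + 2 * y + 4 * k + 16 \<le> 2 * c" by simp
  moreover define q where "q = (m + 1) div 2"
  then have "q \<le> k + 2" unfolding k by simp
  ultimately have "2 * x + 2 * q + 3 \<le> c \<or> 2 * y + 2 * q + 3 \<le> c" by linarith
  then show ?thesis unfolding c_def[symmetric] q_def[symmetric] by auto
qed

text \<open>Only the bound enters the induction: in the equality case the shape is read off the
  geodesic or the removed edge, not inherited from the smaller system.\<close>

lemma wien_le_cyc_bound:
  assumes "ksys K E" "2 \<le> K" "card E = n + 2" "card (\<Union>E) \<le> card E * K"
  shows "int (wien E) \<le> cyc_bound K n \<and>
    (int (wien E) = cyc_bound K n \<longrightarrow>
      (\<exists>a p. chain2 K (n + 2) a p \<and> E = p ` {..<n + 2} \<and> (a = n div 2 \<or> a = (n + 1) div 2)))"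
    (is "?bound E n \<and> (?eq E n \<longrightarrow> ?chain E n)")
  using assms
proof (induction n arbitrary: E rule: less_induct)
  case (less n)
  interpret ksys K E by fact
  note K = less.prems(2) and m = less.prems(3) and N = less.prems(4)
  show ?case
  proof (cases "\<exists>e s s'. e \<in> E \<and> conn (E - {e}) \<and> s \<in> e \<and> s \<in> \<Union>(E - {e}) \<and>
      s' \<in> e \<and> s' \<in> \<Union>(E - {e}) \<and> s \<noteq> s'")
    case True
    then obtain e s s' where e: "e \<in> E" "conn (E - {e})" and s: "s \<in> e" "s \<in> \<Union>(E - {e})"
      and s': "s' \<in> e" "s' \<in> \<Union>(E - {e})" and ne: "s \<noteq> s'" by blast
    note A = wien_two_shared[OF K m e s s' ne] and A' = wien_two_shared[OF K m e s' s ne[symmetric]]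
    have le: "end_cycle_bound K n \<le> cyc_bound K n" "2 \<le> n \<longrightarrow> end_cycle_bound K n < cyc_bound K n"
      using end_cycle_bound_le[of K n] K by auto
    have "?chain E n" if eq: "?eq E n"
    proof -
      have eq': "int (wien E) = end_cycle_bound K n" using A(1) le(1) eq by linarith
      \<comment> \<open>Equality leaves only systems with two or three edges, which are identified
        directly.\<close>
      then have n: "n < 2" using le(2) eq by auto
      note A2 = A(2)[OF eq'] and A2' = A'(2)[OF eq']
      show ?thesis
      proof (cases "n = 0")
        case True
        have "card (e \<inter> \<Union>(E - {e})) = 2" using A2 ne by simp
        then obtain p where "chain2 K 2 0 p \<and> E = p ` {..<2}"
          using two_edges_chain2[OF K _ e(1)] m True by auto
        then have "chain2 K (n + 2) 0 p \<and> E = p ` {..<n + 2}" "0 = n div 2"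
          unfolding True by (simp_all add: numeral_2_eq_2)
        then show ?thesis by blast
      next
        case False
        then have n1: "n = 1" using n by simp
        have "tr (E - {e}) s = 3 * K" "tr (E - {e}) s' = 3 * K" "card (\<Union>(E - {e})) = 2 * K + 1"
          using A2 A2' unfolding n1 by (auto simp: insert_commute)
        then obtain p where "chain2 K 3 0 p \<and> E = p ` {..<3}"
          using three_edges_chain2[OF K _ e, of s s'] m n1 A2 ne by auto
        then have "chain2 K (n + 2) 0 p \<and> E = p ` {..<n + 2}" "0 = n div 2"
          unfolding n1 by (simp_all add: numeral_3_eq_3 numeral_2_eq_2)
        then show ?thesis by blast
      qed
    qed
    then show ?thesis using A(1) le(1) by auto
  next
    case False
    have leaf: "\<exists>w. e \<inter> \<Union>(E - {e}) = {w}" if e: "e \<in> E" "conn (E - {e})" for e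
    proof -
      have "E - {e} \<noteq> {}"
      proof -
        have "card (E - {e}) = Suc n" using m e fin by simp
        then show ?thesis by (metis card.empty nat.distinct(1))
      qed
      then obtain s where s: "s \<in> e" "s \<in> \<Union>(E - {e})" using ex_shared[OF e(1)] by blast
      have "s' = s" if "s' \<in> e" "s' \<in> \<Union>(E - {e})" for s' using False e s that by blast
      then show ?thesis using s by blast
    qed
    have ne: "E \<noteq> {}" using m by auto
    \<comment> \<open>A double sweep: l1 is farthest from an arbitrary vertex, l2 is farthest from a
      private vertex of l1.\<close>
    then obtain z0 where z0: "z0 \<in> \<Union>E" using edge_ne by blast
    obtain l1 where l1: "l1 \<in> E" "\<And>h. h \<in> E \<Longrightarrow> lev E z0 h \<le> lev E z0 l1"
      using ex_max_lev[OF ne, of z0] by blast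
    have c1: "conn (E - {l1})" by (rule max_lev_noncut[OF z0 l1])
    obtain w1 where w1: "l1 \<inter> \<Union>(E - {l1}) = {w1}" using leaf[OF l1(1) c1] by blast
    have privex: "\<exists>z. z \<in> l \<and> z \<notin> \<Union>(E - {l})" if "l \<in> E" "l \<inter> \<Union>(E - {l}) = {w}" for l w
    proof -
      have "w \<in> l" using that by blast
      then have "card (l - {w}) = K" using card_edge[OF that(1)] by simp
      then have "l - {w} \<noteq> {}" using K by (metis card.empty not_numeral_le_zero)
      then show ?thesis using that by blast
    qed
    obtain z1 where z1: "z1 \<in> l1" "z1 \<notin> \<Union>(E - {l1})" using privex[OF l1(1) w1] by blast
    have z1E: "z1 \<in> \<Union>E" using z1 l1 by blast
    obtain l2 where l2: "l2 \<in> E" "\<And>h. h \<in> E \<Longrightarrow> lev E z1 h \<le> lev E z1 l2"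
      using ex_max_lev[OF ne, of z1] by blast
    have c2: "conn (E - {l2})" by (rule max_lev_noncut[OF z1E l2])
    obtain w2 where w2: "l2 \<inter> \<Union>(E - {l2}) = {w2}" using leaf[OF l2(1) c2] by blast
    obtain z2 where z2: "z2 \<in> l2" "z2 \<notin> \<Union>(E - {l2})" using privex[OF l2(1) w2] by blast
    have z2E: "z2 \<in> \<Union>E" using z2 l2 by blast
    \<comment> \<open>If l1 were farthest from its own private vertex z1, all levels would be 1 and
      every edge would contain z1.\<close>
    have l12: "l1 \<noteq> l2"
    proof
      assume eq: "l1 = l2"
      obtain h where h: "h \<in> E" "h \<noteq> l1" using w1 by blast
      obtain x where x: "x \<in> h" "Suc (dst E z1 x) = lev E z1 h" by (rule lev_attained[OF h(1)])
      have "lev E z1 h \<le> 1" using l2(2)[OF h(1)] lev_le[OF l1(1) z1(1), of z1] eq by simp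
      then have "x = z1" using x dst_eq_0[OF con z1E, of x] h by auto
      then show False using z1 x h by blast
    qed
    have Nrem: "card (\<Union>(E - {l})) + K = card (\<Union>E)" if "l \<in> E" "l \<inter> \<Union>(E - {l}) = {w}" for l w
      using card_verts_remove[OF that(1)] card_shared[OF that(1)] that(2) by simp
    have mrem: "card (E - {l}) = n + 1" if "l \<in> E" for l using that m fin by simp
    \<comment> \<open>For n < 2, removing l1 leaves one edge, or two edges meeting in at most one
      vertex. Then there are at least card E * K + 1 vertices, against N. This also secures the
      bound 4 on the number of edges for \<open>two_leaves_arith\<close>.\<close>
    have n2: "2 \<le> n"
    proof (rule ccontr)
      assume "\<not> 2 \<le> n"
      then consider "n = 0" | "n = 1" by linarith
      then show False
      proof cases
        case 1
        then have "card (E - {l1}) = 1" using mrem[OF l1(1)] by simp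
        then obtain f where f: "E - {l1} = {f}" by (auto simp: card_1_singleton_iff)
        then have "card f = Suc K" using card_edge by blast
        then show False using Nrem[OF l1(1) w1] f N m 1 by simp
      next
        case 2
        then have "card (E - {l1}) = 2" using mrem[OF l1(1)] by simp
        moreover have l2': "l2 \<in> E - {l1}" using l2 l12 by blast
        ultimately have "card (E - {l1} - {l2}) = 1" using fin by simp
        then obtain h where h: "E - {l1} - {l2} = {h}" by (auto simp: card_1_singleton_iff)
        then have hE: "h \<in> E" "h \<noteq> l2" by blast+
        have E: "E - {l1} = {l2, h}" using h l2' by blast
        have "l2 \<inter> h \<subseteq> {w2}" using w2 hE by blast
        then have "card (l2 \<inter> h) \<le> card {w2}" by (intro card_mono) auto
        moreover have "card (l2 \<union> h) + card (l2 \<inter> h) = 2 * Suc K"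
          using card_Un_Int[OF fin_edge[OF l2(1)] fin_edge[OF hE(1)]] card_edge l2(1) hE(1) by simp
        ultimately have "2 * K + 1 \<le> card (\<Union>(E - {l1}))" unfolding E by simp
        then show False using Nrem[OF l1(1) w1] N m 2 by simp
      qed
    qed
    obtain k where k: "n = Suc k" using n2 by (metis Suc_le_D numeral_2_eq_2)
    have m3: "card E = k + 3" using m k by simp
    have IH: "int (wien (E - {l})) \<le> cyc_bound K k"
      if l: "l \<in> E" "conn (E - {l})" "l \<inter> \<Union>(E - {l}) = {w}" for l w
    proof -
      have mk: "card (E - {l}) = k + 2" using mrem[OF l(1)] k by simp
      have "card (\<Union>(E - {l})) \<le> card (E - {l}) * K" using Nrem[OF l(1,3)] N unfolding mk m3 by (simp add: algebra_simps)
      then show ?thesis using less.IH[of k, OF _ ksys_remove[OF l(2)] K mk] k by simp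
    qed
    have B1: "int (wien E) + int (K * d) \<le> cyc_bound K n"
      if "2 * tr E z1 + 2 * (k div 2 + 3) + d \<le> K * ((k + 3) * (k + 4))" for d
      unfolding k by (rule wien_remove_leaf_le[OF K m3 l1(1) c1 w1 z1 IH[OF l1(1) c1 w1] that])
    have B2: "int (wien E) + int (K * d) \<le> cyc_bound K n"
      if "2 * tr E z2 + 2 * (k div 2 + 3) + d \<le> K * ((k + 3) * (k + 4))" for d
      unfolding k by (rule wien_remove_leaf_le[OF K m3 l2(1) c2 w2 z2 IH[OF l2(1) c2 w2] that])
    have Kd: "0 < int (K * d)" if "0 < d" for d using K that by simp
    have dle: "dst E z1 z2 \<le> card E" by (rule dst_le_card[OF z1E z2E])
    show ?thesis
    proof (cases "dst E z1 z2 = card E")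
      case False
      then have "dst E z1 z2 < card E" using dle by simp
      then have "2 * (tr E z1 + tr E z2) + 8 \<le> K * (2 * (card E * (card E - 1)) + 2 * (card E + 2))"
        by (rule two_leaves_off_geodesic[OF N l1(1) z1 w1 l2(1) z2 w2 l12])
      then have "2 * tr E z1 + 2 * ((card E + 1) div 2 + 1) + 1 \<le> K * (card E * (card E + 1)) \<or>
         2 * tr E z2 + 2 * ((card E + 1) div 2 + 1) + 1 \<le> K * (card E * (card E + 1))"
        using m n2 by (intro two_leaves_arith[OF K]) auto
      moreover have "(card E + 1) div 2 + 1 = k div 2 + 3" "card E + 1 = k + 4" unfolding m3 by simp_all
      ultimately have "int (wien E) + int (K * 1) \<le> cyc_bound K n"
        using B1[of 1] B2[of 1] unfolding m3 by metis
      then show ?thesis using Kd[of 1] by linarith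
    next
      case True
      have "2 \<le> card E" using m by simp
      then obtain a p where a: "Suc a < card E" and E: "E = p ` {..<card E}"
        and t1: "2 * tr E z1 + 2 * (a + 2) + 2 * (card E * K - card (\<Union>E)) \<le> K * (card E * (card E + 1))"
        and t2: "2 * tr E z2 + 2 * (card E - a) + 2 * (card E * K - card (\<Union>E)) \<le> K * (card E * (card E + 1))"
        and ch: "card (\<Union>E) = card E * K \<longrightarrow> chain2 K (card E) a p"
        by (rule two_leaves_geodesic_chain[OF K N _ z1E z2E True]) blast
      let ?\<delta> = "card E * K - card (\<Union>E)"
      have mm: "card E * (card E + 1) = (k + 3) * (k + 4)" unfolding m3 by simp
      define b where "b = n - a"
      have ab: "a + b = n" "card E - a = b + 2" using a m by (auto simp: b_def)
      have kd: "k div 2 + 3 = (n + 1) div 2 + 2" unfolding k by simp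
      \<comment> \<open>The end farther from the doubled pair is used. The slack d is twice the
        excess over the balanced position plus twice the number of missing vertices, so d = 0 makes
        both vanish.\<close>
      have "\<exists>d. int (wien E) + int (K * d) \<le> cyc_bound K n \<and> (d = 0 \<longrightarrow> ?\<delta> = 0 \<and> (a = n div 2 \<or> a = (n + 1) div 2))"
      proof (cases "(n + 1) div 2 \<le> a")
        case True
        let ?d = "2 * (a - (n + 1) div 2) + 2 * ?\<delta>"
        have "2 * tr E z1 + 2 * (k div 2 + 3) + ?d \<le> K * ((k + 3) * (k + 4))"
        proof -
          have "2 * tr E z1 + 2 * ((n + 1) div 2 + 2) + ?d = 2 * tr E z1 + 2 * (a + 2) + 2 * ?\<delta>"
            using True by simp
          then show ?thesis using t1 unfolding mm kd by (simp only:)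
        qed
        then show ?thesis using B1[of ?d] True by (intro exI[of _ ?d]) auto
      next
        case False
        then have b: "(n + 1) div 2 \<le> b" using ab by linarith
        let ?d = "2 * (b - (n + 1) div 2) + 2 * ?\<delta>"
        have "2 * tr E z2 + 2 * (k div 2 + 3) + ?d \<le> K * ((k + 3) * (k + 4))"
        proof -
          have "2 * tr E z2 + 2 * ((n + 1) div 2 + 2) + ?d = 2 * tr E z2 + 2 * (b + 2) + 2 * ?\<delta>"
            using b by simp
          then show ?thesis using t2 unfolding mm kd ab(2) by (simp only:)
        qed
        moreover have "a = n div 2" if "b = (n + 1) div 2" using ab that by linarith
        ultimately show ?thesis using B2[of ?d] b by (intro exI[of _ ?d]) auto
      qed
      then obtain d where d: "int (wien E) + int (K * d) \<le> cyc_bound K n"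
        "d = 0 \<longrightarrow> ?\<delta> = 0 \<and> (a = n div 2 \<or> a = (n + 1) div 2)" by blast
      have "?chain E n" if "?eq E n"
      proof -
        have "d = 0" using d(1) that Kd[of d] by linarith
        then have \<delta>: "?\<delta> = 0" and aa: "a = n div 2 \<or> a = (n + 1) div 2" using d(2) by auto
        have "card (\<Union>E) = card E * K" using \<delta> N by linarith
        then have "chain2 K (card E) a p" using ch by blast
        then show ?thesis using E aa unfolding m by blast
      qed
      moreover have "0 \<le> int (K * d)" by simp
      then have "?bound E n" using d(1) by linarith
      ultimately show ?thesis by blast
    qed
  qed
qed

subsection \<open>Cycles of the extremal edge sequence\<close>

text \<open>x and y are the vertices through which the cycle enters and leaves e. In a cycle of
  length 2 the neighbouring edges e1 and e2 coincide, so the two vertices, not the two edges, are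
  claimed to be distinct.\<close>

lemma cycle_edge_two_neighbours:
  assumes c: "cycle G vs es" and e: "e \<in> set es"
  obtains x y e1 e2 where "x \<noteq> y" "x \<in> e" "y \<in> e" "e1 \<in> set es" "e1 \<noteq> e" "x \<in> e1"
    "e2 \<in> set es" "e2 \<noteq> e" "y \<in> e2"
proof -
  let ?q = "length es"
  have w: "length vs = Suc ?q" "\<And>i. i < ?q \<Longrightarrow> vs ! i \<noteq> vs ! Suc i \<and> vs ! i \<in> es ! i \<and> vs ! Suc i \<in> es ! i"
    and q: "2 \<le> ?q" and di: "distinct es" and hl: "hd vs = last vs"
    using c by (auto simp: cycle_def walk_def)
  have vs0: "vs ! 0 = vs ! ?q" using hl w(1) by (metis diff_Suc_1 hd_conv_nth last_conv_nth list.size(3) nat.distinct(1))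
  obtain t where t: "t < ?q" "es ! t = e" using e by (metis in_set_conv_nth)
  have ne: "es ! s \<noteq> e" if "s < ?q" "s \<noteq> t" for s using nth_eq_iff_index_eq[OF di] t that by blast
  have x: "vs ! t \<noteq> vs ! Suc t" "vs ! t \<in> e" "vs ! Suc t \<in> e" using w(2)[OF t(1)] t(2) by auto
  have "\<exists>s<?q. s \<noteq> t \<and> vs ! t \<in> es ! s"
  proof (cases t)
    case 0
    have "?q - 1 < ?q" "Suc (?q - 1) = ?q" "?q - 1 \<noteq> t" using q 0 by simp_all
    then have "?q - 1 < ?q \<and> ?q - 1 \<noteq> t \<and> vs ! t \<in> es ! (?q - 1)" using w(2)[of "?q - 1"] vs0 0 by simp
    then show ?thesis by blast
  next
    case (Suc s)
    then show ?thesis using w(2)[of s] t by (intro exI[of _ s]) auto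
  qed
  then obtain s where s: "s < ?q" "s \<noteq> t" "vs ! t \<in> es ! s" by blast
  have "\<exists>s<?q. s \<noteq> t \<and> vs ! Suc t \<in> es ! s"
  proof (cases "Suc t = ?q")
    case True
    have "0 < ?q" "0 \<noteq> t" using True q by linarith+
    moreover have "vs ! Suc t \<in> es ! 0" using w(2)[OF \<open>0 < ?q\<close>] vs0 unfolding True by metis
    ultimately show ?thesis by blast
  next
    case False
    then have "Suc t < ?q" using t(1) by linarith
    then show ?thesis using w(2)[of "Suc t"] by (intro exI[of _ "Suc t"]) simp
  qed
  then obtain s' where s': "s' < ?q" "s' \<noteq> t" "vs ! Suc t \<in> es ! s'" by blast
  show ?thesis
    by (rule that[OF x nth_mem[OF s(1)] ne[OF s(1,2)] s(3) nth_mem[OF s'(1)] ne[OF s'(1,2)] s'(3)])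
qed

text \<open>Take the largest index on the cycle. Both cyclic neighbours of that edge must be the
  edge one below, so these two share two vertices and are the doubled pair. The same holds at the
  smallest index.\<close>

lemma chain2_cycle_edges:
  assumes ch: "chain2 K m a p" and G: "edges G = p ` {..<m}" and c: "cycle G vs es"
  shows "set es \<subseteq> {p a, p (Suc a)}"
proof -
  let ?I = "{i. i < m \<and> p i \<in> set es}"
  have es: "set es \<subseteq> p ` {..<m}" "es \<noteq> []" using c G by (auto simp: cycle_def walk_def)
  have fI: "finite ?I" by simp
  obtain e0 where "e0 \<in> set es" using es(2) by (metis hd_in_set)
  then have neI: "?I \<noteq> {}" using es(1) by blast
  have nb: "\<exists>x y i j. x \<noteq> y \<and> x \<in> p t \<and> y \<in> p t \<and> i \<in> ?I \<and> j \<in> ?I \<and> i \<noteq> t \<and> j \<noteq> t \<and>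
      x \<in> p i \<and> y \<in> p j \<and> i \<le> Suc t \<and> t \<le> Suc i \<and> j \<le> Suc t \<and> t \<le> Suc j" if t: "t \<in> ?I" for t
  proof -
    have pt: "p t \<in> set es" "t < m" using t by auto
    obtain x y e1 e2 where xy: "x \<noteq> y" "x \<in> p t" "y \<in> p t" and e1: "e1 \<in> set es" "e1 \<noteq> p t" "x \<in> e1"
      and e2: "e2 \<in> set es" "e2 \<noteq> p t" "y \<in> e2"
      by (rule cycle_edge_two_neighbours[OF c pt(1)])
    obtain i where i: "i < m" "e1 = p i" using es e1 by auto
    obtain j where j: "j < m" "e2 = p j" using es e2 by auto
    have "p i \<inter> p t \<noteq> {}" "p j \<inter> p t \<noteq> {}" using xy e1 e2 i j by blast+
    then have "i \<le> Suc t \<and> t \<le> Suc i" "j \<le> Suc t \<and> t \<le> Suc j"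
      using chain2_near[OF ch i(1) pt(2)] chain2_near[OF ch j(1) pt(2)] by blast+
    then show ?thesis using xy e1 e2 i j by blast
  qed
  have two: "i = a" if "Suc i < m" "x \<noteq> y" "x \<in> p i \<inter> p (Suc i)" "y \<in> p i \<inter> p (Suc i)" for i x y
  proof (rule ccontr)
    assume "i \<noteq> a"
    then have "card (p i \<inter> p (Suc i)) = 1" using chain2_consec[OF ch that(1)] by simp
    then show False using that by (metis card_1_singletonE singletonD)
  qed
  have M: "Max ?I \<in> ?I" "\<And>i. i \<in> ?I \<Longrightarrow> i \<le> Max ?I" using Max_in[OF fI neI] Max_ge[OF fI] by blast+
  have M': "Min ?I \<in> ?I" "\<And>i. i \<in> ?I \<Longrightarrow> Min ?I \<le> i" using Min_in[OF fI neI] Min_le[OF fI] by blast+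
  have "Max ?I = Suc a"
  proof -
    obtain x y i j where n: "x \<noteq> y" "x \<in> p (Max ?I)" "y \<in> p (Max ?I)" "i \<in> ?I" "j \<in> ?I" "i \<noteq> Max ?I" "j \<noteq> Max ?I"
      "x \<in> p i" "y \<in> p j" "Max ?I \<le> Suc i" "Max ?I \<le> Suc j" using nb[OF M(1)] by blast
    have "i \<le> Max ?I" "j \<le> Max ?I" using M(2) n by blast+
    then have ij: "Max ?I = Suc i" "j = i" using n by linarith+
    have "i = a" by (rule two[of i x y]) (use n ij M(1) in auto)
    then show ?thesis using ij by simp
  qed
  moreover have "Min ?I = a"
  proof -
    obtain x y i j where n: "x \<noteq> y" "x \<in> p (Min ?I)" "y \<in> p (Min ?I)" "i \<in> ?I" "j \<in> ?I" "i \<noteq> Min ?I" "j \<noteq> Min ?I"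
      "x \<in> p i" "y \<in> p j" "i \<le> Suc (Min ?I)" "j \<le> Suc (Min ?I)" using nb[OF M'(1)] by blast
    have "Min ?I \<le> i" "Min ?I \<le> j" using M'(2) n by blast+
    then have ij: "i = Suc (Min ?I)" "j = Suc (Min ?I)" using n by linarith+
    show ?thesis by (rule two[of "Min ?I" x y]) (use n ij in auto)
  qed
  ultimately have "i = a \<or> i = Suc a" if "i \<in> ?I" for i using M(2)[OF that] M'(2)[OF that] by linarith
  then show ?thesis using es by auto
qed

lemma same_cycle_two:
  "same_cycle [x, y, x] [e, f] [x, y, x] [e, f]" "same_cycle [x, y, x] [e, f] [x, y, x] [f, e]"
  "same_cycle [x, y, x] [e, f] [y, x, y] [e, f]" "same_cycle [x, y, x] [e, f] [y, x, y] [f, e]"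
proof -
  show "same_cycle [x, y, x] [e, f] [x, y, x] [e, f]"
    unfolding same_cycle_def by (rule disjI1, rule exI[of _ 0]) simp
  show "same_cycle [x, y, x] [e, f] [x, y, x] [f, e]"
    unfolding same_cycle_def by (rule disjI2, rule exI[of _ 0]) simp
  show "same_cycle [x, y, x] [e, f] [y, x, y] [e, f]"
    unfolding same_cycle_def by (rule disjI2, rule exI[of _ 1]) simp
  show "same_cycle [x, y, x] [e, f] [y, x, y] [f, e]"
    unfolding same_cycle_def by (rule disjI1, rule exI[of _ 1]) simp
qed

text \<open>Makes the extremal example an admissible competitor. A cycle runs through the doubled
  pair and its two common vertices; its four possible listings differ only in starting point or
  direction.\<close>

lemma chain2_unicyclic:
  fixes p :: "nat \<Rightarrow> 'a set"
  assumes ch: "chain2 K m a p" and K: "2 \<le> K"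
  defines "G \<equiv> \<lparr>verts = \<Union>(p ` {..<m}), edges = p ` {..<m}\<rparr>"
  shows "unicyclic G"
proof -
  note a = chain2_index[OF ch]
  have G: "verts G = \<Union>(p ` {..<m})" "edges G = p ` {..<m}" by (simp_all add: G_def)
  let ?e = "p a" and ?f = "p (Suc a)"
  have ef: "?e \<noteq> ?f" using chain2_ne[OF ch K _ a] by simp
  have "card (?e \<inter> ?f) = 2" using chain2_consec[OF ch a] by simp
  then obtain u v where uv: "?e \<inter> ?f = {u, v}" "u \<noteq> v" by (auto simp: card_2_iff)
  have in_ef: "u \<in> ?e" "v \<in> ?e" "u \<in> ?f" "v \<in> ?f" using uv by blast+
  have ex: "cycle G [u, v, u] [?e, ?f]"
    using in_ef uv(2) ef a unfolding cycle_def walk_def G by (auto simp: less_Suc_eq)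
  have form: "(vs = [u, v, u] \<or> vs = [v, u, v]) \<and> (es = [?e, ?f] \<or> es = [?f, ?e])" if c: "cycle G vs es" for vs es
  proof -
    have sub: "set es \<subseteq> {?e, ?f}" by (rule chain2_cycle_edges[OF ch G(2) c])
    have w: "length vs = Suc (length es)" "\<And>i. i < length es \<Longrightarrow> vs ! i \<noteq> vs ! Suc i \<and> vs ! i \<in> es ! i \<and> vs ! Suc i \<in> es ! i"
      and q: "2 \<le> length es" and di: "distinct es" and hl: "hd vs = last vs"
      using c by (auto simp: cycle_def walk_def)
    have "card (set es) \<le> card {?e, ?f}" by (rule card_mono[OF _ sub]) simp
    then have "length es = 2" using distinct_card[OF di] q ef by simp
    then obtain e1 e2 where es: "es = [e1, e2]" by (auto simp: length_Suc_conv numeral_2_eq_2)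
    then obtain x y z where vs: "vs = [x, y, z]" using w(1) by (auto simp: length_Suc_conv)
    have e12: "es = [?e, ?f] \<or> es = [?f, ?e]" using sub di es by auto
    have xz: "z = x" using hl vs by simp
    have "x \<noteq> y" "x \<in> e1" "y \<in> e1" "y \<in> e2" "x \<in> e2"
      using w(2)[of 0] w(2)[of 1] es vs xz by auto
    then have "x \<in> ?e \<inter> ?f" "y \<in> ?e \<inter> ?f" "x \<noteq> y" using e12 es by auto
    then have "vs = [u, v, u] \<or> vs = [v, u, v]" unfolding uv vs xz by auto
    then show ?thesis using e12 by blast
  qed
  have same: "same_cycle vs es vs' es'"
    if v: "vs = [u, v, u] \<or> vs = [v, u, v]" and e: "es = [?e, ?f] \<or> es = [?f, ?e]"
      and v': "vs' = [u, v, u] \<or> vs' = [v, u, v]" and e': "es' = [?e, ?f] \<or> es' = [?f, ?e]" for vs es vs' es'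
  proof -
    show ?thesis using v e v' e' by (elim disjE) (simp_all only: same_cycle_two)
  qed
  have "connected G" using connected_iff_conn[of G] chain2_conn[OF ch] by (simp add: G)
  then show ?thesis
    unfolding unicyclic_def
  proof (intro conjI allI impI exI)
    show "cycle G [u, v, u] [?e, ?f]" by (rule ex)
    fix vs es vs' es'
    assume c: "cycle G vs es" "cycle G vs' es'"
    show "same_cycle vs es vs' es'"
      using form[OF c(1)] form[OF c(2)] by (intro same) simp_all
  qed
qed

subsection \<open>Isomorphism\<close>

text \<open>Bijections between fibres of the same colour are glued. It is applied with the set of
  indices of the edges through a vertex as its colour.\<close>

lemma fibrewise_bij:
  assumes fin: "finite A" "finite B"
    and card: "\<And>c. card {x \<in> A. g x = c} = card {y \<in> B. h y = c}"
  obtains f where "bij_betw f A B" "\<And>x. x \<in> A \<Longrightarrow> h (f x) = g x"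
proof -
  have "\<exists>F. bij_betw F {x \<in> A. g x = c} {y \<in> B. h y = c}" for c
    by (rule finite_same_card_bij) (use fin card in auto)
  then obtain F where F: "\<And>c. bij_betw (F c) {x \<in> A. g x = c} {y \<in> B. h y = c}" by metis
  define f where "f x = F (g x) x" for x
  have f: "f x \<in> B" "h (f x) = g x" if "x \<in> A" for x
    using bij_betwE[OF F[of "g x"]] that by (auto simp: f_def)
  have "inj_on f A"
  proof (rule inj_onI)
    fix x y assume xy: "x \<in> A" "y \<in> A" "f x = f y"
    then have "g x = g y" using f by metis
    then show "x = y" using xy inj_onD[OF bij_betw_imp_inj_on[OF F[of "g x"]], of x y] by (simp add: f_def)
  qed
  moreover have "f ` A = B"
  proof
    show "f ` A \<subseteq> B" using f by blast
    show "B \<subseteq> f ` A"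
    proof
      fix y assume "y \<in> B"
      then have "y \<in> F (h y) ` {x \<in> A. g x = h y}" using bij_betw_imp_surj_on[OF F[of "h y"]] by blast
      then obtain x where x: "x \<in> A" "g x = h y" "y = F (h y) x" by blast
      then have "y = f x" by (simp add: f_def)
      then show "y \<in> f ` A" using x(1) by (rule image_eqI)
    qed
  qed
  ultimately show ?thesis using that[of f] f by (simp add: bij_betw_def)
qed

definition edge_indices :: "nat \<Rightarrow> (nat \<Rightarrow> 'a set) \<Rightarrow> 'a \<Rightarrow> nat set" where
  "edge_indices m p x = {i. i < m \<and> x \<in> p i}"

lemma chain2_edge_indices:
  assumes c: "chain2 K m a p" and x: "x \<in> p i" "i < m"
  shows "edge_indices m p x =
    (if Suc i < m \<and> x \<in> p (Suc i) then {i, Suc i} else if 0 < i \<and> x \<in> p (i - 1) then {i - 1, i} else {i})"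
proof -
  have near: "j \<le> Suc l \<and> l \<le> Suc j" if "x \<in> p j" "x \<in> p l" "j < m" "l < m" for j l
    using chain2_near[OF c that(3,4)] that(1,2) by blast
  have "j \<in> edge_indices m p x \<longleftrightarrow> j \<in> (if Suc i < m \<and> x \<in> p (Suc i) then {i, Suc i}
      else if 0 < i \<and> x \<in> p (i - 1) then {i - 1, i} else {i})" for j
  proof (cases "Suc i < m \<and> x \<in> p (Suc i)")
    case True
    then show ?thesis using near[of j i] near[of j "Suc i"] x by (auto simp: edge_indices_def)
  next
    case False
    note F = this
    show ?thesis
    proof (cases "0 < i \<and> x \<in> p (i - 1)")
      case True
      then obtain k where k: "i = Suc k" by (cases i) auto
      then show ?thesis using F True near[of j i] near[of j k] x by (auto simp: edge_indices_def)
    next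
      case False
      have "j = i" if "j < m" "x \<in> p j"
      proof -
        have "j = i \<or> j = Suc i \<or> Suc j = i" using near[of j i] that x by linarith
        then show ?thesis using F False that by auto
      qed
      then show ?thesis using F False x by (auto simp: edge_indices_def)
    qed
  qed
  then show ?thesis by blast
qed

text \<open>How many vertices lie in exactly the edges with index in \<open>I\<close>; these numbers depend on \<open>K\<close>, \<open>m\<close>
  and \<open>a\<close> only, so they determine a \<open>chain2\<close> up to isomorphism.\<close>

lemma chain2_card_cell:
  assumes c: "chain2 K m a p"
  defines "V \<equiv> \<Union>(p ` {..<m})"
  shows "i < m \<Longrightarrow> card {x \<in> V. edge_indices m p x = {i}} +
      (if Suc i < m then if i = a then 2 else 1 else 0) +
      (if 0 < i then if i - 1 = a then 2 else 1 else 0) = Suc K"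
    and "Suc i < m \<Longrightarrow> card {x \<in> V. edge_indices m p x = {i, Suc i}} = (if i = a then 2 else 1)"
    and "\<not> (\<exists>i<m. I = {i}) \<Longrightarrow> \<not> (\<exists>i. Suc i < m \<and> I = {i, Suc i}) \<Longrightarrow>
      {x \<in> V. edge_indices m p x = I} = {}"
proof -
  have mem: "x \<in> p i" if "edge_indices m p x = I" "i \<in> I" for x i I
    using that by (auto simp: edge_indices_def)
  have two: "{x \<in> V. edge_indices m p x = {i, Suc i}} = p i \<inter> p (Suc i)" if i: "Suc i < m" for i
  proof
    show "{x \<in> V. edge_indices m p x = {i, Suc i}} \<subseteq> p i \<inter> p (Suc i)" using mem by blast
    show "p i \<inter> p (Suc i) \<subseteq> {x \<in> V. edge_indices m p x = {i, Suc i}}"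
    proof
      fix x assume x: "x \<in> p i \<inter> p (Suc i)"
      then have "edge_indices m p x = {i, Suc i}" using chain2_edge_indices[OF c, of x i] i by simp
      then show "x \<in> {x \<in> V. edge_indices m p x = {i, Suc i}}" using x i by (auto simp: V_def)
    qed
  qed
  then show 2: "card {x \<in> V. edge_indices m p x = {i, Suc i}} = (if i = a then 2 else 1)" if "Suc i < m" for i
    using chain2_consec[OF c that] that by simp
  show "card {x \<in> V. edge_indices m p x = {i}} +
      (if Suc i < m then if i = a then 2 else 1 else 0) +
      (if 0 < i then if i - 1 = a then 2 else 1 else 0) = Suc K" if i: "i < m" for i
  proof -
    \<comment> \<open>The edge p i splits into its own vertices, the overlap with the next edge and
      the overlap with the previous one.\<close>
    let ?A = "{x \<in> V. edge_indices m p x = {i}}" and ?B = "if Suc i < m then p i \<inter> p (Suc i) else {}"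
      and ?C = "if 0 < i then p (i - 1) \<inter> p i else {}"
    have fin: "finite (p i)" by (rule chain2_finite_edge[OF c i])
    have sub: "?A \<subseteq> p i" "?B \<subseteq> p i" "?C \<subseteq> p i" using mem by auto
    have fins: "finite ?A" "finite ?B" "finite ?C" using sub fin by (meson finite_subset)+
    have "p i \<subseteq> ?A \<union> ?B \<union> ?C"
    proof
      fix x assume x: "x \<in> p i"
      then have "x \<in> V" using i by (auto simp: V_def)
      then show "x \<in> ?A \<union> ?B \<union> ?C" using chain2_edge_indices[OF c x i] x by (auto split: if_splits)
    qed
    then have U: "p i = ?A \<union> ?B \<union> ?C" using sub by blast
    have iB: "edge_indices m p x = {i, Suc i}" if "x \<in> ?B" for x
      using chain2_edge_indices[OF c, of x i] that i by (auto split: if_splits)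
    have iC: "i - 1 \<in> edge_indices m p x" "0 < i" if "x \<in> ?C" for x
      using that i by (auto simp: edge_indices_def split: if_splits)
    have AB: "?A \<inter> ?B = {}" using iB by force
    have ABC: "(?A \<union> ?B) \<inter> ?C = {}"
    proof (rule equals0I)
      fix x assume x: "x \<in> (?A \<union> ?B) \<inter> ?C"
      then have "edge_indices m p x = {i} \<or> edge_indices m p x = {i, Suc i}" using iB by blast
      moreover have "i - 1 \<in> edge_indices m p x" "0 < i" using iC[of x] x by blast+
      ultimately show False by auto
    qed
    have "card (p i) = card (?A \<union> ?B \<union> ?C)" by (rule arg_cong[OF U])
    also have "\<dots> = card (?A \<union> ?B) + card ?C"
      by (rule card_Un_disjoint[OF finite_UnI[OF fins(1,2)] fins(3) ABC])
    also have "card (?A \<union> ?B) = card ?A + card ?B" by (rule card_Un_disjoint[OF fins(1,2) AB])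
    finally have "card (p i) = card ?A + card ?B + card ?C" .
    moreover have "card ?B = (if Suc i < m then if i = a then 2 else 1 else 0)"
      using chain2_consec[OF c, of i] by simp
    moreover have "card ?C = (if 0 < i then if i - 1 = a then 2 else 1 else 0)"
    proof (cases i)
      case (Suc k)
      then show ?thesis using chain2_consec[OF c, of k] i by simp
    qed simp
    ultimately show ?thesis using chain2_card_edge[OF c i] by simp
  qed
  show "{x \<in> V. edge_indices m p x = I} = {}"
    if n1: "\<not> (\<exists>i<m. I = {i})" and n2: "\<not> (\<exists>i. Suc i < m \<and> I = {i, Suc i})"
  proof (rule equals0I)
    fix x assume "x \<in> {x \<in> V. edge_indices m p x = I}"
    then obtain i where i: "i < m" "x \<in> p i" and I: "edge_indices m p x = I" by (auto simp: V_def)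
    show False
    proof (cases "Suc i < m \<and> x \<in> p (Suc i)")
      case True
      then show False using chain2_edge_indices[OF c i(2,1)] I n2 by auto
    next
      case False
      note F = this
      show False
      proof (cases "0 < i \<and> x \<in> p (i - 1)")
        case True
        then have "I = {i - 1, Suc (i - 1)}" "Suc (i - 1) < m" using chain2_edge_indices[OF c i(2,1)] I F i by auto
        then show False using n2 by blast
      next
        case False
        then have "I = {i}" using chain2_edge_indices[OF c i(2,1)] I F by auto
        then show False using n1 i(1) by blast
      qed
    qed
  qed
qed

lemma chain2_isomorphic:
  assumes p: "chain2 K m a p" and q: "chain2 K m a q"
  obtains f where "bij_betw f (\<Union>(p ` {..<m})) (\<Union>(q ` {..<m}))" "\<And>i. i < m \<Longrightarrow> f ` p i = q i"
proof -
  let ?V = "\<Union>(p ` {..<m})" and ?W = "\<Union>(q ` {..<m})"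
  have fin: "finite ?V" "finite ?W" using chain2_finite_edge[OF p] chain2_finite_edge[OF q] by auto
  have "card {x \<in> ?V. edge_indices m p x = I} = card {y \<in> ?W. edge_indices m q y = I}" for I
  proof (cases "\<exists>i<m. I = {i}")
    case True
    then obtain i where i: "i < m" "I = {i}" by blast
    show ?thesis unfolding i(2) using chain2_card_cell(1)[OF p i(1)] chain2_card_cell(1)[OF q i(1)] by linarith
  next
    case False
    note F = this
    show ?thesis
    proof (cases "\<exists>i. Suc i < m \<and> I = {i, Suc i}")
      case True
      then obtain i where i: "Suc i < m" "I = {i, Suc i}" by blast
      show ?thesis unfolding i(2) chain2_card_cell(2)[OF p i(1)] chain2_card_cell(2)[OF q i(1)] ..
    next
      case False
      then show ?thesis
        using chain2_card_cell(3)[OF p F False] chain2_card_cell(3)[OF q F False] by (simp only: card.empty)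
    qed
  qed
  then obtain f where f: "bij_betw f ?V ?W" "\<And>x. x \<in> ?V \<Longrightarrow> edge_indices m q (f x) = edge_indices m p x"
    by (rule fibrewise_bij[OF fin]) blast
  have "f ` p i = q i" if i: "i < m" for i
  proof
    show "f ` p i \<subseteq> q i"
    proof
      fix y assume "y \<in> f ` p i"
      then obtain x where x: "x \<in> p i" "y = f x" by blast
      then have "x \<in> ?V" using i by blast
      moreover have "i \<in> edge_indices m p x" using x i by (simp add: edge_indices_def)
      ultimately have "i \<in> edge_indices m q (f x)" using f(2) by simp
      then show "y \<in> q i" using x by (simp add: edge_indices_def)
    qed
    show "q i \<subseteq> f ` p i"
    proof
      fix y assume y: "y \<in> q i"
      then have "y \<in> f ` ?V" using f(1) i by (auto simp: bij_betw_def)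
      then obtain x where x: "x \<in> ?V" "y = f x" by blast
      have "i \<in> edge_indices m q y" using y i by (simp add: edge_indices_def)
      then have "i \<in> edge_indices m p x" using f(2)[OF x(1)] x(2) by simp
      then show "y \<in> f ` p i" using x by (simp add: edge_indices_def)
    qed
  qed
  then show ?thesis using that f(1) by blast
qed

section \<open>Edge sequences under injections and attached paths\<close>

lemma chain2_image:
  assumes c: "chain2 K m a p" and f: "inj_on f (\<Union>(p ` {..<m}))"
  shows "chain2 K m a (\<lambda>i. f ` p i)"
proof -
  have sub: "p i \<subseteq> \<Union>(p ` {..<m})" if "i < m" for i using that by blast
  have "card (f ` p i) = card (p i)" if "i < m" for i
    by (rule card_image[OF inj_on_subset[OF f sub[OF that]]])
  moreover have int: "f ` p i \<inter> f ` p j = f ` (p i \<inter> p j)" if "i < m" "j < m" for i j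
    by (rule inj_on_image_Int[OF f sub[OF that(1)] sub[OF that(2)], symmetric])
  moreover have "card (f ` (p i \<inter> p j)) = card (p i \<inter> p j)" if "i < m" for i j
    by (rule card_image[OF inj_on_subset[OF f]]) (use sub[OF that] in blast)
  ultimately show ?thesis using c unfolding chain2_def by simp
qed

text \<open>As w avoids \<open>p (m - 2)\<close>, it lies in no edge before the last one. So the new
  edge meets only the last edge, and only in w.\<close>

lemma chain2_extend:
  assumes c: "chain2 K m a p" and w: "w \<in> p (m - 1)" "w \<notin> p (m - 2)"
    and Y: "Y \<inter> \<Union>(p ` {..<m}) = {}" "card Y = K" and K: "0 < K"
  shows "chain2 K (Suc m) a (p(m := insert w Y))"
proof -
  note a = chain2_index[OF c]
  let ?p = "p(m := insert w Y)"
  have fY: "finite Y" using Y K by (metis card.infinite less_numeral_extra(3))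
  have YI: "Y \<inter> p i = {}" if "i < m" for i using Y that by blast
  have wY: "w \<notin> Y" using YI[of "m - 1"] w a by auto
  have far: "p i \<inter> insert w Y = {}" if "Suc i < m" for i
  proof -
    have "w \<notin> p i"
    proof (cases "Suc (Suc i) = m")
      case True
      then have "i = m - 2" by simp
      then show ?thesis using w by simp
    next
      case False
      then have "p i \<inter> p (m - 1) = {}" using chain2_far[OF c, of i "m - 1"] that by simp
      then show ?thesis using w by blast
    qed
    then show ?thesis using YI[of i] that by auto
  qed
  have last: "p (m - 1) \<inter> insert w Y = {w}" using w YI[of "m - 1"] a by auto
  show ?thesis
    unfolding chain2_def
  proof (intro conjI allI impI)
    show "Suc a < Suc m" using a by simp
    show "card (?p i) = Suc K" if "i < Suc m" for i
      using chain2_card_edge[OF c, of i] that fY wY Y(2) by (cases "i = m") auto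
    show "?p i \<inter> ?p j = {}" if "Suc i < j" "j < Suc m" for i j
      using chain2_far[OF c that(1)] far[of i] that by (cases "j = m") auto
    show "card (?p i \<inter> ?p (Suc i)) = (if i = a then 2 else 1)" if "Suc i < Suc m" for i
    proof (cases "Suc i = m")
      case True
      then have i: "i = m - 1" "i \<noteq> a" "i \<noteq> m" using a by auto
      then have "?p i \<inter> ?p (Suc i) = {w}" using last True by simp
      then show ?thesis using i by simp
    next
      case False
      then show ?thesis using chain2_consec[OF c, of i] that by simp
    qed
  qed
qed

lemma chain2_attach_path:
  assumes c: "chain2 K m a p" and G: "verts G = \<Union>(p ` {..<m})" "edges G = p ` {..<m}" and K: "0 < K"
    and w: "w \<in> p (m - 1)" "w \<notin> p (m - 2)"
    and y: "\<And>i j i' j'. y i j = y i' j' \<Longrightarrow> i = i' \<and> j = j'" "\<And>i j. y i j \<notin> verts G"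
  shows "\<exists>p'. chain2 K (m + r) a p' \<and> verts (attach_path (Suc K) w y r G) = \<Union>(p' ` {..<m + r}) \<and>
    edges (attach_path (Suc K) w y r G) = p' ` {..<m + r} \<and> (\<forall>i<m. p' i = p i)"
proof -
  let ?G = "\<lambda>r. attach_path (Suc K) w y r G" and ?w = "\<lambda>r. if r = 0 then w else y r 0"
  note a = chain2_index[OF c]
  \<comment> \<open>The induction also carries the tip of the path, which lies in the last edge but
    not in the one before, as \<open>chain2_extend\<close> demands.\<close>
  have "\<exists>p'. chain2 K (m + r) a p' \<and> verts (?G r) = \<Union>(p' ` {..<m + r}) \<and>
    edges (?G r) = p' ` {..<m + r} \<and> (\<forall>i<m. p' i = p i) \<and> ?w r \<in> p' (m + r - 1) \<and> ?w r \<notin> p' (m + r - 2)"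
  proof (induction r)
    case 0
    show ?case using c G w by (intro exI[of _ p]) (simp add: attach_path_def)
  next
    case (Suc r)
    then obtain p' where p': "chain2 K (m + r) a p'" "verts (?G r) = \<Union>(p' ` {..<m + r})"
      "edges (?G r) = p' ` {..<m + r}" "\<forall>i<m. p' i = p i" "?w r \<in> p' (m + r - 1)" "?w r \<notin> p' (m + r - 2)"
      by blast
    let ?Y = "pendant_block (Suc K) y (Suc r)"
    let ?q = "p'(m + r := insert (?w r) ?Y)"
    have Y: "?Y = y (Suc r) ` {..<K}" by (simp add: pendant_block_def)
    have "inj_on (y (Suc r)) {..<K}" by (rule inj_onI) (use y(1) in blast)
    then have cY: "card ?Y = K" unfolding Y by (simp add: card_image)
    have new: "y (Suc r) j \<notin> verts (?G r)" for j
      using y(2)[of "Suc r" j] y(1)[of "Suc r" j] by (fastforce simp: attach_path_def pendant_block_def)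
    then have disj: "?Y \<inter> \<Union>(p' ` {..<m + r}) = {}" unfolding Y p'(2)[symmetric] by blast
    have ch: "chain2 K (Suc (m + r)) a ?q" by (rule chain2_extend[OF p'(1,5,6) disj cY K])
    have edge: "pendant_edge (Suc K) w y (Suc r) = insert (?w r) ?Y" by (auto simp: pendant_edge_def)
    have im: "?q ` {..<Suc (m + r)} = insert (insert (?w r) ?Y) (p' ` {..<m + r})"
      by (auto simp: lessThan_Suc)
    have "edges (?G (Suc r)) = insert (pendant_edge (Suc K) w y (Suc r)) (edges (?G r))"
      by (simp add: attach_path_def atLeastAtMostSuc_conv)
    then have E: "edges (?G (Suc r)) = ?q ` {..<Suc (m + r)}" unfolding im edge p'(3) .
    have "?w r \<in> verts (?G r)" using p'(5) a unfolding p'(2) by fastforce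
    moreover have "verts (?G (Suc r)) = verts (?G r) \<union> ?Y"
      by (auto simp: attach_path_def atLeastAtMostSuc_conv)
    ultimately have "verts (?G (Suc r)) = insert (?w r) ?Y \<union> verts (?G r)" by blast
    then have V: "verts (?G (Suc r)) = \<Union>(?q ` {..<Suc (m + r)})" unfolding im Union_insert p'(2) .
    have "y (Suc r) 0 \<in> ?Y" using K unfolding Y by blast
    moreover have "y (Suc r) 0 \<notin> p' (m + r - 1)"
    proof
      assume "y (Suc r) 0 \<in> p' (m + r - 1)"
      moreover have "m + r - 1 < m + r" using a by simp
      ultimately have "y (Suc r) 0 \<in> verts (?G r)" unfolding p'(2) by blast
      then show False using new by blast
    qed
    moreover have "m + r - 1 \<noteq> m + r" using a by simp
    ultimately have 1: "y (Suc r) 0 \<in> ?q (m + r)" "y (Suc r) 0 \<notin> ?q (m + r - 1)" "\<forall>i<m. ?q i = p i"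
      using p'(4) by simp_all
    have "m + Suc r = Suc (m + r)" "m + Suc r - 1 = m + r" "m + Suc r - 2 = m + r - 1" by simp_all
    then show ?case using ch E V 1 by (intro exI[of _ ?q]) (simp only: nat.distinct if_False, blast)
  qed
  then show ?thesis by blast
qed

text \<open>Edges are appended at the end of a sequence only. So the path of length a is attached to
  the sequence f, e; reversal then moves the doubled pair from position 0 to a and puts f last,
  ready for the path of length b.\<close>

lemma C2_tilde_chain2:
  assumes K: "2 \<le> K"
  obtains q where "chain2 K (a + b + 2) a q" "verts (C2_tilde (Suc K) a b) = \<Union>(q ` {..<a + b + 2})"
    "edges (C2_tilde (Suc K) a b) = q ` {..<a + b + 2}"
proof -
  let ?e = "{VU, VV} \<union> VW ` {1..K - 1}" and ?f = "{VU, VV} \<union> VW' ` {1..K - 1}"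
  have base: "verts (C2_base (Suc K)) = ?e \<union> ?f" "edges (C2_base (Suc K)) = {?e, ?f}"
    by (simp_all add: C2_base_def Let_def)
  define p where "p i = (if i = (0::nat) then ?f else ?e)" for i
  have im: "p ` {..<2} = {?f, ?e}" by (auto simp: p_def numeral_2_eq_2 lessThan_Suc)
  have c1: "card (VW ` {1..K - 1}) = K - 1" "card (VW' ` {1..K - 1}) = K - 1"
    by (simp_all add: card_image inj_on_def)
  have "card ?e = card {VU, VV} + card (VW ` {1..K - 1})" by (rule card_Un_disjoint) auto
  then have ce: "card ?e = Suc K" using c1 K by simp
  have "card ?f = card {VU, VV} + card (VW' ` {1..K - 1})" by (rule card_Un_disjoint) auto
  then have cf: "card ?f = Suc K" using c1 K by simp
  have "?f \<inter> ?e = {VU, VV}" by auto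
  then have ci: "card (?f \<inter> ?e) = 2" by simp
  have p: "chain2 K 2 0 p" unfolding chain2_def p_def using ce cf ci by auto
  have in1: "VW 1 \<in> ?e" "VW 1 \<notin> ?f" "VW' 1 \<in> ?f" "VW' 1 \<notin> ?e" using K by auto
  let ?G = "attach_path (Suc K) (VW 1) VY a (C2_base (Suc K))"
  have "\<exists>p'. chain2 K (2 + a) 0 p' \<and> verts ?G = \<Union>(p' ` {..<2 + a}) \<and>
    edges ?G = p' ` {..<2 + a} \<and> (\<forall>i<2. p' i = p i)"
    by (rule chain2_attach_path[OF p]) (use K base im in1 in \<open>auto simp: p_def\<close>)
  then obtain p' where p': "chain2 K (2 + a) 0 p'" "verts ?G = \<Union>(p' ` {..<2 + a})"
    "edges ?G = p' ` {..<2 + a}" "\<forall>i<2. p' i = p i" by (elim exE conjE) (rule that)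
  let ?r = "\<lambda>i. p' (2 + a - 1 - i)"
  have r: "chain2 K (2 + a) a ?r" using chain2_rev[OF p'(1)] by simp
  have imr: "?r ` {..<2 + a} = p' ` {..<2 + a}" by (rule image_rev_lessThan)
  have r1: "?r (2 + a - 1) = ?f" "?r (2 + a - 2) = ?e" using p'(4) by (simp_all add: p_def)
  have "VY' i j \<notin> verts ?G" for i j unfolding attach_path_def base by (auto simp: pendant_block_def base)
  then have "\<exists>q. chain2 K (2 + a + b) a q \<and>
    verts (attach_path (Suc K) (VW' 1) VY' b ?G) = \<Union>(q ` {..<2 + a + b}) \<and>
    edges (attach_path (Suc K) (VW' 1) VY' b ?G) = q ` {..<2 + a + b} \<and> (\<forall>i<2 + a. q i = ?r i)"
    using p'(2,3) K r1 in1 by (intro chain2_attach_path[OF r]) (simp_all only: imr, auto)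
  then obtain q where "chain2 K (2 + a + b) a q" "verts (C2_tilde (Suc K) a b) = \<Union>(q ` {..<2 + a + b})"
    "edges (C2_tilde (Suc K) a b) = q ` {..<2 + a + b}"
    unfolding C2_tilde_def[symmetric] by (elim exE conjE) (rule that)
  moreover have "2 + a + b = a + b + 2" by simp
  ultimately show ?thesis using that by metis
qed

section \<open>Vertex count in the presence of a cycle, and the comparison\<close>

text \<open>Along the cycle each edge after the first brings at most K new vertices, and the last
  one at most K - 1, since both of its cycle vertices are already covered. This cancels the extra
  vertex of the first edge; \<open>card_verts_growth\<close> handles the edges off the
  cycle.\<close>

lemma cycle_card_verts:
  assumes ks: "ksys K (edges G)" and c: "cycle G vs es"
  shows "card (\<Union>(edges G)) \<le> card (edges G) * K"
proof -
  interpret ksys K "edges G" by (rule ks)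
  let ?q = "length es"
  have w: "length vs = Suc ?q" "set es \<subseteq> edges G"
    "\<And>i. i < ?q \<Longrightarrow> vs ! i \<noteq> vs ! Suc i \<and> vs ! i \<in> es ! i \<and> vs ! Suc i \<in> es ! i"
    and q: "2 \<le> ?q" and di: "distinct es" and hl: "hd vs = last vs"
    using c by (auto simp: cycle_def walk_def)
  have vs0: "vs ! 0 = vs ! ?q" using hl w(1) by (metis diff_Suc_1 hd_conv_nth last_conv_nth list.size(3) nat.distinct(1))
  let ?U = "\<lambda>j. \<Union>(set (take j es))"
  have E: "es ! j \<in> edges G" if "j < ?q" for j using w(2) that by (auto dest: nth_mem)
  have finU: "finite (?U j)" for j using fin_edge w(2) set_take_subset[of j es] by blast
  have step: "card (?U (Suc j)) + card (?U j \<inter> es ! j) = card (?U j) + Suc K" if j: "j < ?q" for j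
  proof -
    have "?U (Suc j) = ?U j \<union> es ! j" using j by (simp add: take_Suc_conv_app_nth Un_commute)
    then show ?thesis
      using card_Un_Int[OF finU fin_edge[OF E[OF j]], of j] card_edge[OF E[OF j]] by simp
  qed
  have prev: "vs ! Suc j \<in> ?U (Suc j)" if j: "j < ?q" for j
  proof -
    have "vs ! Suc j \<in> es ! j" using w(3)[OF j] by blast
    moreover have "es ! j \<in> set (take (Suc j) es)" using j by (simp add: take_Suc_conv_app_nth)
    ultimately show ?thesis by blast
  qed
  have bound: "Suc j \<le> ?q \<Longrightarrow> card (?U (Suc j)) \<le> Suc j * K + 1" for j
  proof (induction j)
    case 0
    then have "0 < ?q" by linarith
    from step[OF this] show ?case by simp
  next
    case (Suc j)
    have j: "Suc j < ?q" "j < ?q" using Suc.prems by simp_all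
    have "vs ! Suc j \<in> ?U (Suc j) \<inter> es ! Suc j" using prev[OF j(2)] w(3)[OF j(1)] by blast
    then have "card (?U (Suc j) \<inter> es ! Suc j) \<noteq> 0" using finU[of "Suc j"] by auto
    then show ?case using Suc.IH step[OF j(1)] j by simp
  qed
  obtain t where t: "?q = Suc (Suc t)" using q by (metis add_2_eq_Suc le_Suc_ex)
  have tl: "Suc t < ?q" "t < ?q" using t by simp_all
  have "vs ! Suc t \<in> ?U (Suc t) \<inter> es ! Suc t" using prev[OF tl(2)] w(3)[OF tl(1)] by blast
  moreover have "vs ! Suc (Suc t) \<in> ?U (Suc t) \<inter> es ! Suc t"
  proof -
    have "0 < ?q" using t by simp
    then have "vs ! 0 \<in> es ! 0" using w(3) by blast
    moreover have "es ! 0 \<in> set (take (Suc t) es)" using t by (cases es) auto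
    ultimately have "vs ! Suc (Suc t) \<in> ?U (Suc t)" using vs0 t by auto
    then show ?thesis using w(3)[OF tl(1)] by blast
  qed
  ultimately have "card {vs ! Suc t, vs ! Suc (Suc t)} \<le> card (?U (Suc t) \<inter> es ! Suc t)"
    using finU[of "Suc t"] by (intro card_mono) auto
  moreover have "vs ! Suc t \<noteq> vs ! Suc (Suc t)" using w(3)[OF tl(1)] by blast
  ultimately have "2 \<le> card (?U (Suc t) \<inter> es ! Suc t)" by simp
  then have "card (?U (Suc (Suc t))) \<le> Suc (Suc t) * K"
    using bound[of t] step[OF tl(1)] tl by simp
  then have F: "card (\<Union>(set es)) \<le> ?q * K" using t by (metis order_refl take_all)
  have ne: "set es \<noteq> {}" using q by auto
  have ce: "card (edges G - set es) + ?q = card (edges G)"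
    using card_Diff_subset[of "set es" "edges G"] w(2) fin distinct_card[OF di] card_mono[OF fin w(2)] by simp
  have "card (\<Union>(edges G)) \<le> card (\<Union>(set es)) + K * card (edges G - set es)"
    by (rule card_verts_growth[OF w(2) ne])
  also have "\<dots> \<le> ?q * K + K * card (edges G - set es)" using F by simp
  also have "\<dots> = card (edges G) * K" unfolding ce[symmetric] by (simp add: algebra_simps)
  finally show ?thesis .
qed

text \<open>An isolated vertex could not be joined to a second vertex, which e provides. This
  justifies working with edge sets alone.\<close>

lemma Union_edges_eq_verts:
  assumes G: "hypergraph G" "connected G" and e: "e \<in> edges G" "2 \<le> card e"
  shows "\<Union>(edges G) = verts G"
proof
  show "\<Union>(edges G) \<subseteq> verts G" using G by (auto simp: hypergraph_def)
  show "verts G \<subseteq> \<Union>(edges G)"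
  proof
    fix v assume v: "v \<in> verts G"
    have "\<not> e \<subseteq> {v}"
    proof
      assume "e \<subseteq> {v}"
      then have "card e \<le> card {v}" by (intro card_mono) auto
      then show False using e by simp
    qed
    then obtain u where u: "u \<in> e" "u \<noteq> v" by blast
    then have "u \<in> verts G" using G e by (auto simp: hypergraph_def)
    then obtain vs es where p: "path_between G v u vs es" using G(2) v unfolding connected_def by blast
    then have w: "walk G vs es" "hd vs = v" "last vs = u" by (auto simp: path_between_def path_def)
    then have l: "length vs = Suc (length es)" by (simp add: walk_def)
    have "es \<noteq> []"
    proof
      assume "es = []"
      then obtain x where "vs = [x]" using l by (auto simp: length_Suc_conv)
      then show False using w u by simp
    qed
    then have "0 < length es" by simp
    then have "vs ! 0 \<in> es ! 0" "es ! 0 \<in> edges G" using w(1) nth_mem[of 0 es] by (auto simp: walk_def)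
    moreover have "vs ! 0 = v" using w(2) l by (metis hd_conv_nth list.size(3) nat.distinct(1))
    ultimately show "v \<in> \<Union>(edges G)" by blast
  qed
qed

text \<open>Competitors have natural numbers as vertices, so the example on \<open>c2_vertex\<close>
  is copied along an injection.\<close>

lemma ex_nat_extremal:
  assumes K: "2 \<le> K"
  obtains H :: "nat hypergraph" where "hypergraph H" "uniform (Suc K) H" "unicyclic H" "hsize H = n + 2"
    "cyc_bound K n \<le> 2 * int (transmission H)"
proof -
  have n: "n div 2 + (n + 1) div 2 = n" by simp
  obtain q :: "nat \<Rightarrow> c2_vertex set" where q: "chain2 K (n + 2) (n div 2) q"
    by (rule C2_tilde_chain2[OF K, of "n div 2" "(n + 1) div 2", unfolded n]) (rule that)
  let ?V = "\<Union>(q ` {..<n + 2})"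
  have "finite ?V" using chain2_finite_edge[OF q] by auto
  then obtain f :: "c2_vertex \<Rightarrow> nat" where "inj_on f ?V" using finite_imp_inj_to_nat_seg by metis
  then have r: "chain2 K (n + 2) (n div 2) (\<lambda>i. f ` q i)" by (rule chain2_image[OF q])
  define p where "p i = f ` q i" for i
  have p: "chain2 K (n + 2) (n div 2) p" using r by (simp add: p_def[abs_def])
  define H where "H = \<lparr>verts = \<Union>(p ` {..<n + 2}), edges = p ` {..<n + 2}\<rparr>"
  have H: "verts H = \<Union>(p ` {..<n + 2})" "edges H = p ` {..<n + 2}" by (simp_all add: H_def)
  have fin: "finite (verts H)" unfolding H using chain2_finite_edge[OF p] by auto
  have "card (p 0) = Suc K" using chain2_card_edge[OF p, of 0] by simp
  then have "p 0 \<noteq> {}" by auto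
  then have "verts H \<noteq> {}" unfolding H by auto
  then have "hypergraph H" unfolding hypergraph_def using fin by (auto simp: H)
  moreover have "uniform (Suc K) H" unfolding uniform_def H using chain2_card_edge[OF p] by auto
  moreover have "unicyclic H" unfolding H_def by (rule chain2_unicyclic[OF p K])
  moreover have "hsize H = n + 2" unfolding hsize_def H using card_image[OF chain2_inj[OF p K]] by simp
  moreover have "2 * transmission H = wien (edges H)"
    by (rule transmission_wien) (use fin chain2_conn[OF p] H in simp_all)
  then have "cyc_bound K n \<le> 2 * int (transmission H)"
    using chain2_wien_ge[OF p K] by (simp add: H)
  ultimately show ?thesis by (rule that)
qed

theorem theorem3p5:
  fixes G :: "'a hypergraph" and k m :: nat
  assumes "k \<ge> 3" and "m \<ge> 2"
    and "hypergraph G" and "uniform k G" and "unicyclic G" and "hsize G = m"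
    and "\<And>H :: nat hypergraph.
           hypergraph H \<Longrightarrow> uniform k H \<Longrightarrow> unicyclic H \<Longrightarrow> hsize H = m \<Longrightarrow>
           transmission H \<le> transmission G"
  shows "isomorphic G
           (C2_tilde k (nat \<lfloor>(real m - 2) / 2\<rfloor>) (nat \<lceil>(real m - 2) / 2\<rceil>))"
proof -
  obtain K where k: "k = Suc K" using assms(1) by (cases k) auto
  then have K: "2 \<le> K" using assms(1) by simp
  obtain n where m: "m = n + 2" using assms(2) by (metis add.commute le_Suc_ex)
  have fE: "finite (edges G)"
    using assms(3) unfolding hypergraph_def by (meson finite_Pow_iff finite_subset)
  have cE: "card (edges G) = n + 2" using assms(6) m by (simp add: hsize_def)
  have ce: "card e = Suc K" if "e \<in> edges G" for e using assms(4) that k by (simp add: uniform_def)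
  obtain e where e: "e \<in> edges G" using cE by fastforce
  have conG: "connected G" using assms(5) by (simp add: unicyclic_def)
  have V: "\<Union>(edges G) = verts G"
    by (rule Union_edges_eq_verts[OF assms(3) conG e]) (use ce[OF e] K in simp)
  have con: "conn (edges G)" using connected_iff_conn[OF V] conG by simp
  have ks: "ksys K (edges G)" by unfold_locales (use fE con ce in auto)
  obtain vs es where "cycle G vs es" using assms(5) by (auto simp: unicyclic_def)
  then have N: "card (\<Union>(edges G)) \<le> card (edges G) * K" by (rule cycle_card_verts[OF ks])
  have T: "2 * transmission G = wien (edges G)"
    by (rule transmission_wien[OF con V]) (use assms(3) in \<open>simp add: hypergraph_def\<close>)
  obtain H :: "nat hypergraph" where H: "hypergraph H" "uniform (Suc K) H" "unicyclic H" "hsize H = n + 2"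
    "cyc_bound K n \<le> 2 * int (transmission H)" by (rule ex_nat_extremal[OF K])
  have "transmission H \<le> transmission G" using assms(7) H k m by simp
  then have ge: "cyc_bound K n \<le> int (wien (edges G))" using H(5) T by linarith
  note main = wien_le_cyc_bound[OF ks K cE N]
  then have "int (wien (edges G)) = cyc_bound K n" using ge by linarith
  then obtain a p where p: "chain2 K (n + 2) a p" "edges G = p ` {..<n + 2}"
    and a: "a = n div 2 \<or> a = (n + 1) div 2" using main by blast
  have "\<exists>p. chain2 K (n + 2) (n div 2) p \<and> edges G = p ` {..<n + 2}"
  proof (cases "a = n div 2")
    case True
    then show ?thesis using p by blast
  next
    case False
    \<comment> \<open>Reversal moves the doubled pair from (n + 1) div 2 to n div 2, its position in
      the sequence of \<open>C2_tilde\<close>.\<close>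
    then have "n + 2 - 2 - a = n div 2" using a by simp
    then show ?thesis using chain2_rev[OF p(1)] image_rev_lessThan[of p "n + 2"] p(2) by metis
  qed
  then obtain p where p: "chain2 K (n + 2) (n div 2) p" "edges G = p ` {..<n + 2}" by blast
  have n: "n div 2 + (n + 1) div 2 = n" by simp
  let ?C = "C2_tilde (Suc K) (n div 2) ((n + 1) div 2)"
  obtain q where q: "chain2 K (n + 2) (n div 2) q" "verts ?C = \<Union>(q ` {..<n + 2})" "edges ?C = q ` {..<n + 2}"
    by (rule C2_tilde_chain2[OF K, of "n div 2" "(n + 1) div 2", unfolded n])
  obtain f where f: "bij_betw f (\<Union>(p ` {..<n + 2})) (\<Union>(q ` {..<n + 2}))" "\<forall>i<n + 2. f ` p i = q i"
    by (rule chain2_isomorphic[OF p(1) q(1)]) blast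
  have "bij_betw f (verts G) (verts ?C)" using f(1) V p(2) q(2) by simp
  moreover have "(\<lambda>e. f ` e) ` edges G = edges ?C" unfolding p(2) q(3) image_image using f(2) by simp
  ultimately have "isomorphic G ?C" unfolding isomorphic_def by blast
  moreover have "nat \<lfloor>(real m - 2) / 2\<rfloor> = n div 2"
  proof -
    have "(real m - 2) / 2 = real n / real 2" unfolding m by simp
    then show ?thesis by (simp only: floor_divide_of_nat_eq nat_int)
  qed
  moreover have "nat \<lceil>(real m - 2) / 2\<rceil> = (n + 1) div 2"
  proof -
    have "\<lceil>real n / 2\<rceil> = int ((n + 1) div 2)" by (rule ceiling_unique) linarith+
    then show ?thesis unfolding m by simp
  qed
  ultimately show ?thesis unfolding k by simp
qed

end
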